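(* Let $\Omega$ be a rectangle with periodic boundary conditions, partitioned by a conforming mesh of axis-parallel rectangular elements $K$ in the two active coordinates. Assume that $w>0$ at every volume and face Gauss--Legendre--Lobatto (GLL) node, that all nodal states are admissible, and that the prescribed geometry is single-valued at shared faces. Suppose that on every element $K$ the nodal values $\mathbb W_{ij}(t)$, $0\le i,j\le N$, satisfy the semidiscrete scheme $$\dot{\mathbb W}_{ij}+2\kappa_1\sum_{m=0}^N\mathsf D_{im}\mathcal H^{1,\mathrm{EC}}_{(i,j),(m,j)}+2\kappa_2\sum_{m=0}^N\mathsf D_{jm}\mathcal H^{2,\mathrm{EC}}_{(i,j),(i,m)}+\frac{\kappa_1\mathsf B_{ii}}{\omega_i}\bigl(\widehat{\mathbb H}^{1,\mathrm{LLF}}_{ij}-\mathbb H^1_{ij}\bigr)+\frac{\kappa_2\mathsf B_{jj}}{\omega_j}\bigl(\widehat{\mathbb H}^{2,\mathrm{LLF}}_{ij}-\mathbb H^2_{ij}\bigr)=\mathbb S^h_{ij},$$ where the interface flux is the local Lax--Friedrichs flux with the geometry-only causal speed $a_f=|\beta^In_I|+\alpha\sqrt{\gamma^{IJ}n_In_J}$. Then the total discrete entropy $$\mathcal E_h(t)=\sum_K J_K\sum_{i,j=0}^N\omega_i\omega_j\,(wj_2\widehat\eta)_{ij}$$ satisfies $$\frac{d\mathcal E_h}{dt}\le 0,$$ and the global weighted rest mass $\sum_KJ_K\sum_{i,j=0}^N\omega_i\omega_j\,(wj_2D)_{ij}$ is constant in time.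
   Context: Indices $I,J\in\{1,2\}$ (active coordinates) and $a,b\in\{1,2\}$ (orthonormal components); repeated indices are summed unless stated otherwise. Fluid state. Fix $1<\Gamma\le 2$. For $\rho>0$, $p>0$, $\widehat v\in\mathbb R^2$ with $|\widehat v|<1$ put $L=(1-|\widehat v|^2)^{-1/2}$, $h=1+\frac{\Gamma p}{(\Gamma-1)\rho}$, $D=\rho L$, $\widehat m=\rho hL^2\widehat v$, $E=\rho hL^2-p$, $\widehat U=(D,\widehat m_1,\widehat m_2,E)^T$ and $\widehat F^a=(D\widehat v_a,\ \widehat m_1\widehat v_a+p\delta_{1a},\ \widehat m_2\widehat v_a+p\delta_{2a},\ \widehat m_a)^T$. Such states $\widehat U$ are called admissible; $(\rho,\widehat v,p)$ is uniquely determined by $\widehat U$. With $s=\log p-\Gamma\log\rho$ and $\zeta=\rho/p$, put $\widehat\eta=-Ds/(\Gamma-1)$, $V=\nabla_{\widehat U}\widehat\eta=\bigl(\frac{\Gamma-s}{\Gamma-1}+\zeta,\ \zeta L\widehat v_1,\ \zeta L\widehat v_2,\ -\zeta L\bigr)^T$, $\Phi=D$, $\psi_a=D\widehat v_a$. Geometry. Prescribed smooth time-independent functions of the active coordinates $(x^1,x^2)$ are given: lapse $\alpha>0$, shift $\beta^I$, symmetric positive definite metric $\gamma_{IJ}$ (inverse $\gamma^{IJ}$), and scalar weight $w$. Set $j_2=\sqrt{\det(\gamma_{IJ})}$; $\Theta$ is the upper-triangular matrix with positive diagonal such that $\Theta^T\Theta=(\gamma_{IJ})^{-1}$; $A_{aI}=\alpha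 j_2\Theta_{aI}$ (so $A_{21}=0$), $C^I=j_2\beta^I$, $\mathcal A_{aI}=wA_{aI}$, $\mathcal C^I=wC^I$. The evolved state is $\mathbb W=wj_2\widehat U$ (so $\widehat U=\mathbb W/(wj_2)$ where $w>0$); $\mathbb W$ is admissible when $\widehat U$ is. The flux is $\mathbb H^I=\mathcal A_{aI}\widehat F^a-\mathcal C^I\widehat U$. Continuous source coefficients. Let $\mu,\nu\in\{0,1,2\}$ with $x^0=t$, $g_{00}=-\alpha^2+\gamma_{IJ}\beta^I\beta^J$, $g_{0I}=\gamma_{IJ}\beta^J$, $g_{IJ}=\gamma_{IJ}$, inverse $g^{\mu\nu}$ (so $g^{0I}=\beta^I/\alpha^2$), Christoffel symbols $\Gamma^\sigma_{\mu\nu}$; $v^I=\Theta_{aI}\widehat v_a$, $\widetilde v^I=v^I-\beta^I/\alpha$, $u^0=L/\alpha$, $u^I=L\widetilde v^I$, $T^{\mu\nu}=\rho hu^\mu u^\nu+pg^{\mu\nu}$, $S_I=\rho hL^2\gamma_{IJ}v^J$, $F_{\rm V}^I=(D\widetilde v^I,\ S_1\widetilde v^I+p\delta^I_1,\ S_2\widetilde v^I+p\delta^I_2,\ E\widetilde v^I+pv^I)^T$, $\mathcal S_{\rm V}^{\rm act}=(0,\ \frac12T^{\mu\nu}\partial_1g_{\mu\nu},\ \frac12T^{\mu\nu}\partial_2g_{\mu\nu},\ T^{I0}\partial_I\alpha-\alpha T^{\mu\nu}\Gamma^0_{\mu\nu})^T$, $\mathcal L=\operatorname{diag}(1,\Theta,1)$,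 and $\mathcal S_W=\alpha j_2[\mathcal L\mathcal S_{\rm V}^{\rm act}+(\partial_I\mathcal L)F_{\rm V}^I]$. The map from $(\alpha,\beta^I,\gamma_{IJ})$ to $Y=(j_2,A_{11},A_{12},A_{22},C^1,C^2)$ is a smooth local change of variables, so, for fixed state and geometry values, $\mathcal S_W$ is linear in the first derivatives of $Y$; the coefficient vectors $B$ are defined by $\mathcal S_W=B_{j_2}^I\partial_Ij_2+B_{A_{aJ}}^I\partial_IA_{aJ}+B_{C^J}^I\partial_IC^J$ (sum over the entries $(a,J)$ with $a\le J$ for $A$). Put $P_\perp^I=(0,\ \alpha j_2\Theta_{1I}p,\ \alpha j_2\Theta_{2I}p,\ \alpha^2j_2g^{0I}p)^T$ and $R_w^I=P_\perp^I-B_{A_{aJ}}^IA_{aJ}-B_{C^J}^IC^J$. Discretization. $K=[x^1_L,x^1_R]\times[x^2_L,x^2_R]$ is the affine image of $[-1,1]^2$, $\Delta x_I=x^I_R-x^I_L$, $J_K=\Delta x_1\Delta x_2/4$, $\kappa_I=2/\Delta x_I$. $\xi_0,\dots,\xi_N$ are the GLL nodes on $[-1,1]$ with positive weights $\omega_i$ and Lagrange basis $\ell_i$; $\mathsf D_{ij}=\ell_j'(\xi_i)$, $\mathsf B=\operatorname{diag}(-1,0,\dots,0,1)$. For nodal fields, $(\mathsf D_1Z)_{ij}=\sum_m\mathsf D_{im}Z_{mj}$, $(\mathsf D_2Z)_{ij}=\sum_m\mathsf D_{jm}Z_{im}$. All geometry and state quantities are evaluated nodally. Volume flux. For two nodes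 $p,q$, $[\![z]\!]=z_q-z_p$ and $\{\!\{z\}\!\}=(z_p+z_q)/2$. Fixed symmetric, consistent two-point functions $\widehat U^{\#}_{pq}$, $\widehat F^{a,\mathrm{EC}}_{pq}$ of the local states (consistent: equal to $\widehat U$, $\widehat F^a$ at equal states) satisfy $[\![V]\!]^T\widehat U^{\#}=[\![\Phi]\!]$ and $[\![V]\!]^T\widehat F^{a,\mathrm{EC}}=[\![\psi_a]\!]$; and $\mathcal H^{I,\mathrm{EC}}_{pq}=\{\!\{\mathcal A_{aI}\}\!\}_{pq}\widehat F^{a,\mathrm{EC}}_{pq}-\{\!\{\mathcal C^I\}\!\}_{pq}\widehat U^{\#}_{pq}$. Discrete source. $\mathbb S^h_{ij}=\sum_{I=1}^2\kappa_I\bigl[w B_{j_2}^I\,\mathsf D_Ij_2+B_{A_{aJ}}^I\,\mathsf D_I(wA_{aJ})+B_{C^J}^I\,\mathsf D_I(wC^J)+R_w^I\,\mathsf D_Iw\bigr]_{ij}$. Surface flux. For a face $f\subset\partial K$ normal to direction $I(f)$, the outward normal covector is $n=\varepsilon_{K,f}e_{I(f)}$, $\varepsilon_{K,f}=\pm1$. At a face GLL node with interior trace $-$ and exterior trace $+$ (the neighbouring element's coinciding node, with the common face geometry), $\mathbb H_n^\pm=n_I\mathbb H^{I,\pm}$, $\widehat{\mathbb H}^{\mathrm{LLF}}_n=\frac12(\mathbb H_n^-+\mathbb H_n^+)-\frac{a_f}{2}(\mathbb W^+-\mathbb W^-)$, and $\widehat{\mathbb H}^{I,\mathrm{LLF}}_{ij}=\varepsilon_{K,f}\widehat{\mathbb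 H}^{\mathrm{LLF}}_n$ for $(i,j)\in f$, $I=I(f)$. *)

theory Defs
  imports "HOL-Analysis.Analysis" "HOL-Computational_Algebra.Polynomial"
begin

section \<open>Fluid state\<close>

record prim =
  rho :: real
  vel :: "real^2"
  prs :: real

definition lorentz :: "prim \<Rightarrow> real" where
  "lorentz q = 1 / sqrt (1 - (norm (vel q))\<^sup>2)"

definition enthalpy :: "real \<Rightarrow> prim \<Rightarrow> real" where
  "enthalpy \<Gamma> q = 1 + \<Gamma> * prs q / ((\<Gamma> - 1) * rho q)"

definition dens :: "prim \<Rightarrow> real" where
  "dens q = rho q * lorentz q"

definition mom :: "real \<Rightarrow> prim \<Rightarrow> real^2" where
  "mom \<Gamma> q = (rho q * enthalpy \<Gamma> q * (lorentz q)\<^sup>2) *\<^sub>R vel q"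

definition energy :: "real \<Rightarrow> prim \<Rightarrow> real" where
  "energy \<Gamma> q = rho q * enthalpy \<Gamma> q * (lorentz q)\<^sup>2 - prs q"

definition cons :: "real \<Rightarrow> prim \<Rightarrow> real^4" where
  "cons \<Gamma> q = vector [dens q, mom \<Gamma> q $ 1, mom \<Gamma> q $ 2, energy \<Gamma> q]"

definition kron :: "'a \<Rightarrow> 'a \<Rightarrow> real" where
  "kron a b = (if a = b then 1 else 0)"

definition phys_flux :: "real \<Rightarrow> 2 \<Rightarrow> prim \<Rightarrow> real^4" where
  "phys_flux \<Gamma> a q = vector
     [dens q * vel q $ a,
      mom \<Gamma> q $ 1 * vel q $ a + prs q * kron 1 a,
      mom \<Gamma> q $ 2 * vel q $ a + prs q * kron 2 a,
      mom \<Gamma> q $ a]"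

definition prim_ok :: "prim \<Rightarrow> bool" where
  "prim_ok q \<longleftrightarrow> rho q > 0 \<and> prs q > 0 \<and> norm (vel q) < 1"

definition admissible :: "real \<Rightarrow> real^4 \<Rightarrow> bool" where
  "admissible \<Gamma> U \<longleftrightarrow> (\<exists>q. prim_ok q \<and> cons \<Gamma> q = U)"

definition prim_of :: "real \<Rightarrow> real^4 \<Rightarrow> prim" where
  "prim_of \<Gamma> U = (THE q. prim_ok q \<and> cons \<Gamma> q = U)"

definition spec_entropy :: "real \<Rightarrow> prim \<Rightarrow> real" where
  "spec_entropy \<Gamma> q = ln (prs q) - \<Gamma> * ln (rho q)"

definition eta :: "real \<Rightarrow> prim \<Rightarrow> real" where
  "eta \<Gamma> q = - dens q * spec_entropy \<Gamma> q / (\<Gamma> - 1)"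

text \<open>The gradient of the entropy with respect to the conserved vector, in primitive variables.\<close>

definition entropy_var :: "real \<Rightarrow> prim \<Rightarrow> real^4" where
  "entropy_var \<Gamma> q = (let \<zeta> = rho q / prs q; L = lorentz q in vector
     [(\<Gamma> - spec_entropy \<Gamma> q) / (\<Gamma> - 1) + \<zeta>,
      \<zeta> * L * vel q $ 1, \<zeta> * L * vel q $ 2, - \<zeta> * L])"

text \<open>The two-point functions take the conserved vectors of the two nodes as arguments.
  The entropy potentials are \<open>D\<close> for the state and \<open>D v\<^sub>a\<close> for the flux.\<close>

definition ec_pair ::
  "real \<Rightarrow> (real^4 \<Rightarrow> real^4 \<Rightarrow> real^4) \<Rightarrow> (2 \<Rightarrow> real^4 \<Rightarrow> real^4 \<Rightarrow> real^4) \<Rightarrow> bool" where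
  "ec_pair \<Gamma> Us Fec \<longleftrightarrow>
     (\<forall>U U'. admissible \<Gamma> U \<and> admissible \<Gamma> U' \<longrightarrow>
        (let q = prim_of \<Gamma> U; q' = prim_of \<Gamma> U';
             dV = entropy_var \<Gamma> q' - entropy_var \<Gamma> q
         in Us U U' = Us U' U \<and> Us U U = U \<and>
            dV \<bullet> Us U U' = dens q' - dens q \<and>
            (\<forall>a. Fec a U U' = Fec a U' U \<and> Fec a U U = phys_flux \<Gamma> a q \<and>
                 dV \<bullet> Fec a U U' = dens q' * vel q' $ a - dens q * vel q $ a)))"

section \<open>Geometry\<close>

record geom =
  lapse :: real
  shift :: "real^2"
  metric :: "real^2^2"

definition geom_ok :: "geom \<Rightarrow> bool" where
  "geom_ok G \<longleftrightarrow> lapse G > 0 \<and> transpose (metric G) = metric G \<and>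
     (\<forall>y. y \<noteq> 0 \<longrightarrow> y \<bullet> (metric G *v y) > 0)"

definition j2 :: "geom \<Rightarrow> real" where
  "j2 G = sqrt (det (metric G))"

definition Theta :: "geom \<Rightarrow> real^2^2" where
  "Theta G = (THE \<Theta>. \<Theta> $ 2 $ 1 = 0 \<and> \<Theta> $ 1 $ 1 > 0 \<and> \<Theta> $ 2 $ 2 > 0 \<and>
                transpose \<Theta> ** \<Theta> = matrix_inv (metric G))"

definition Ageo :: "geom \<Rightarrow> 2 \<Rightarrow> 2 \<Rightarrow> real" where
  "Ageo G a I = lapse G * j2 G * Theta G $ a $ I"

definition Cgeo :: "geom \<Rightarrow> 2 \<Rightarrow> real" where
  "Cgeo G I = j2 G * shift G $ I"

text \<open>\<open>C\<^sup>k\<close> on a set, with one-sided derivatives at boundary points.\<close>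

primrec Ck_on :: "nat \<Rightarrow> (real^2) set \<Rightarrow> (real^2 \<Rightarrow> real) \<Rightarrow> bool" where
  "Ck_on 0 X f \<longleftrightarrow> continuous_on X f"
| "Ck_on (Suc k) X f \<longleftrightarrow>
     (\<exists>g :: 2 \<Rightarrow> real^2 \<Rightarrow> real.
        (\<forall>x\<in>X. (f has_derivative (\<lambda>y. \<Sum>I\<in>UNIV. g I x * y $ I)) (at x within X)) \<and>
        (\<forall>I. Ck_on k X (g I)))"

definition smooth_on :: "(real^2) set \<Rightarrow> (real^2 \<Rightarrow> real) \<Rightarrow> bool" where
  "smooth_on X f \<longleftrightarrow> (\<forall>k. Ck_on k X f)"

definition smooth_geom_on :: "(real^2) set \<Rightarrow> (real^2 \<Rightarrow> geom) \<Rightarrow> bool" where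
  "smooth_geom_on X \<G> \<longleftrightarrow>
     (\<forall>x\<in>X. geom_ok (\<G> x)) \<and>
     smooth_on X (\<lambda>x. lapse (\<G> x)) \<and>
     (\<forall>I. smooth_on X (\<lambda>x. shift (\<G> x) $ I)) \<and>
     (\<forall>I J. smooth_on X (\<lambda>x. metric (\<G> x) $ I $ J))"

section \<open>Continuous source and its coefficients\<close>

definition partial :: "2 \<Rightarrow> (real^2 \<Rightarrow> 'a::real_normed_vector) \<Rightarrow> real^2 \<Rightarrow> 'a" where
  "partial I f x = frechet_derivative f (at x) (axis I 1)"

text \<open>Spacetime indices are of type \<open>2 option\<close>: \<open>None\<close> is the time index \<open>0\<close>.
  All fields are time-independent.\<close>

definition st_partial :: "2 option \<Rightarrow> (real^2 \<Rightarrow> real) \<Rightarrow> real^2 \<Rightarrow> real" where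
  "st_partial \<mu> f x = (case \<mu> of None \<Rightarrow> 0 | Some I \<Rightarrow> partial I f x)"

definition st_metric :: "geom \<Rightarrow> real^(2 option)^(2 option)" where
  "st_metric G = (\<chi> \<mu> \<nu>. case (\<mu>, \<nu>) of
       (None, None) \<Rightarrow> - (lapse G)\<^sup>2 + shift G \<bullet> (metric G *v shift G)
     | (None, Some I) \<Rightarrow> (metric G *v shift G) $ I
     | (Some I, None) \<Rightarrow> (metric G *v shift G) $ I
     | (Some I, Some J) \<Rightarrow> metric G $ I $ J)"

definition christoffel ::
  "(real^2 \<Rightarrow> geom) \<Rightarrow> real^2 \<Rightarrow> 2 option \<Rightarrow> 2 option \<Rightarrow> 2 option \<Rightarrow> real" where
  "christoffel \<G> x \<sigma> \<mu> \<nu> = (\<Sum>\<tau>\<in>UNIV. matrix_inv (st_metric (\<G> x)) $ \<sigma> $ \<tau> *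
     (st_partial \<mu> (\<lambda>y. st_metric (\<G> y) $ \<tau> $ \<nu>) x
      + st_partial \<nu> (\<lambda>y. st_metric (\<G> y) $ \<tau> $ \<mu>) x
      - st_partial \<tau> (\<lambda>y. st_metric (\<G> y) $ \<mu> $ \<nu>) x) / 2)"

definition vup :: "prim \<Rightarrow> geom \<Rightarrow> real^2" where
  "vup q G = (\<chi> I. \<Sum>a\<in>UNIV. Theta G $ a $ I * vel q $ a)"

definition vtil :: "prim \<Rightarrow> geom \<Rightarrow> real^2" where
  "vtil q G = vup q G - (1 / lapse G) *\<^sub>R shift G"

definition four_vel :: "prim \<Rightarrow> geom \<Rightarrow> 2 option \<Rightarrow> real" where
  "four_vel q G \<mu> = (case \<mu> of None \<Rightarrow> lorentz q / lapse G | Some I \<Rightarrow> lorentz q * vtil q G $ I)"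

definition stress :: "real \<Rightarrow> prim \<Rightarrow> geom \<Rightarrow> 2 option \<Rightarrow> 2 option \<Rightarrow> real" where
  "stress \<Gamma> q G \<mu> \<nu> = rho q * enthalpy \<Gamma> q * four_vel q G \<mu> * four_vel q G \<nu>
     + prs q * matrix_inv (st_metric G) $ \<mu> $ \<nu>"

definition Slow :: "real \<Rightarrow> prim \<Rightarrow> geom \<Rightarrow> real^2" where
  "Slow \<Gamma> q G = (rho q * enthalpy \<Gamma> q * (lorentz q)\<^sup>2) *\<^sub>R (metric G *v vup q G)"

definition FV :: "real \<Rightarrow> prim \<Rightarrow> geom \<Rightarrow> 2 \<Rightarrow> real^4" where
  "FV \<Gamma> q G I = vector
     [dens q * vtil q G $ I,
      Slow \<Gamma> q G $ 1 * vtil q G $ I + prs q * kron I 1,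
      Slow \<Gamma> q G $ 2 * vtil q G $ I + prs q * kron I 2,
      energy \<Gamma> q * vtil q G $ I + prs q * vup q G $ I]"

definition SV :: "real \<Rightarrow> prim \<Rightarrow> (real^2 \<Rightarrow> geom) \<Rightarrow> real^2 \<Rightarrow> real^4" where
  "SV \<Gamma> q \<G> x = (let T = stress \<Gamma> q (\<G> x) in vector
     [0,
      (\<Sum>\<mu>\<in>UNIV. \<Sum>\<nu>\<in>UNIV. T \<mu> \<nu> * partial 1 (\<lambda>y. st_metric (\<G> y) $ \<mu> $ \<nu>) x) / 2,
      (\<Sum>\<mu>\<in>UNIV. \<Sum>\<nu>\<in>UNIV. T \<mu> \<nu> * partial 2 (\<lambda>y. st_metric (\<G> y) $ \<mu> $ \<nu>) x) / 2,
      (\<Sum>I\<in>UNIV. T (Some I) None * partial I (\<lambda>y. lapse (\<G> y)) x)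
        - lapse (\<G> x) * (\<Sum>\<mu>\<in>UNIV. \<Sum>\<nu>\<in>UNIV. T \<mu> \<nu> * christoffel \<G> x None \<mu> \<nu>)])"

definition Lmat :: "geom \<Rightarrow> real^4^4" where
  "Lmat G = vector
     [vector [1, 0, 0, 0],
      vector [0, Theta G $ 1 $ 1, Theta G $ 1 $ 2, 0],
      vector [0, Theta G $ 2 $ 1, Theta G $ 2 $ 2, 0],
      vector [0, 0, 0, 1]]"

definition SW :: "real \<Rightarrow> prim \<Rightarrow> (real^2 \<Rightarrow> geom) \<Rightarrow> real^2 \<Rightarrow> real^4" where
  "SW \<Gamma> q \<G> x = (lapse (\<G> x) * j2 (\<G> x)) *\<^sub>R
     (Lmat (\<G> x) *v SV \<Gamma> q \<G> x
      + (\<Sum>I\<in>UNIV. partial I (\<lambda>y. Lmat (\<G> y)) x *v FV \<Gamma> q (\<G> x) I))"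

text \<open>The index pairs with \<open>a \<le> J\<close>, written out because \<open>2 = 0\<close> in the type \<open>2\<close>
  and its order is not the order of \<open>1, 2\<close>.\<close>

definition upper_idx :: "(2 \<times> 2) set" where
  "upper_idx = {(1, 1), (1, 2), (2, 2)}"

text \<open>Coefficient vectors for one direction of differentiation at a time:
  \<open>bj B I\<close>, \<open>bA B I a J\<close> and \<open>bC B I J\<close> multiply the \<open>I\<close>-derivatives of
  \<open>j2\<close>, \<open>Ageo a J\<close> and \<open>Cgeo J\<close>.\<close>

record coeffs =
  bj :: "2 \<Rightarrow> real^4"
  bA :: "2 \<Rightarrow> 2 \<Rightarrow> 2 \<Rightarrow> real^4"
  bC :: "2 \<Rightarrow> 2 \<Rightarrow> real^4"

definition is_source_coeffs :: "real \<Rightarrow> prim \<Rightarrow> geom \<Rightarrow> coeffs \<Rightarrow> bool" where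
  "is_source_coeffs \<Gamma> q G B \<longleftrightarrow>
     (\<forall>X x \<G>. open X \<and> x \<in> X \<and> smooth_geom_on X \<G> \<and> \<G> x = G \<longrightarrow>
        SW \<Gamma> q \<G> x = (\<Sum>I\<in>UNIV.
            partial I (\<lambda>y. j2 (\<G> y)) x *\<^sub>R bj B I
          + (\<Sum>(a, J)\<in>upper_idx. partial I (\<lambda>y. Ageo (\<G> y) a J) x *\<^sub>R bA B I a J)
          + (\<Sum>J\<in>UNIV. partial I (\<lambda>y. Cgeo (\<G> y) J) x *\<^sub>R bC B I J)))"

text \<open>The coefficients are determined by this identity, except for the entries \<open>bA B I 2 1\<close>,
  which occur nowhere below.\<close>

definition source_coeffs :: "real \<Rightarrow> prim \<Rightarrow> geom \<Rightarrow> coeffs" where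
  "source_coeffs \<Gamma> q G = (SOME B. is_source_coeffs \<Gamma> q G B)"

definition Pperp :: "prim \<Rightarrow> geom \<Rightarrow> 2 \<Rightarrow> real^4" where
  "Pperp q G I = vector
     [0,
      lapse G * j2 G * Theta G $ 1 $ I * prs q,
      lapse G * j2 G * Theta G $ 2 $ I * prs q,
      (lapse G)\<^sup>2 * j2 G * matrix_inv (st_metric G) $ None $ Some I * prs q]"

definition Rw :: "real \<Rightarrow> prim \<Rightarrow> geom \<Rightarrow> 2 \<Rightarrow> real^4" where
  "Rw \<Gamma> q G I = (let B = source_coeffs \<Gamma> q G in
     Pperp q G I - (\<Sum>(a, J)\<in>upper_idx. Ageo G a J *\<^sub>R bA B I a J)
                 - (\<Sum>J\<in>UNIV. Cgeo G J *\<^sub>R bC B I J))"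

section \<open>Gauss--Legendre--Lobatto collocation\<close>

text \<open>Rodrigues' formula.\<close>

definition legendre :: "nat \<Rightarrow> real poly" where
  "legendre N = smult (1 / (2 ^ N * fact N)) ((pderiv ^^ N) ([:-1, 0, 1:] ^ N))"

definition gll_nodes :: "nat \<Rightarrow> (nat \<Rightarrow> real) \<Rightarrow> bool" where
  "gll_nodes N \<xi> \<longleftrightarrow> strict_mono_on {..N} \<xi> \<and>
     \<xi> ` {..N} = {x. poly ([:1, 0, -1:] * pderiv (legendre N)) x = 0}"

definition lagrange :: "nat \<Rightarrow> (nat \<Rightarrow> real) \<Rightarrow> nat \<Rightarrow> real poly" where
  "lagrange N \<xi> i = (\<Prod>k\<in>{..N} - {i}. smult (1 / (\<xi> i - \<xi> k)) [:- \<xi> k, 1:])"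

definition gll_weight :: "nat \<Rightarrow> (nat \<Rightarrow> real) \<Rightarrow> nat \<Rightarrow> real" where
  "gll_weight N \<xi> i = integral {-1..1} (poly (lagrange N \<xi> i))"

definition Dmat :: "nat \<Rightarrow> (nat \<Rightarrow> real) \<Rightarrow> nat \<Rightarrow> nat \<Rightarrow> real" where
  "Dmat N \<xi> i j = poly (pderiv (lagrange N \<xi> j)) (\<xi> i)"

definition Bdiag :: "nat \<Rightarrow> nat \<Rightarrow> real" where
  "Bdiag N i = (if i = 0 then -1 else if i = N then 1 else 0)"

definition Dop :: "nat \<Rightarrow> (nat \<Rightarrow> real) \<Rightarrow> 2 \<Rightarrow> (nat \<Rightarrow> nat \<Rightarrow> real) \<Rightarrow> nat \<Rightarrow> nat \<Rightarrow> real" where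
  "Dop N \<xi> I Z i j =
     (if I = 1 then \<Sum>m\<le>N. Dmat N \<xi> i m * Z m j else \<Sum>m\<le>N. Dmat N \<xi> j m * Z i m)"

section \<open>Periodic rectangular meshes\<close>

definition periods :: "real^2 \<Rightarrow> real^2 \<Rightarrow> (real^2) set" where
  "periods lo hi = {\<tau>. \<forall>I. \<exists>k::int. \<tau> $ I = of_int k * (hi $ I - lo $ I)}"

text \<open>The domain is \<open>cbox lo hi\<close>. Conformity is required across the periodic identification
  as well: any two elements, up to translation by periods, meet in a common face
  (possibly empty, a vertex, an edge, or the whole element).\<close>

definition periodic_mesh :: "real^2 \<Rightarrow> real^2 \<Rightarrow> (real^2) set set \<Rightarrow> bool" where
  "periodic_mesh lo hi M \<longleftrightarrow>
     (\<forall>I. lo $ I < hi $ I) \<and> M division_of cbox lo hi \<and> (\<forall>K\<in>M. interior K \<noteq> {}) \<and>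
     (\<forall>K\<in>M. \<forall>K'\<in>M. \<forall>\<tau>\<in>periods lo hi.
        (K \<inter> (+) \<tau> ` K') face_of K \<and> (K \<inter> (+) \<tau> ` K') face_of ((+) \<tau> ` K'))"

definition width :: "(real^2) set \<Rightarrow> 2 \<Rightarrow> real" where
  "width K I = interval_upperbound K $ I - interval_lowerbound K $ I"

definition jac :: "(real^2) set \<Rightarrow> real" where
  "jac K = width K 1 * width K 2 / 4"

definition kap :: "(real^2) set \<Rightarrow> 2 \<Rightarrow> real" where
  "kap K I = 2 / width K I"

definition node :: "(nat \<Rightarrow> real) \<Rightarrow> (real^2) set \<Rightarrow> nat \<Rightarrow> nat \<Rightarrow> real^2" where
  "node \<xi> K i j = (\<chi> I. interval_lowerbound K $ I
     + width K I * ((if I = 1 then \<xi> i else \<xi> j) + 1) / 2)"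

text \<open>The side of \<open>K\<close> with outward normal \<open>\<epsilon> e\<^sub>I\<close>, where \<open>\<epsilon>\<close> is \<open>1\<close> or \<open>-1\<close>.\<close>

definition side :: "(real^2) set \<Rightarrow> 2 \<Rightarrow> real \<Rightarrow> (real^2) set" where
  "side K I \<epsilon> =
     {x \<in> K. x $ I = (if \<epsilon> = 1 then interval_upperbound K $ I else interval_lowerbound K $ I)}"

definition neighbour ::
  "real^2 \<Rightarrow> real^2 \<Rightarrow> (real^2) set set \<Rightarrow> (real^2) set \<Rightarrow> 2 \<Rightarrow> real \<Rightarrow> (real^2) set" where
  "neighbour lo hi M K I \<epsilon> =
     (THE K'. K' \<in> M \<and> (\<exists>\<tau>\<in>periods lo hi. side K I \<epsilon> = (+) \<tau> ` side K' I (- \<epsilon>)))"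

text \<open>For a node on a side normal to direction \<open>I\<close>, its sign \<open>\<epsilon>\<close> and the indices, in the
  neighbour across that side, of the coinciding node.\<close>

definition on_side :: "nat \<Rightarrow> 2 \<Rightarrow> nat \<Rightarrow> nat \<Rightarrow> bool" where
  "on_side N I i j \<longleftrightarrow> (if I = 1 then i else j) \<in> {0, N}"

definition side_sgn :: "nat \<Rightarrow> 2 \<Rightarrow> nat \<Rightarrow> nat \<Rightarrow> real" where
  "side_sgn N I i j = (if (if I = 1 then i else j) = N then 1 else -1)"

definition ext_i :: "nat \<Rightarrow> 2 \<Rightarrow> nat \<Rightarrow> nat" where
  "ext_i N I i = (if I = 1 then N - i else i)"

definition ext_j :: "nat \<Rightarrow> 2 \<Rightarrow> nat \<Rightarrow> nat" where
  "ext_j N I j = (if I = 1 then j else N - j)"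

section \<open>The semidiscrete scheme\<close>

text \<open>The geometry and the weight are given element by element; a geometry defined on the whole
  domain is the special case in which \<open>geo\<close> and \<open>wt\<close> do not depend on the element.\<close>

definition face_single_valued ::
  "real^2 \<Rightarrow> real^2 \<Rightarrow> (real^2) set set \<Rightarrow> nat \<Rightarrow> (nat \<Rightarrow> real) \<Rightarrow>
   ((real^2) set \<Rightarrow> real^2 \<Rightarrow> 'g) \<Rightarrow> bool" where
  "face_single_valued lo hi M N \<xi> f \<longleftrightarrow>
     (\<forall>K\<in>M. \<forall>I. \<forall>i\<le>N. \<forall>j\<le>N. on_side N I i j \<longrightarrow>
        (let K' = neighbour lo hi M K I (side_sgn N I i j) in
         f K (node \<xi> K i j) = f K' (node \<xi> K' (ext_i N I i) (ext_j N I j))))"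

text \<open>\<open>flux G \<omega> I\<close> is the physical flux at geometry \<open>G\<close> and weight \<open>\<omega>\<close>, and
  \<open>causal_speed G n\<close> the interface speed for the conormal \<open>n\<close>.\<close>

definition flux :: "real \<Rightarrow> geom \<Rightarrow> real \<Rightarrow> 2 \<Rightarrow> real^4 \<Rightarrow> real^4" where
  "flux \<Gamma> G \<omega> I U =
     (\<Sum>a\<in>UNIV. (\<omega> * Ageo G a I) *\<^sub>R phys_flux \<Gamma> a (prim_of \<Gamma> U)) - (\<omega> * Cgeo G I) *\<^sub>R U"

definition causal_speed :: "geom \<Rightarrow> real^2 \<Rightarrow> real" where
  "causal_speed G n = \<bar>shift G \<bullet> n\<bar> + lapse G * sqrt (n \<bullet> (matrix_inv (metric G) *v n))"

definition llf :: "real \<Rightarrow> geom \<Rightarrow> real \<Rightarrow> real^2 \<Rightarrow> real^4 \<Rightarrow> real^4 \<Rightarrow> real^4" where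
  "llf \<Gamma> G \<omega> n Wm Wp =
     (let Hn = (\<lambda>W. \<Sum>I\<in>UNIV. n $ I *\<^sub>R flux \<Gamma> G \<omega> I (W /\<^sub>R (\<omega> * j2 G)))
      in (1/2) *\<^sub>R (Hn Wm + Hn Wp) - (causal_speed G n / 2) *\<^sub>R (Wp - Wm))"

context
  fixes \<Gamma> :: real
    and Us :: "real^4 \<Rightarrow> real^4 \<Rightarrow> real^4"
    and Fec :: "2 \<Rightarrow> real^4 \<Rightarrow> real^4 \<Rightarrow> real^4"
    and N :: nat
    and \<xi> :: "nat \<Rightarrow> real"
    and lo hi :: "real^2"
    and M :: "(real^2) set set"
    and geo :: "(real^2) set \<Rightarrow> real^2 \<Rightarrow> geom"
    and wt :: "(real^2) set \<Rightarrow> real^2 \<Rightarrow> real"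
begin

definition Gn :: "(real^2) set \<Rightarrow> nat \<Rightarrow> nat \<Rightarrow> geom" where
  "Gn K i j = geo K (node \<xi> K i j)"

definition wn :: "(real^2) set \<Rightarrow> nat \<Rightarrow> nat \<Rightarrow> real" where
  "wn K i j = wt K (node \<xi> K i j)"

text \<open>The first argument \<open>W\<close> is the evolved nodal state at one instant.\<close>

definition Ust :: "((real^2) set \<Rightarrow> nat \<Rightarrow> nat \<Rightarrow> real^4) \<Rightarrow> (real^2) set \<Rightarrow> nat \<Rightarrow> nat \<Rightarrow> real^4" where
  "Ust W K i j = W K i j /\<^sub>R (wn K i j * j2 (Gn K i j))"

definition Hec :: "((real^2) set \<Rightarrow> nat \<Rightarrow> nat \<Rightarrow> real^4) \<Rightarrow> (real^2) set \<Rightarrow> 2 \<Rightarrow>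
    nat \<times> nat \<Rightarrow> nat \<times> nat \<Rightarrow> real^4" where
  "Hec W K I = (\<lambda>(i, j) (k, l).
     (\<Sum>a\<in>UNIV. ((wn K i j * Ageo (Gn K i j) a I + wn K k l * Ageo (Gn K k l) a I) / 2)
          *\<^sub>R Fec a (Ust W K i j) (Ust W K k l))
     - ((wn K i j * Cgeo (Gn K i j) I + wn K k l * Cgeo (Gn K k l) I) / 2)
          *\<^sub>R Us (Ust W K i j) (Ust W K k l))"

definition Hn :: "((real^2) set \<Rightarrow> nat \<Rightarrow> nat \<Rightarrow> real^4) \<Rightarrow> (real^2) set \<Rightarrow> 2 \<Rightarrow>
    nat \<Rightarrow> nat \<Rightarrow> real^4" where
  "Hn W K I i j = flux \<Gamma> (Gn K i j) (wn K i j) I (Ust W K i j)"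

text \<open>Meaningful for nodes on a side normal to direction \<open>I\<close>; elsewhere the scheme multiplies
  it by \<open>0\<close>.\<close>

definition Hllf :: "((real^2) set \<Rightarrow> nat \<Rightarrow> nat \<Rightarrow> real^4) \<Rightarrow> (real^2) set \<Rightarrow> 2 \<Rightarrow>
    nat \<Rightarrow> nat \<Rightarrow> real^4" where
  "Hllf W K I i j =
     (let \<epsilon> = side_sgn N I i j; K' = neighbour lo hi M K I \<epsilon>
      in \<epsilon> *\<^sub>R llf \<Gamma> (Gn K i j) (wn K i j) (\<epsilon> *\<^sub>R axis I 1)
             (W K i j) (W K' (ext_i N I i) (ext_j N I j)))"

definition Sh :: "((real^2) set \<Rightarrow> nat \<Rightarrow> nat \<Rightarrow> real^4) \<Rightarrow> (real^2) set \<Rightarrow>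
    nat \<Rightarrow> nat \<Rightarrow> real^4" where
  "Sh W K i j =
     (let q = prim_of \<Gamma> (Ust W K i j); G = Gn K i j; B = source_coeffs \<Gamma> q G in
      \<Sum>I\<in>UNIV. kap K I *\<^sub>R
        ((wn K i j * Dop N \<xi> I (\<lambda>k l. j2 (Gn K k l)) i j) *\<^sub>R bj B I
         + (\<Sum>(a, J)\<in>upper_idx.
              Dop N \<xi> I (\<lambda>k l. wn K k l * Ageo (Gn K k l) a J) i j *\<^sub>R bA B I a J)
         + (\<Sum>J\<in>UNIV. Dop N \<xi> I (\<lambda>k l. wn K k l * Cgeo (Gn K k l) J) i j *\<^sub>R bC B I J)
         + Dop N \<xi> I (wn K) i j *\<^sub>R Rw \<Gamma> q G I))"

definition semidiscrete ::
  "real set \<Rightarrow> (real \<Rightarrow> (real^2) set \<Rightarrow> nat \<Rightarrow> nat \<Rightarrow> real^4) \<Rightarrow> bool" where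
  "semidiscrete T W \<longleftrightarrow>
     (\<forall>t\<in>T. \<forall>K\<in>M. \<forall>i\<le>N. \<forall>j\<le>N. \<exists>Wdot.
        ((\<lambda>s. W s K i j) has_vector_derivative Wdot) (at t within T) \<and>
        Wdot
        + (2 * kap K 1) *\<^sub>R (\<Sum>m\<le>N. Dmat N \<xi> i m *\<^sub>R Hec (W t) K 1 (i, j) (m, j))
        + (2 * kap K 2) *\<^sub>R (\<Sum>m\<le>N. Dmat N \<xi> j m *\<^sub>R Hec (W t) K 2 (i, j) (i, m))
        + (kap K 1 * Bdiag N i / gll_weight N \<xi> i) *\<^sub>R (Hllf (W t) K 1 i j - Hn (W t) K 1 i j)
        + (kap K 2 * Bdiag N j / gll_weight N \<xi> j) *\<^sub>R (Hllf (W t) K 2 i j - Hn (W t) K 2 i j)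
        = Sh (W t) K i j)"

definition mesh_integral :: "((real^2) set \<Rightarrow> nat \<Rightarrow> nat \<Rightarrow> real) \<Rightarrow> real" where
  "mesh_integral f =
     (\<Sum>K\<in>M. jac K * (\<Sum>i\<le>N. \<Sum>j\<le>N. gll_weight N \<xi> i * gll_weight N \<xi> j * f K i j))"

definition total_entropy :: "((real^2) set \<Rightarrow> nat \<Rightarrow> nat \<Rightarrow> real^4) \<Rightarrow> real" where
  "total_entropy W = mesh_integral (\<lambda>K i j.
     wn K i j * j2 (Gn K i j) * eta \<Gamma> (prim_of \<Gamma> (Ust W K i j)))"

definition total_mass :: "((real^2) set \<Rightarrow> nat \<Rightarrow> nat \<Rightarrow> real^4) \<Rightarrow> real" where
  "total_mass W = mesh_integral (\<lambda>K i j.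
     wn K i j * j2 (Gn K i j) * dens (prim_of \<Gamma> (Ust W K i j)))"

end

end

theory Submission
  imports Defs
begin

text \<open>The scheme is tested, node by node, with the entropy variables \<open>V\<close>, weighted with the
  quadrature weights and summed.  Three cancellations then leave only nonpositive interface terms.

  Inside an element the two-point relations \<open>[[V]] \<bullet> F = [[\<psi>]]\<close>, \<open>[[V]] \<bullet> U = [[\<Phi>]]\<close> and the
  summation-by-parts property of the GLL derivative matrix turn the flux differences into
  boundary values of \<open>V \<bullet> H - \<Psi>\<close>, with \<open>\<Psi>\<close> the weighted entropy potential of the flux, plus
  the volume term \<open>\<psi>\<^sub>a D(wA) - \<Phi> D(wC)\<close> (\<open>sbp_flux_line\<close>).

  The source is built to cancel this volume term.  Contracted with \<open>V\<close>, the continuous source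
  \<open>SW\<close> equals \<open>D (v\<^sub>a \<partial>\<^sub>I A\<^sub>a\<^sub>I - \<partial>\<^sub>I C\<^sub>I)\<close>: the kinetic terms of the stress tensor
  cancel against the rotation of the orthonormal frame, and only the pressure terms survive
  (\<open>entropy_source_balance\<close>).  Since the first derivatives of the six geometry variables can be
  prescribed independently (\<open>exists_geometry_with_jet\<close>), this identity can be read off
  coefficient by coefficient (\<open>source_coeffs_entropy\<close>).  That coefficients with the defining
  property exist at all is \<open>source_coeffs_exist\<close>.

  What remains are face terms \<open>[[V]] \<bullet> H - [[\<Psi>]]\<close>.  Faces are matched in pairs because taking the
  neighbour across a side is an involution on the elements of a periodic conforming mesh
  (\<open>neighbour_properties\<close>).  The face terms are nonpositive for the Lax--Friedrichs flux with
  the causal speed because light bounds all signal speeds: for every \<open>n\<close> with \<open>|n| \<le> 1\<close> the potential \<open>D (1 + n \<bullet> v)\<close> is a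
  convex function of the entropy variables, with gradient \<open>U + n\<^sub>a F\<^sup>a\<close> (\<open>potential_convex\<close>).
  This convexity relies on \<open>\<Gamma> \<le> 2\<close>.

  The chain rule in time uses the special case \<open>n = 0\<close>, convexity of the entropy in \<open>U\<close>, together
  with continuity of \<open>V\<close> as a function of \<open>U\<close> (\<open>eta_has_derivative_along\<close>).  Conservation
  of mass is the same balance law with \<open>V\<close> replaced by the constant first unit vector, whose
  potentials vanish (\<open>global_balance\<close>, \<open>density_is_test\<close>).\<close>

section \<open>Components of vectors\<close>

lemma vector_4_nth [simp]:
  "(vector [a, b, c, d] :: 'a::zero^4) $ 1 = a"
  "(vector [a, b, c, d] :: 'a::zero^4) $ 2 = b"
  "(vector [a, b, c, d] :: 'a::zero^4) $ 3 = c"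
  "(vector [a, b, c, d] :: 'a::zero^4) $ 4 = d"
  unfolding vector_def by simp_all

lemma inner_real4: "(x::real^4) \<bullet> y = x$1 * y$1 + x$2 * y$2 + x$3 * y$3 + x$4 * y$4"
  by (simp add: inner_vec_def sum_4)

lemma inner_real2: "(x::real^2) \<bullet> y = x$1 * y$1 + x$2 * y$2"
  by (simp add: inner_vec_def sum_2)

lemma norm_real2_sq: "(norm (x::real^2))\<^sup>2 = (x$1)\<^sup>2 + (x$2)\<^sup>2"
  by (simp only: power2_norm_eq_inner inner_real2) (simp add: power2_eq_square)

section \<open>Convexity of the entropy potentials along causal directions\<close>

lemma reverse_cauchy_schwarz:
  fixes w0 w1 w2 u0 u1 u2 z y :: real
  assumes "w0 > 0" "u0 > 0" "z \<ge> 0" "y \<ge> 0"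
    and "z\<^sup>2 = w0\<^sup>2 - w1\<^sup>2 - w2\<^sup>2" "y\<^sup>2 = u0\<^sup>2 - u1\<^sup>2 - u2\<^sup>2"
  shows "z * y \<le> w0 * u0 - w1 * u1 - w2 * u2"
proof -
  have "(z * y + (w1 * u1 + w2 * u2))\<^sup>2 \<le> (z\<^sup>2 + w1\<^sup>2 + w2\<^sup>2) * (y\<^sup>2 + u1\<^sup>2 + u2\<^sup>2)"
  proof -
    have "(z\<^sup>2 + w1\<^sup>2 + w2\<^sup>2) * (y\<^sup>2 + u1\<^sup>2 + u2\<^sup>2) - (z * y + (w1 * u1 + w2 * u2))\<^sup>2
        = (z * u1 - y * w1)\<^sup>2 + (z * u2 - y * w2)\<^sup>2 + (w1 * u2 - w2 * u1)\<^sup>2"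
      by algebra
    moreover have "\<dots> \<ge> 0" by simp
    ultimately show ?thesis by linarith
  qed
  also have "\<dots> = (w0 * u0)\<^sup>2" using assms by (simp add: power_mult_distrib)
  finally have "z * y + (w1 * u1 + w2 * u2) \<le> w0 * u0"
    using assms by (meson mult_nonneg_nonneg less_imp_le power2_le_imp_le)
  then show ?thesis by simp
qed

text \<open>First-order concavity of \<open>\<zeta>\<^sup>2 / (k \<bullet> w)\<close> on the future cone, where \<open>\<zeta>\<^sup>2\<close> is the Minkowski
  square of \<open>w = (w0, w1, w2)\<close> and \<open>k = (1, n1, n2)\<close> is causal: the quotient is homogeneous of
  degree one, so the right-hand side is its linearisation at \<open>w\<close>, evaluated at \<open>u\<close>.\<close>

lemma null_covector_concavity:
  fixes w0 w1 w2 u0 u1 u2 n1 n2 a b :: real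
  assumes n: "n1\<^sup>2 + n2\<^sup>2 \<le> 1"
    and a: "a = w0 + n1 * w1 + n2 * w2" "a > 0"
    and b: "b = u0 + n1 * u1 + n2 * u2" "b > 0"
  shows "(u0\<^sup>2 - u1\<^sup>2 - u2\<^sup>2) / b
     \<le> 2 * (w0 * u0 - w1 * u1 - w2 * u2) / a - (w0\<^sup>2 - w1\<^sup>2 - w2\<^sup>2) * b / a\<^sup>2"
proof -
  \<comment> \<open>The vector \<open>(k \<bullet> w) u - (k \<bullet> u) w\<close> is annihilated by \<open>k\<close>, hence it is not timelike; its Minkowski square is the quadratic form to be bounded.\<close>
  define y0 y1 y2 where "y0 = a * u0 - b * w0" and "y1 = a * u1 - b * w1" and "y2 = a * u2 - b * w2"
  have "y0 = - (n1 * y1 + n2 * y2)"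
    unfolding y0_def y1_def y2_def a b by algebra
  then have "y0\<^sup>2 = (n1 * y1 + n2 * y2)\<^sup>2" by algebra
  also have "\<dots> \<le> (n1\<^sup>2 + n2\<^sup>2) * (y1\<^sup>2 + y2\<^sup>2)"
  proof -
    have "(n1\<^sup>2 + n2\<^sup>2) * (y1\<^sup>2 + y2\<^sup>2) - (n1 * y1 + n2 * y2)\<^sup>2 = (n1 * y2 - n2 * y1)\<^sup>2"
      by algebra
    then show ?thesis by (metis diff_ge_0_iff_ge zero_le_power2)
  qed
  also have "\<dots> \<le> 1 * (y1\<^sup>2 + y2\<^sup>2)"
    using n by (intro mult_right_mono) auto
  finally have "y0\<^sup>2 - y1\<^sup>2 - y2\<^sup>2 \<le> 0" by simp
  then have "(u0\<^sup>2 - u1\<^sup>2 - u2\<^sup>2) * a\<^sup>2 - 2 * (w0 * u0 - w1 * u1 - w2 * u2) * a * b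
      + (w0\<^sup>2 - w1\<^sup>2 - w2\<^sup>2) * b\<^sup>2 \<le> 0"
    unfolding y0_def y1_def y2_def by (simp add: algebra_simps power2_eq_square)
  then have "((u0\<^sup>2 - u1\<^sup>2 - u2\<^sup>2) * a\<^sup>2 - 2 * (w0 * u0 - w1 * u1 - w2 * u2) * a * b
      + (w0\<^sup>2 - w1\<^sup>2 - w2\<^sup>2) * b\<^sup>2) / (a\<^sup>2 * b) \<le> 0"
    using a b by (simp add: divide_le_0_iff)
  moreover have "((u0\<^sup>2 - u1\<^sup>2 - u2\<^sup>2) * a\<^sup>2 - 2 * (w0 * u0 - w1 * u1 - w2 * u2) * a * b
      + (w0\<^sup>2 - w1\<^sup>2 - w2\<^sup>2) * b\<^sup>2) / (a\<^sup>2 * b)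
    = (u0\<^sup>2 - u1\<^sup>2 - u2\<^sup>2) / b - 2 * (w0 * u0 - w1 * u1 - w2 * u2) / a + (w0\<^sup>2 - w1\<^sup>2 - w2\<^sup>2) * b / a\<^sup>2"
    using a(2) b(2) by (simp add: field_simps power2_eq_square)
  ultimately show ?thesis by linarith
qed

text \<open>In terms of \<open>w = \<zeta> L (1, v)\<close> and the first entropy variable \<open>\<theta>\<close>, the potential
  \<open>D (1 + n \<bullet> v)\<close> is a constant times \<open>exp (\<theta> - \<zeta> - (m + 1) ln \<zeta> + ln (k \<bullet> w))\<close> with
  \<open>m = 1 / (\<Gamma> - 1)\<close>.  The part of the exponent that depends on \<open>w\<close> is convex, because
  \<open>\<zeta>\<close> and \<open>\<zeta>\<^sup>2 / (k \<bullet> w)\<close> are both concave and \<open>m \<ge> 1\<close>.\<close>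

lemma log_potential_gradient:
  fixes w0 w1 w2 u0 u1 u2 n1 n2 a b z y m :: real
  assumes n: "n1\<^sup>2 + n2\<^sup>2 \<le> 1" and m: "m \<ge> 1"
    and w: "w0 > 0" "z > 0" "z\<^sup>2 = w0\<^sup>2 - w1\<^sup>2 - w2\<^sup>2"
    and u: "u0 > 0" "y > 0" "y\<^sup>2 = u0\<^sup>2 - u1\<^sup>2 - u2\<^sup>2"
    and a: "a = w0 + n1 * w1 + n2 * w2" "a > 0"
    and b: "b = u0 + n1 * u1 + n2 * u2" "b > 0"
  defines "X \<equiv> (w0 * u0 - w1 * u1 - w2 * u2) / z\<^sup>2"
  shows "(- y - (m + 1) * ln y + ln b) - (- z - (m + 1) * ln z + ln a)
      \<ge> - (z + m + 1) * (X - 1) + (b / a - 1)"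
proof -
  have y: "y \<le> X * z"
  proof -
    have "z * y \<le> w0 * u0 - w1 * u1 - w2 * u2"
      using w u by (intro reverse_cauchy_schwarz) auto
    then have "y \<le> (w0 * u0 - w1 * u1 - w2 * u2) / z" using w(2) by (simp add: field_simps)
    also have "\<dots> = X * z" using w(2) by (simp add: X_def power2_eq_square)
    finally show ?thesis .
  qed
  have l1: "ln y - ln z \<le> X - 1"
  proof -
    have "ln y - ln z = ln (y / z)" using w u by (simp add: ln_div)
    also have "\<dots> \<le> y / z - 1" using w u by (intro ln_le_minus_one) simp
    also have "\<dots> \<le> X - 1" using y w by (simp add: field_simps)
    finally show ?thesis .
  qed
  \<comment> \<open>Two of the \<open>m + 1\<close> logarithms absorb \<open>ln b\<close> through the concave quotient; the other \<open>m - 1\<close> are covered by \<open>l1\<close>.\<close>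
  have l2: "(2 * ln y - ln b) - (2 * ln z - ln a) \<le> 2 * X - b / a - 1"
  proof -
    have "(2 * ln y - ln b) - (2 * ln z - ln a) = ln ((y\<^sup>2 / b) / (z\<^sup>2 / a))"
      using w(2) u(2) a(2) b(2) by (simp add: ln_div ln_mult ln_realpow)
    also have "\<dots> \<le> (y\<^sup>2 / b) / (z\<^sup>2 / a) - 1"
      using w(2) u(2) a(2) b(2) by (intro ln_le_minus_one) simp
    also have "y\<^sup>2 / b \<le> 2 * (w0 * u0 - w1 * u1 - w2 * u2) / a - z\<^sup>2 * b / a\<^sup>2"
      using null_covector_concavity[OF n a b] w(3) u(3) by simp
    then have "(y\<^sup>2 / b) / (z\<^sup>2 / a) \<le> (2 * (w0 * u0 - w1 * u1 - w2 * u2) / a - z\<^sup>2 * b / a\<^sup>2) / (z\<^sup>2 / a)"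
      using w(2) a(2) by (intro divide_right_mono) auto
    also have "\<dots> = 2 * X - b / a"
      using w(2) a(2) unfolding X_def by (simp add: field_simps power2_eq_square)
    finally show ?thesis by simp
  qed
  have "(m - 1) * (ln y - ln z) \<le> (m - 1) * (X - 1)"
    using l1 m by (intro mult_left_mono) auto
  with l2 y show ?thesis by (simp add: algebra_simps)
qed

lemma lorentz_facts:
  assumes "prim_ok q"
  shows "lorentz q > 0" "(lorentz q)\<^sup>2 * (1 - (vel q $ 1)\<^sup>2 - (vel q $ 2)\<^sup>2) = 1"
proof -
  have "(norm (vel q))\<^sup>2 < 1" using assms by (simp add: prim_ok_def abs_square_less_1)
  then have p: "1 - (norm (vel q))\<^sup>2 > 0" by simp
  then show "lorentz q > 0" by (simp add: lorentz_def)
  have "(lorentz q)\<^sup>2 * (1 - (norm (vel q))\<^sup>2) = 1"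
    using p by (simp add: lorentz_def power_divide)
  then show "(lorentz q)\<^sup>2 * (1 - (vel q $ 1)\<^sup>2 - (vel q $ 2)\<^sup>2) = 1"
    by (simp add: norm_real2_sq algebra_simps)
qed

lemma one_plus_velocity_pos:
  assumes "prim_ok q" "norm n \<le> 1"
  shows "1 + n \<bullet> vel q > 0"
proof -
  have "\<bar>n \<bullet> vel q\<bar> \<le> norm n * norm (vel q)" by (rule Cauchy_Schwarz_ineq2)
  also have "\<dots> \<le> 1 * norm (vel q)" using assms by (intro mult_right_mono) auto
  also have "\<dots> < 1" using assms by (simp add: prim_ok_def)
  finally show ?thesis by linarith
qed

lemma inner_cons_plus_flux:
  "x \<bullet> (cons \<Gamma> q + (\<Sum>a\<in>UNIV. n $ a *\<^sub>R phys_flux \<Gamma> a q))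
   = dens q * (1 + n \<bullet> vel q) * x $ 1
   + (1 + n \<bullet> vel q) * (rho q * enthalpy \<Gamma> q * (lorentz q)\<^sup>2) * (vel q $ 1 * x $ 2 + vel q $ 2 * x $ 3 + x $ 4)
   + prs q * (n $ 1 * x $ 2 + n $ 2 * x $ 3 - x $ 4)"
  unfolding inner_real4
  by (simp add: cons_def phys_flux_def sum_2 mom_def energy_def inner_real2 kron_def) algebra

text \<open>The exponential of a convex function is convex.  Here the exponent is the first entropy variable
  plus the function of \<open>log_potential_gradient\<close>; the gradient of the potential is
  \<open>U + n\<^sub>a F\<^sup>a\<close>.\<close>

theorem potential_convex:
  assumes G: "1 < \<Gamma>" "\<Gamma> \<le> 2" and q: "prim_ok q" "prim_ok q'" and n: "norm n \<le> 1"
  shows "(entropy_var \<Gamma> q' - entropy_var \<Gamma> q) \<bullet> (cons \<Gamma> q + (\<Sum>a\<in>UNIV. n $ a *\<^sub>R phys_flux \<Gamma> a q))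
      \<le> dens q' * (1 + n \<bullet> vel q') - dens q * (1 + n \<bullet> vel q)"
proof -
  define m where "m = 1 / (\<Gamma> - 1)"
  have m: "m \<ge> 1" using G by (simp add: m_def)
  have Gm: "\<Gamma> / (\<Gamma> - 1) = m + 1" "\<Gamma> = 1 + 1/m" "m > 0" using G by (simp_all add: m_def field_simps)
  define z y where "z = rho q / prs q" and "y = rho q' / prs q'"
  define L L' where "L = lorentz q" and "L' = lorentz q'"
  define v1 v2 where "v1 = vel q $ 1" and "v2 = vel q $ 2"
  define v1' v2' where "v1' = vel q' $ 1" and "v2' = vel q' $ 2"
  have pos: "rho q > 0" "prs q > 0" "rho q' > 0" "prs q' > 0" "z > 0" "y > 0" "L > 0" "L' > 0"
    using q lorentz_facts by (auto simp: prim_ok_def z_def y_def L_def L'_def)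
  have L: "L\<^sup>2 * (1 - v1\<^sup>2 - v2\<^sup>2) = 1" "L'\<^sup>2 * (1 - v1'\<^sup>2 - v2'\<^sup>2) = 1"
    using lorentz_facts(2) q by (auto simp: L_def L'_def v1_def v2_def v1'_def v2'_def)
  define a b where "a = z * L + n$1 * (z * L * v1) + n$2 * (z * L * v2)"
    and "b = y * L' + n$1 * (y * L' * v1') + n$2 * (y * L' * v2')"
  have nn: "(n$1)\<^sup>2 + (n$2)\<^sup>2 \<le> 1"
    using n by (metis norm_real2_sq power_le_one norm_ge_zero)
  define k k' where "k = 1 + n \<bullet> vel q" and "k' = 1 + n \<bullet> vel q'"
  have kpos: "k > 0" "k' > 0" using one_plus_velocity_pos q n by (auto simp: k_def k'_def)
  have ak: "a = z * L * k" "b = y * L' * k'"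
    by (simp_all add: a_def b_def k_def k'_def inner_real2 v1_def v2_def v1'_def v2'_def algebra_simps)
  then have ab: "a > 0" "b > 0" using pos kpos by auto
  define X where "X = (z * L * (y * L') - z * L * v1 * (y * L' * v1') - z * L * v2 * (y * L' * v2')) / z\<^sup>2"
  have Xz: "X * z = L * L' * y * (1 - v1 * v1' - v2 * v2')"
    using pos by (simp add: X_def field_simps power2_eq_square)
  define \<theta> \<theta>' where "\<theta> = entropy_var \<Gamma> q $ 1" and "\<theta>' = entropy_var \<Gamma> q' $ 1"
  have lnrho: "ln (rho r) = entropy_var \<Gamma> r $ 1 - rho r / prs r - \<Gamma> * m - m * ln (rho r / prs r)"
    if "prim_ok r" for r
  proof -
    have "ln (rho r / prs r) = ln (rho r) - ln (prs r)" using that by (simp add: ln_div prim_ok_def)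
    moreover have "entropy_var \<Gamma> r $ 1 = (\<Gamma> - ln (prs r)) * m + \<Gamma> * m * ln (rho r) + rho r / prs r"
      by (simp add: entropy_var_def Let_def spec_entropy_def m_def add_divide_distrib diff_divide_distrib algebra_simps)
    moreover have "\<Gamma> * m = 1 + m" using Gm(3) by (subst Gm(2)) (simp add: field_simps)
    moreover have "m * ln (rho r / prs r) = m * ln (rho r) - m * ln (prs r)"
      using calculation(1) by (simp add: right_diff_distrib)
    ultimately show ?thesis by (simp add: algebra_simps)
  qed
  define g g' where "g = - z - (m + 1) * ln z + ln a" and "g' = - y - (m + 1) * ln y + ln b"
  have g: "g' - g \<ge> - (z + m + 1) * (X - 1) + (b / a - 1)"
    unfolding g_def g'_def X_def
  proof (rule log_potential_gradient[OF nn m _ _ _ _ _ _ a_def ab(1) b_def ab(2)])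
    show "z\<^sup>2 = (z * L)\<^sup>2 - (z * L * v1)\<^sup>2 - (z * L * v2)\<^sup>2" using L(1) by algebra
    show "y\<^sup>2 = (y * L')\<^sup>2 - (y * L' * v1')\<^sup>2 - (y * L' * v2')\<^sup>2" using L(2) by algebra
  qed (use pos in auto)
  have lnf: "ln (dens q * k) = \<theta> + g - \<Gamma> * m" "ln (dens q' * k') = \<theta>' + g' - \<Gamma> * m"
  proof -
    have "ln (dens q * k) = ln (rho q) + ln (L * k)"
      using pos kpos by (simp add: dens_def L_def[symmetric] ln_mult)
    moreover have "ln (L * k) = ln a - ln z"
      using pos kpos by (simp add: ak ln_mult)
    ultimately show "ln (dens q * k) = \<theta> + g - \<Gamma> * m"
      using lnrho[OF q(1)] by (simp add: \<theta>_def g_def z_def algebra_simps)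
    have "ln (dens q' * k') = ln (rho q') + ln (L' * k')"
      using pos kpos by (simp add: dens_def L'_def[symmetric] ln_mult)
    moreover have "ln (L' * k') = ln b - ln y"
      using pos kpos by (simp add: ak ln_mult)
    ultimately show "ln (dens q' * k') = \<theta>' + g' - \<Gamma> * m"
      using lnrho[OF q(2)] by (simp add: \<theta>'_def g'_def y_def algebra_simps)
  qed
  have f0: "dens q * k > 0" "dens q' * k' > 0"
    using pos kpos by (simp_all add: dens_def L_def[symmetric] L'_def[symmetric])
  \<comment> \<open>The ratio of the potentials is an exponential, and \<open>exp x \<ge> 1 + x\<close> is its convexity.\<close>
  have "1 + ((\<theta>' - \<theta>) + (g' - g)) \<le> exp ((\<theta>' - \<theta>) + (g' - g))" by (rule exp_ge_add_one_self)
  also have "(\<theta>' - \<theta>) + (g' - g) = ln (dens q' * k') - ln (dens q * k)" by (simp add: lnf)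
  also have "exp \<dots> = dens q' * k' / (dens q * k)" using f0 by (simp add: exp_diff)
  finally have "1 + ((\<theta>' - \<theta>) + (- (z + m + 1) * (X - 1) + (b / a - 1))) \<le> dens q' * k' / (dens q * k)"
    using g lnf by linarith
  then have "dens q * k * (1 + ((\<theta>' - \<theta>) + (- (z + m + 1) * (X - 1) + (b / a - 1)))) \<le> dens q' * k'"
    using f0(1) by (simp add: pos_le_divide_eq mult.commute)
  moreover have "(entropy_var \<Gamma> q' - entropy_var \<Gamma> q) \<bullet> (cons \<Gamma> q + (\<Sum>a\<in>UNIV. n $ a *\<^sub>R phys_flux \<Gamma> a q))
     = dens q * k * ((\<theta>' - \<theta>) + (- (z + m + 1) * (X - 1) + (b / a - 1)))"
  proof -
    have h: "rho q * enthalpy \<Gamma> q = prs q * (z + m + 1)"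
      
    proof -
      have "rho q * enthalpy \<Gamma> q = rho q + \<Gamma> / (\<Gamma> - 1) * prs q"
        using pos by (simp add: enthalpy_def distrib_left)
      also have "\<dots> = prs q * (z + m + 1)"
        unfolding Gm(1) using pos by (simp add: z_def algebra_simps)
      finally show ?thesis .
    qed
    have d: "dens q = prs q * z * L" using pos by (simp add: dens_def L_def z_def)
    have e2: "entropy_var \<Gamma> q $ 2 = z * L * v1" "entropy_var \<Gamma> q $ 3 = z * L * v2" "entropy_var \<Gamma> q $ 4 = - z * L"
      "entropy_var \<Gamma> q' $ 2 = y * L' * v1'" "entropy_var \<Gamma> q' $ 3 = y * L' * v2'" "entropy_var \<Gamma> q' $ 4 = - y * L'"
      by (simp_all add: entropy_var_def Let_def z_def L_def v1_def v2_def y_def L'_def v1'_def v2'_def)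
    have t2: "k * (prs q * (z + m + 1) * L\<^sup>2) * (v1 * (y * L' * v1' - z * L * v1) + v2 * (y * L' * v2' - z * L * v2) + (- y * L' - - z * L))
       = dens q * k * (- (z + m + 1) * (X - 1))"
    proof -
      have "L * (v1 * (y * L' * v1' - z * L * v1) + v2 * (y * L' * v2' - z * L * v2) + (- y * L' - - z * L))
         = z * (L\<^sup>2 * (1 - v1\<^sup>2 - v2\<^sup>2)) - L * L' * y * (1 - v1 * v1' - v2 * v2')"
        by (simp add: algebra_simps power2_eq_square)
      also have "\<dots> = - z * (X - 1)" unfolding L(1) Xz[symmetric] by (simp add: algebra_simps)
      finally have *: "L * (v1 * (y * L' * v1' - z * L * v1) + v2 * (y * L' * v2' - z * L * v2) + (- y * L' - - z * L)) = - z * (X - 1)" .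
      have "k * (prs q * (z + m + 1) * L\<^sup>2) * (v1 * (y * L' * v1' - z * L * v1) + v2 * (y * L' * v2' - z * L * v2) + (- y * L' - - z * L))
         = k * prs q * (z + m + 1) * L * (L * (v1 * (y * L' * v1' - z * L * v1) + v2 * (y * L' * v2' - z * L * v2) + (- y * L' - - z * L)))"
        by (simp add: power2_eq_square mult.assoc)
      also have "\<dots> = dens q * k * (- (z + m + 1) * (X - 1))"
        unfolding * d by (simp add: algebra_simps)
      finally show ?thesis .
    qed
    have t3: "prs q * (n$1 * (y * L' * v1' - z * L * v1) + n$2 * (y * L' * v2' - z * L * v2) - (- y * L' - - z * L))
       = dens q * k * (b / a - 1)"
    proof -
      have "dens q * k * (b / a - 1) = prs q * (b - a)"
        unfolding d using ab ak pos kpos by (simp add: field_simps)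
      then show ?thesis by (simp add: a_def b_def algebra_simps)
    qed
    show ?thesis
      unfolding inner_cons_plus_flux vector_minus_component e2 k_def[symmetric] h L_def[symmetric]
        v1_def[symmetric] v2_def[symmetric] t2 t3
      by (simp add: \<theta>_def \<theta>'_def algebra_simps)
  qed
  ultimately show ?thesis by (simp add: k_def k'_def algebra_simps)
qed


section \<open>Entropy and recovery of the primitive variables\<close>

text \<open>The Legendre relation between the entropy and its potential \<open>\<Phi> = D\<close>.\<close>

lemma inner_entropy_var_cons:
  assumes "1 < \<Gamma>" "prim_ok q"
  shows "entropy_var \<Gamma> q \<bullet> cons \<Gamma> q = dens q + eta \<Gamma> q"
proof -
  define L z where "L = lorentz q" and "z = rho q / prs q"
  have p: "prs q \<noteq> 0" "rho q \<noteq> 0" "prs q * z = rho q" using assms by (auto simp: prim_ok_def z_def)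
  have L: "L\<^sup>2 * (1 - (vel q $ 1)\<^sup>2 - (vel q $ 2)\<^sup>2) = 1"
    using lorentz_facts(2)[OF assms(2)] by (simp add: L_def)
  define c where "c = \<Gamma> / (\<Gamma> - 1)"
  have h: "rho q * enthalpy \<Gamma> q = rho q + c * prs q"
    using p assms by (simp add: enthalpy_def c_def field_simps)
  have V1: "entropy_var \<Gamma> q $ 1 = c - spec_entropy \<Gamma> q / (\<Gamma> - 1) + z"
    by (simp add: entropy_var_def Let_def z_def c_def diff_divide_distrib)
  have V: "entropy_var \<Gamma> q $ 2 = z * L * vel q $ 1" "entropy_var \<Gamma> q $ 3 = z * L * vel q $ 2"
     "entropy_var \<Gamma> q $ 4 = - z * L"
    by (simp_all add: entropy_var_def Let_def z_def L_def)
  have "entropy_var \<Gamma> q \<bullet> cons \<Gamma> q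
     = rho q * L * (c - spec_entropy \<Gamma> q / (\<Gamma> - 1) + z)
     - z * L * ((rho q + c * prs q) * (L\<^sup>2 * (1 - (vel q $ 1)\<^sup>2 - (vel q $ 2)\<^sup>2)) - prs q)"
    unfolding inner_real4 V1 V cons_def vector_4_nth mom_def energy_def h dens_def L_def[symmetric]
      vector_scaleR_component real_scaleR_def
    by algebra
  also have "\<dots> = rho q * L * (c - spec_entropy \<Gamma> q / (\<Gamma> - 1) + z) - L * z * rho q - L * (c - 1) * (prs q * z)"
    unfolding L by (simp add: algebra_simps)
  also have "\<dots> = dens q + eta \<Gamma> q"
    unfolding p(3) by (simp add: dens_def L_def eta_def algebra_simps)
  finally show ?thesis .
qed

text \<open>Legendre dual of \<open>potential_convex\<close> with \<open>n = 0\<close>.\<close>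

lemma entropy_convex:
  assumes "1 < \<Gamma>" "\<Gamma> \<le> 2" "prim_ok q" "prim_ok q'"
  shows "entropy_var \<Gamma> q \<bullet> (cons \<Gamma> q' - cons \<Gamma> q) \<le> eta \<Gamma> q' - eta \<Gamma> q"
  using potential_convex[of \<Gamma> q' q 0] inner_entropy_var_cons[of \<Gamma> q] inner_entropy_var_cons[of \<Gamma> q'] assms
  by (simp add: inner_diff_left inner_diff_right)

lemma cons_nth:
  "cons \<Gamma> q $ 1 = dens q"
  "cons \<Gamma> q $ 2 = (rho q * enthalpy \<Gamma> q * (lorentz q)\<^sup>2) * vel q $ 1"
  "cons \<Gamma> q $ 3 = (rho q * enthalpy \<Gamma> q * (lorentz q)\<^sup>2) * vel q $ 2"
  "cons \<Gamma> q $ 4 = rho q * enthalpy \<Gamma> q * (lorentz q)\<^sup>2 - prs q"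
  by (simp_all add: cons_def mom_def energy_def)

text \<open>Density, momentum and energy fix the state once the inertia \<open>H = \<rho> h L\<^sup>2\<close> is known.  If two
  states with the same conserved vector had \<open>H < H'\<close>, then \<open>|H| |v| = |H'| |v'|\<close> would make the
  second one slower, and the equation of state would give
  \<open>p' - p \<le> c (1 + |v| |v'|) (H' - H) < H' - H\<close> with \<open>c = (\<Gamma> - 1) / \<Gamma> \<le> 1/2\<close>, whereas equality
  of the energies demands \<open>p' - p = H' - H\<close>.\<close>

lemma inertia_le_of_cons_eq:
  assumes G: "1 < \<Gamma>" "\<Gamma> \<le> 2" and q: "prim_ok q" "prim_ok q'" and eq: "cons \<Gamma> q = cons \<Gamma> q'"
  shows "rho q' * enthalpy \<Gamma> q' * (lorentz q')\<^sup>2 \<le> rho q * enthalpy \<Gamma> q * (lorentz q)\<^sup>2"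
proof (rule ccontr)
  define H :: "prim \<Rightarrow> real" where "H = (\<lambda>r. rho r * enthalpy \<Gamma> r * (lorentz r)\<^sup>2)"
  define c where "c = (\<Gamma> - 1) / \<Gamma>"
  have c: "0 < c" "c \<le> 1/2" using G by (auto simp: c_def field_simps)
  assume "\<not> ?thesis"
  then have lt: "H q < H q'" by (simp add: H_def)
  have pos: "rho r > 0" "prs r > 0" "enthalpy \<Gamma> r > 0" "lorentz r > 0" "H r > 0" if "prim_ok r" for r
  proof -
    show "rho r > 0" "prs r > 0" "lorentz r > 0" using that lorentz_facts by (auto simp: prim_ok_def)
    then have "\<Gamma> * prs r / ((\<Gamma> - 1) * rho r) > 0" using G by simp
    then show "enthalpy \<Gamma> r > 0" by (simp add: enthalpy_def)
    with \<open>rho r > 0\<close> \<open>lorentz r > 0\<close> show "H r > 0" by (simp add: H_def)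
  qed
  define s :: "prim \<Rightarrow> real" where "s = (\<lambda>r. norm (vel r))"
  have s: "0 \<le> s r" "s r < 1" if "prim_ok r" for r using that by (auto simp: prim_ok_def s_def)
  have L2: "(lorentz r)\<^sup>2 * (1 - (s r)\<^sup>2) = 1" if "prim_ok r" for r
    using lorentz_facts(2)[OF that] unfolding s_def norm_real2_sq by algebra
  have comp: "dens q = dens q'" "H q *\<^sub>R vel q = H q' *\<^sub>R vel q'" "H q - prs q = H q' - prs q'"
    using eq by (auto simp: vec_eq_iff forall_4 forall_2 cons_nth H_def)
  have Hs: "H q * s q = H q' * s q'"
    using arg_cong[OF comp(2), of norm] pos(5)[OF q(1)] pos(5)[OF q(2)] by (simp add: s_def)
  have ss: "s q' \<le> s q"
  proof (rule ccontr)
    assume "\<not> s q' \<le> s q"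
    then have "H q * s q < H q' * s q'"
      using lt pos(5)[OF q(1)] s[OF q(1)] by (intro mult_strict_mono) auto
    then show False using Hs by simp
  qed
  have p: "prs r = c * (H r * (1 - (s r)\<^sup>2) - rho r)" if "prim_ok r" for r
  proof -
    have "H r * (1 - (s r)\<^sup>2) = rho r * enthalpy \<Gamma> r"
      using L2[OF that] unfolding H_def by (simp add: mult.assoc)
    then have "H r * (1 - (s r)\<^sup>2) - rho r = rho r * (\<Gamma> * prs r / ((\<Gamma> - 1) * rho r))"
      by (simp add: enthalpy_def algebra_simps)
    also have "\<dots> = \<Gamma> * prs r / (\<Gamma> - 1)" using pos[OF that] by simp
    finally show ?thesis using G by (simp add: c_def)
  qed
  have rr: "rho q \<le> rho q'"
  proof -
    have "lorentz q' \<le> lorentz q"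
    proof -
      have "1 - (s q)\<^sup>2 \<le> 1 - (s q')\<^sup>2" using ss s[OF q(2)] by (simp add: power_mono)
      moreover have "0 < 1 - (s q)\<^sup>2" using s[OF q(1)] by (simp add: abs_square_less_1)
      moreover have "lorentz r = 1 / sqrt (1 - (s r)\<^sup>2)" for r by (simp add: lorentz_def s_def)
      ultimately show ?thesis by (simp only:, intro divide_left_mono) (auto intro!: mult_pos_pos)
    qed
    moreover have "rho q * lorentz q = rho q' * lorentz q'" using comp(1) by (simp add: dens_def)
    ultimately show ?thesis using pos[OF q(1)] pos[OF q(2)]
      by (metis linorder_not_le mult_strict_mono less_imp_le nle_le order_less_irrefl mult_less_le_imp_less)
  qed
  have "H q' - H q = prs q' - prs q" using comp(3) by simp
  also have "\<dots> = c * ((H q' * (1 - (s q')\<^sup>2) - H q * (1 - (s q)\<^sup>2)) - (rho q' - rho q))"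
    using p[OF q(1)] p[OF q(2)] by (simp add: algebra_simps)
  also have "H q' * (1 - (s q')\<^sup>2) - H q * (1 - (s q)\<^sup>2) = (H q' - H q) * (1 + s q * s q')"
    using Hs by algebra
  also have "c * ((H q' - H q) * (1 + s q * s q') - (rho q' - rho q)) \<le> c * ((H q' - H q) * (1 + s q * s q'))"
    using c rr by (intro mult_left_mono) auto
  also have "\<dots> \<le> (1/2) * ((H q' - H q) * (1 + s q * s q'))"
    using c lt s q by (intro mult_right_mono) auto
  also have "\<dots> < (1/2) * ((H q' - H q) * 2)"
  proof -
    have "s q * s q' < 1 * 1" using s[OF q(1)] s[OF q(2)] by (intro mult_strict_mono') auto
    then have "(H q' - H q) * (1 + s q * s q') < (H q' - H q) * 2" using lt by (intro mult_strict_left_mono) auto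
    then show ?thesis by simp
  qed
  finally show False by simp
qed

lemma cons_inj:
  assumes G: "1 < \<Gamma>" "\<Gamma> \<le> 2" and q: "prim_ok q" "prim_ok q'" and eq: "cons \<Gamma> q = cons \<Gamma> q'"
  shows "q = q'"
proof -
  have H: "rho q * enthalpy \<Gamma> q * (lorentz q)\<^sup>2 = rho q' * enthalpy \<Gamma> q' * (lorentz q')\<^sup>2" (is "?H = ?H'")
    using inertia_le_of_cons_eq[OF G q eq] inertia_le_of_cons_eq[OF G q(2,1) eq[symmetric]] by simp
  have comp: "dens q = dens q'" "?H * vel q $ 1 = ?H' * vel q' $ 1" "?H * vel q $ 2 = ?H' * vel q' $ 2"
       "?H - prs q = ?H' - prs q'"
    using eq by (auto simp: vec_eq_iff forall_4 cons_nth)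
  have p: "prs q = prs q'" using comp(4) H by simp
  have "enthalpy \<Gamma> q > 0"
  proof -
    have "\<Gamma> * prs q / ((\<Gamma> - 1) * rho q) > 0" using G q by (simp add: prim_ok_def)
    then show ?thesis by (simp add: enthalpy_def)
  qed
  then have "?H \<noteq> 0" using q(1) lorentz_facts(1)[OF q(1)] by (simp add: prim_ok_def)
  then have v: "vel q = vel q'" using comp(2,3) H by (auto simp: vec_eq_iff forall_2)
  then have "lorentz q = lorentz q'" by (simp add: lorentz_def)
  then have "rho q = rho q'" using comp(1) lorentz_facts(1)[OF q(2)] by (simp add: dens_def)
  with v p show ?thesis by simp
qed

lemma prim_of_cons:
  assumes "1 < \<Gamma>" "\<Gamma> \<le> 2" "prim_ok q"
  shows "prim_of \<Gamma> (cons \<Gamma> q) = q"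
  unfolding prim_of_def using assms cons_inj[of \<Gamma>] by (intro the_equality) auto

lemma prim_of_admissible:
  assumes "1 < \<Gamma>" "\<Gamma> \<le> 2" "admissible \<Gamma> U"
  shows "prim_ok (prim_of \<Gamma> U)" "cons \<Gamma> (prim_of \<Gamma> U) = U"
  using assms prim_of_cons by (auto simp: admissible_def)

section \<open>Dissipation of the Lax--Friedrichs flux\<close>

text \<open>The dissipation splits into an acoustic part with speed \<open>l\<close> and an advective part with speed
  \<open>s\<close>.  The acoustic part is half the sum of the convexity inequalities for \<open>n = e\<close> and
  \<open>n = - e\<close>, taken from opposite ends; the advective part is upwinding, controlled by \<open>n = 0\<close>.\<close>

theorem lax_friedrichs_dissipative:
  fixes e :: "real^2" and s l :: real
  assumes G: "1 < \<Gamma>" "\<Gamma> \<le> 2" and q: "prim_ok q" "prim_ok q'" and e: "norm e \<le> 1" and l: "0 \<le> l"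
  defines "H \<equiv> \<lambda>r. l *\<^sub>R (\<Sum>a\<in>UNIV. e $ a *\<^sub>R phys_flux \<Gamma> a r) - s *\<^sub>R cons \<Gamma> r"
  shows "(entropy_var \<Gamma> q' - entropy_var \<Gamma> q) \<bullet>
           ((1/2) *\<^sub>R (H q + H q') - ((\<bar>s\<bar> + l) / 2) *\<^sub>R (cons \<Gamma> q' - cons \<Gamma> q))
       \<le> dens q' * (l * (e \<bullet> vel q') - s) - dens q * (l * (e \<bullet> vel q) - s)"
proof -
  define dV where "dV = entropy_var \<Gamma> q' - entropy_var \<Gamma> q"
  define u u' where "u = dV \<bullet> cons \<Gamma> q" and "u' = dV \<bullet> cons \<Gamma> q'"
  define f f' where "f = dV \<bullet> (\<Sum>a\<in>UNIV. e $ a *\<^sub>R phys_flux \<Gamma> a q)"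
    and "f' = dV \<bullet> (\<Sum>a\<in>UNIV. e $ a *\<^sub>R phys_flux \<Gamma> a q')"
  have p1: "u + f \<le> dens q' * (1 + e \<bullet> vel q') - dens q * (1 + e \<bullet> vel q)"
    using potential_convex[OF G q e] by (simp add: u_def f_def dV_def inner_add_right)
  have p2: "f' - u' \<le> dens q * (1 - e \<bullet> vel q) - dens q' * (1 - e \<bullet> vel q')"
    using potential_convex[OF G q(2,1), of "- e"] e
    by (simp add: u'_def f'_def dV_def inner_add_right sum_negf inner_diff_left inner_diff_right)
  have p3: "u \<le> dens q' - dens q" "dens q' - dens q \<le> u'"
    using potential_convex[OF G q, of 0] potential_convex[OF G q(2,1), of 0]
    by (simp_all add: u_def u'_def dV_def inner_diff_left)
  have "l / 2 * ((f + u) + (f' - u')) \<le> l / 2 * (2 * (dens q' * (e \<bullet> vel q') - dens q * (e \<bullet> vel q)))"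
    using p1 p2 l by (intro mult_left_mono) (auto simp: algebra_simps)
  moreover have "- s / 2 * (u + u') - \<bar>s\<bar> / 2 * (u' - u) \<le> - s * (dens q' - dens q)"
  proof (cases "s \<ge> 0")
    case True
    then show ?thesis using mult_left_mono[OF p3(2) True] by (simp add: field_simps)
  next
    case False
    then have "- s * u \<le> - s * (dens q' - dens q)" using p3(1) by (intro mult_left_mono) auto
    then show ?thesis using False by (simp add: field_simps)
  qed
  moreover have "dV \<bullet> ((1/2) *\<^sub>R (H q + H q') - ((\<bar>s\<bar> + l) / 2) *\<^sub>R (cons \<Gamma> q' - cons \<Gamma> q))
      = l / 2 * ((f + u) + (f' - u')) + (- s / 2 * (u + u') - \<bar>s\<bar> / 2 * (u' - u))"
    unfolding H_def inner_diff_right inner_add_right inner_scaleR_right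
      u_def[symmetric] u'_def[symmetric] f_def[symmetric] f'_def[symmetric]
    by (simp add: field_simps)
  ultimately have "dV \<bullet> ((1/2) *\<^sub>R (H q + H q') - ((\<bar>s\<bar> + l) / 2) *\<^sub>R (cons \<Gamma> q' - cons \<Gamma> q))
      \<le> l / 2 * (2 * (dens q' * (e \<bullet> vel q') - dens q * (e \<bullet> vel q))) - s * (dens q' - dens q)" by linarith
  also have "\<dots> = dens q' * (l * (e \<bullet> vel q') - s) - dens q * (l * (e \<bullet> vel q) - s)"
    by (simp add: algebra_simps)
  finally show ?thesis unfolding dV_def .
qed

section \<open>The entropy along a trajectory\<close>

text \<open>The map from primitive to conserved variables is continuous and injective between open subsets
  of four-dimensional space, so invariance of domain makes its inverse continuous.\<close>

lemma continuous_entropy_var: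
  assumes G: "1 < \<Gamma>" "\<Gamma> \<le> 2"
  shows "continuous_on {U. admissible \<Gamma> U} (\<lambda>U. entropy_var \<Gamma> (prim_of \<Gamma> U))"
proof -
  define P :: "real \<times> (real^2) \<times> real \<Rightarrow> prim" where "P = (\<lambda>(r, v, p). \<lparr>rho = r, vel = v, prs = p\<rparr>)"
  define S where "S = {x. prim_ok (P x)}"
  have Ssimp: "S = {x. fst x > 0} \<inter> {x. snd (snd x) > 0} \<inter> {x. norm (fst (snd x)) < 1}"
    by (auto simp: S_def prim_ok_def P_def split: prod.splits)
  have "open S" unfolding Ssimp by (intro open_Int open_Collect_less continuous_intros)
  have PS: "P (rho q, vel q, prs q) = q" for q by (simp add: P_def)
  have sel: "rho (P x) = fst x" "vel (P x) = fst (snd x)" "prs (P x) = snd (snd x)" for x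
    by (auto simp: P_def split: prod.splits)
  have img: "(\<lambda>x. cons \<Gamma> (P x)) ` S = {U. admissible \<Gamma> U}"
    unfolding S_def admissible_def image_def by (auto, metis PS)
  have inj: "inj_on (\<lambda>x. cons \<Gamma> (P x)) S"
  proof (rule inj_onI)
    fix x y assume "x \<in> S" "y \<in> S" "cons \<Gamma> (P x) = cons \<Gamma> (P y)"
    then have "P x = P y" using cons_inj[OF G] by (auto simp: S_def)
    then show "x = y" using sel[of x] sel[of y] by (simp add: prod_eq_iff)
  qed
  have lor: "continuous_on S (\<lambda>x. lorentz (P x))"
    unfolding lorentz_def sel
    by (intro continuous_intros) (use less_irrefl in \<open>auto simp: Ssimp power2_eq_1_iff, (metis norm_ge_zero neg_0_le_iff_le not_one_le_zero)?\<close>)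
  have cont: "continuous_on S (\<lambda>x. cons \<Gamma> (P x))"
  proof -
    have "continuous_on S (\<lambda>x. cons \<Gamma> (P x) $ i)" for i
      using exhaust_4[of i]
      by (elim disjE; simp add: cons_nth dens_def enthalpy_def sel;
          intro continuous_intros lor; use G in \<open>force simp: Ssimp\<close>)
    then show ?thesis by (intro continuous_on_vec_lambda[of S, where f="\<lambda>i x. cons \<Gamma> (P x) $ i", simplified])
  qed
  have contV: "continuous_on S (\<lambda>x. entropy_var \<Gamma> (P x))"
  proof -
    have "continuous_on S (\<lambda>x. entropy_var \<Gamma> (P x) $ i)" for i
      using exhaust_4[of i]
      by (elim disjE; simp add: entropy_var_def Let_def spec_entropy_def sel;
          intro continuous_intros lor; use G in \<open>force simp: Ssimp\<close>)
    then show ?thesis by (intro continuous_on_vec_lambda[of S, where f="\<lambda>i x. entropy_var \<Gamma> (P x) $ i", simplified])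
  qed
  obtain g where g: "homeomorphism S ((\<lambda>x. cons \<Gamma> (P x)) ` S) (\<lambda>x. cons \<Gamma> (P x)) g"
    using invariance_of_domain_homeomorphism[OF \<open>open S\<close> cont _ inj] by auto
  have gS: "g U \<in> S" "cons \<Gamma> (P (g U)) = U" if "admissible \<Gamma> U" for U
    using g that unfolding img homeomorphism_def by auto
  have Pg: "prim_of \<Gamma> U = P (g U)" if "admissible \<Gamma> U" for U
    using prim_of_cons[OF G, of "P (g U)"] gS[OF that] by (simp add: S_def)
  have "continuous_on {U. admissible \<Gamma> U} (\<lambda>U. entropy_var \<Gamma> (P (g U)))"
    using g unfolding img homeomorphism_def
    by (intro continuous_on_compose2[OF contV, of _ g]) auto
  then show ?thesis by (rule continuous_on_eq) (simp add: Pg)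
qed

lemma eventually_at_withinI:
  assumes "\<And>s. s \<in> T \<Longrightarrow> s \<noteq> t \<Longrightarrow> P s"
  shows "eventually P (at t within T)"
  using assms by (auto simp: eventually_at_filter intro: always_eventually)

text \<open>Differentiability of the primitive variables is avoided: convexity squeezes the difference
  quotient of the entropy between two expressions that share a limit, since \<open>V\<close> is continuous
  in \<open>U\<close>.\<close>

lemma eta_has_derivative_along:
  assumes G: "1 < \<Gamma>" "\<Gamma> \<le> 2" and t: "t \<in> T"
    and adm: "\<And>s. s \<in> T \<Longrightarrow> admissible \<Gamma> (U s)"
    and U: "(U has_vector_derivative U') (at t within T)"
  shows "((\<lambda>s. eta \<Gamma> (prim_of \<Gamma> (U s))) has_real_derivative entropy_var \<Gamma> (prim_of \<Gamma> (U t)) \<bullet> U') (at t within T)"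
proof -
  define V where "V = (\<lambda>s. entropy_var \<Gamma> (prim_of \<Gamma> (U s)))"
  define h where "h = (\<lambda>s. eta \<Gamma> (prim_of \<Gamma> (U s)))"
  define d where "d = (\<lambda>s. (U s - U t) /\<^sub>R (s - t))"
  have d: "(d \<longlongrightarrow> U') (at t within T)"
    
  proof -
    have "((\<lambda>s. (1 / \<bar>s - t\<bar>) *\<^sub>R (U s - (U t + (s - t) *\<^sub>R U'))) \<longlongrightarrow> 0) (at t within T)"
      using U by (auto simp: has_vector_derivative_def has_derivative_within)
    then have z: "((\<lambda>s. norm ((1 / \<bar>s - t\<bar>) *\<^sub>R (U s - (U t + (s - t) *\<^sub>R U')))) \<longlongrightarrow> 0) (at t within T)"
      by (rule tendsto_norm_zero)
    have eq: "norm (d s - U') = norm ((1 / \<bar>s - t\<bar>) *\<^sub>R (U s - (U t + (s - t) *\<^sub>R U')))" if "s \<noteq> t" for s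
    proof -
      have "d s - U' = (1 / (s - t)) *\<^sub>R (U s - (U t + (s - t) *\<^sub>R U'))"
      proof -
        have "(1 / (s - t)) *\<^sub>R ((U s - U t) - (s - t) *\<^sub>R U')
            = (1 / (s - t)) *\<^sub>R (U s - U t) - ((1 / (s - t)) * (s - t)) *\<^sub>R U'"
          by (simp only: scaleR_diff_right scaleR_scaleR)
        then show ?thesis using that by (simp add: d_def divide_inverse diff_diff_eq)
      qed
      then show ?thesis by (simp add: abs_divide)
    qed
    have "((\<lambda>s. d s - U') \<longlongrightarrow> 0) (at t within T)"
      by (rule Lim_null_comparison[OF _ z]) (rule eventually_at_withinI, rule eq_refl, rule eq)
    then show ?thesis by (simp add: LIM_zero_iff)
  qed
  have Ucont: "(U \<longlongrightarrow> U t) (at t within T)"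
    using has_vector_derivative_continuous[OF U] by (simp add: continuous_within)
  have Vc: "(V \<longlongrightarrow> V t) (at t within T)"
  proof -
    have "continuous (at (U t) within {U. admissible \<Gamma> U}) (\<lambda>U. entropy_var \<Gamma> (prim_of \<Gamma> U))"
      using continuous_entropy_var[OF G] adm[OF t] by (simp add: continuous_on_eq_continuous_within)
    then show ?thesis unfolding V_def
      by (rule continuous_within_tendsto_compose[OF _ _ Ucont]) (use adm in \<open>auto intro: eventually_at_withinI\<close>)
  qed
  have ineq: "V a \<bullet> (U b - U a) \<le> h b - h a" if "a \<in> T" "b \<in> T" for a b
    using entropy_convex[OF G, of "prim_of \<Gamma> (U a)" "prim_of \<Gamma> (U b)"]
      prim_of_admissible[OF G adm[OF that(1)]] prim_of_admissible[OF G adm[OF that(2)]]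
    by (simp add: V_def h_def)
  \<comment> \<open>Convexity at both ends traps the difference quotient between \<open>V t \<bullet> d s\<close> and \<open>V s \<bullet> d s\<close>.\<close>
  have bnd: "\<bar>(h s - h t) / (s - t) - V t \<bullet> d s\<bar> \<le> \<bar>(V s - V t) \<bullet> d s\<bar>" if "s \<in> T" "s \<noteq> t" for s
  proof -
    have "0 \<le> h s - h t - V t \<bullet> (U s - U t)" "h s - h t - V t \<bullet> (U s - U t) \<le> (V s - V t) \<bullet> (U s - U t)"
      using ineq[OF t that(1)] ineq[OF that(1) t] by (simp_all add: inner_diff_left inner_diff_right)
    then have "\<bar>h s - h t - V t \<bullet> (U s - U t)\<bar> \<le> \<bar>(V s - V t) \<bullet> (U s - U t)\<bar>" by linarith
    then have "\<bar>h s - h t - V t \<bullet> (U s - U t)\<bar> / \<bar>s - t\<bar> \<le> \<bar>(V s - V t) \<bullet> (U s - U t)\<bar> / \<bar>s - t\<bar>"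
      by (rule divide_right_mono) simp
    moreover have "V t \<bullet> d s = V t \<bullet> (U s - U t) / (s - t)" "(V s - V t) \<bullet> d s = (V s - V t) \<bullet> (U s - U t) / (s - t)"
      by (simp_all add: d_def divide_inverse)
    ultimately show ?thesis by (simp only: diff_divide_distrib[symmetric] abs_divide)
  qed
  have "((\<lambda>s. (V s - V t) \<bullet> d s) \<longlongrightarrow> (V t - V t) \<bullet> U') (at t within T)"
    by (intro tendsto_intros Vc d)
  then have z: "((\<lambda>s. \<bar>(V s - V t) \<bullet> d s\<bar>) \<longlongrightarrow> 0) (at t within T)"
    by (intro tendsto_rabs_zero) simp
  have "((\<lambda>s. (h s - h t) / (s - t) - V t \<bullet> d s) \<longlongrightarrow> 0) (at t within T)"
    by (rule Lim_null_comparison[OF _ z]) (rule eventually_at_withinI, simp only: real_norm_def, rule bnd)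
  moreover have "((\<lambda>s. V t \<bullet> d s) \<longlongrightarrow> V t \<bullet> U') (at t within T)" by (intro tendsto_intros d)
  ultimately have "((\<lambda>s. ((h s - h t) / (s - t) - V t \<bullet> d s) + V t \<bullet> d s) \<longlongrightarrow> 0 + V t \<bullet> U') (at t within T)"
    by (rule tendsto_add)
  then show ?thesis by (simp add: has_field_derivative_iff h_def V_def)
qed

section \<open>Explicit formulas for the geometry\<close>

lemma matrix_inv_eqI:
  fixes A :: "'a::field^'n^'n"
  assumes "A ** B = mat 1"
  shows "matrix_inv A = B"
proof -
  have BA: "B ** A = mat 1" using assms by (simp add: matrix_left_right_inverse)
  have "A ** matrix_inv A = mat 1 \<and> matrix_inv A ** A = mat 1"
    unfolding matrix_inv_def by (rule someI[of _ B]) (simp add: assms BA)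
  then have "matrix_inv A = (B ** A) ** matrix_inv A" by (simp add: BA)
  also have "\<dots> = B" using \<open>A ** matrix_inv A = mat 1 \<and> _\<close> by (simp add: matrix_mul_assoc[symmetric])
  finally show ?thesis .
qed

lemma geom_ok_iff:
  "geom_ok G \<longleftrightarrow> lapse G > 0 \<and> metric G $ 2 $ 1 = metric G $ 1 $ 2 \<and> metric G $ 2 $ 2 > 0 \<and>
     metric G $ 1 $ 1 * metric G $ 2 $ 2 - (metric G $ 1 $ 2)\<^sup>2 > 0"
proof -
  define a b d where "a = metric G $ 1 $ 1" and "b = metric G $ 1 $ 2" and "d = metric G $ 2 $ 2"
  have sym: "transpose (metric G) = metric G \<longleftrightarrow> metric G $ 2 $ 1 = b"
    by (auto simp: transpose_def vec_eq_iff forall_2 b_def)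
  have quad: "y \<bullet> (metric G *v y) = a * (y$1)\<^sup>2 + 2 * b * y$1 * y$2 + d * (y$2)\<^sup>2"
    if "metric G $ 2 $ 1 = b" for y
    using that by (simp add: inner_vec_def sum_2 matrix_vector_mult_def a_def b_def d_def algebra_simps power2_eq_square)
  have "(\<forall>y. y \<noteq> 0 \<longrightarrow> y \<bullet> (metric G *v y) > 0) \<longleftrightarrow> d > 0 \<and> a * d - b\<^sup>2 > 0"
    if s: "metric G $ 2 $ 1 = b"
  proof
    assume pos: "\<forall>y. y \<noteq> 0 \<longrightarrow> y \<bullet> (metric G *v y) > 0"
    have "(vector [0, 1] :: real^2) \<noteq> 0" by (simp add: vec_eq_iff forall_2)
    then have d: "d > 0" using pos quad[OF s] by fastforce
    have "(vector [d, -b] :: real^2) \<noteq> 0" using d by (simp add: vec_eq_iff forall_2)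
    then have "a * d\<^sup>2 + 2 * b * d * (-b) + d * (-b)\<^sup>2 > 0" using pos quad[OF s] by fastforce
    also have "a * d\<^sup>2 + 2 * b * d * (-b) + d * (-b)\<^sup>2 = d * (a * d - b\<^sup>2)" by algebra
    finally show "d > 0 \<and> a * d - b\<^sup>2 > 0" using d by (simp add: zero_less_mult_iff)
  next
    assume h: "d > 0 \<and> a * d - b\<^sup>2 > 0"
    show "\<forall>y. y \<noteq> 0 \<longrightarrow> y \<bullet> (metric G *v y) > 0"
    proof (intro allI impI)
      fix y :: "real^2" assume y: "y \<noteq> 0"
      have "d * (y \<bullet> (metric G *v y)) = (a * d - b\<^sup>2) * (y$1)\<^sup>2 + (b * y$1 + d * y$2)\<^sup>2"
        unfolding quad[OF s] by algebra
      also have "\<dots> > 0"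
      proof (cases "y $ 1 = 0")
        case True
        then have "y $ 2 \<noteq> 0" using y by (auto simp: vec_eq_iff forall_2)
        then show ?thesis using True h by simp
      next
        case False
        then show ?thesis using h by (intro add_pos_nonneg mult_pos_pos) auto
      qed
      finally show "y \<bullet> (metric G *v y) > 0" using h by (simp add: zero_less_mult_iff)
    qed
  qed
  then show ?thesis unfolding geom_ok_def sym a_def[symmetric] b_def[symmetric] d_def[symmetric] by blast
qed

lemma j2_eq:
  assumes "geom_ok G"
  shows "j2 G = sqrt (metric G $ 1 $ 1 * metric G $ 2 $ 2 - (metric G $ 1 $ 2)\<^sup>2)"
    and "j2 G > 0"
    and "(j2 G)\<^sup>2 = metric G $ 1 $ 1 * metric G $ 2 $ 2 - (metric G $ 1 $ 2)\<^sup>2"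
proof -
  show e: "j2 G = sqrt (metric G $ 1 $ 1 * metric G $ 2 $ 2 - (metric G $ 1 $ 2)\<^sup>2)"
    using assms by (simp add: geom_ok_iff j2_def det_2 power2_eq_square)
  show "j2 G > 0" "(j2 G)\<^sup>2 = metric G $ 1 $ 1 * metric G $ 2 $ 2 - (metric G $ 1 $ 2)\<^sup>2"
    using assms unfolding e by (auto simp: geom_ok_iff)
qed

lemma matrix_inv_metric:
  assumes "geom_ok G"
  shows "matrix_inv (metric G) = vector [vector [metric G $ 2 $ 2 / (j2 G)\<^sup>2, - metric G $ 1 $ 2 / (j2 G)\<^sup>2],
     vector [- metric G $ 1 $ 2 / (j2 G)\<^sup>2, metric G $ 1 $ 1 / (j2 G)\<^sup>2]]"
proof (rule matrix_inv_eqI)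
  have j: "(j2 G)\<^sup>2 \<noteq> 0" using j2_eq(2)[OF assms] by simp
  have s: "metric G $ 2 $ 1 = metric G $ 1 $ 2" using assms by (simp add: geom_ok_iff)
  show "metric G ** vector [vector [metric G $ 2 $ 2 / (j2 G)\<^sup>2, - metric G $ 1 $ 2 / (j2 G)\<^sup>2],
     vector [- metric G $ 1 $ 2 / (j2 G)\<^sup>2, metric G $ 1 $ 1 / (j2 G)\<^sup>2]] = mat 1"
    using j j2_eq(3)[OF assms]
    by (simp add: vec_eq_iff forall_2 matrix_matrix_mult_def sum_2 mat_def s field_simps power2_eq_square)
qed

text \<open>The Cholesky factor of the inverse of a two-dimensional metric.\<close>

lemma Theta_explicit:
  assumes "geom_ok G"
  shows "Theta G = vector [vector [sqrt (metric G $ 2 $ 2) / j2 G, - metric G $ 1 $ 2 / (j2 G * sqrt (metric G $ 2 $ 2))],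
     vector [0, 1 / sqrt (metric G $ 2 $ 2)]]" (is "_ = ?T")
    and "transpose (Theta G) ** Theta G = matrix_inv (metric G)"
proof -
  define a b d j r where "a = metric G $ 1 $ 1" and "b = metric G $ 1 $ 2" and "d = metric G $ 2 $ 2"
    and "j = j2 G" and "r = sqrt (metric G $ 2 $ 2)"
  have pos: "d > 0" "j > 0" "r > 0" and j: "j\<^sup>2 = a * d - b\<^sup>2" and r: "r\<^sup>2 = d"
    using assms j2_eq[OF assms] by (auto simp: geom_ok_iff a_def b_def d_def j_def r_def)
  have T: "?T = vector [vector [r / j, - b / (j * r)], vector [0, 1 / r]]"
    by (simp add: b_def j_def r_def)
  have inv: "matrix_inv (metric G) = vector [vector [d / j\<^sup>2, - b / j\<^sup>2], vector [- b / j\<^sup>2, a / j\<^sup>2]]"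
    by (simp add: matrix_inv_metric[OF assms] a_def b_def d_def j_def)
  have 22: "(b / (j * r))\<^sup>2 + (1 / r)\<^sup>2 = a / j\<^sup>2"
  proof -
    have "(b / (j * r))\<^sup>2 + (1 / r)\<^sup>2 = (b\<^sup>2 + j\<^sup>2) / (j\<^sup>2 * r\<^sup>2)"
      using pos by (simp add: power_divide power_mult_distrib add_divide_distrib)
    also have "b\<^sup>2 + j\<^sup>2 = a * r\<^sup>2" using j r by simp
    finally show ?thesis using pos by simp
  qed
  let ?P = "\<lambda>\<Theta>::real^2^2. \<Theta> $ 2 $ 1 = 0 \<and> \<Theta> $ 1 $ 1 > 0 \<and> \<Theta> $ 2 $ 2 > 0 \<and>
                transpose \<Theta> ** \<Theta> = matrix_inv (metric G)"
  have PT: "?P ?T"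
  proof -
    have "r / j * (r / j) = d / j\<^sup>2" using r by (simp add: power2_eq_square)
    moreover have "r / j * (b / (j * r)) = b / j\<^sup>2" using pos by (simp add: power2_eq_square)
    ultimately show ?thesis
      unfolding T inv using pos 22
      by (simp add: vec_eq_iff forall_2 matrix_matrix_mult_def sum_2 transpose_def power2_eq_square mult.commute)
  qed
  have "S = ?T" if S: "?P S" for S
  proof -
    have e: "(S$1$1)\<^sup>2 = d / j\<^sup>2" "S$1$1 * S$1$2 = - b / j\<^sup>2" "(S$1$2)\<^sup>2 + (S$2$2)\<^sup>2 = a / j\<^sup>2"
      using S unfolding inv
      by (auto simp: vec_eq_iff forall_2 matrix_matrix_mult_def sum_2 transpose_def power2_eq_square)
    have s1: "S$1$1 = r / j"
      using S pos e(1) r by (intro power2_eq_imp_eq[of "S$1$1"]) (auto simp: power_divide)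
    have s2: "S$1$2 = - b / (j * r)"
      using e(2) pos unfolding s1 by (simp add: field_simps power2_eq_square)
    have "(S$2$2)\<^sup>2 = (1 / r)\<^sup>2" using e(3) 22 unfolding s2 by (simp add: power2_eq_square)
    then have s3: "S$2$2 = 1 / r" using S pos by (intro power2_eq_imp_eq[of "S$2$2"]) auto
    show ?thesis unfolding T using s1 s2 s3 S by (simp add: vec_eq_iff forall_2)
  qed
  then show "Theta G = ?T" unfolding Theta_def using PT by (intro the_equality) auto
  then show "transpose (Theta G) ** Theta G = matrix_inv (metric G)" using PT by simp
qed

lemma Ageo_explicit:
  assumes "geom_ok G"
  shows "Ageo G 1 1 = lapse G * sqrt (metric G $ 2 $ 2)"
    and "Ageo G 1 2 = - lapse G * metric G $ 1 $ 2 / sqrt (metric G $ 2 $ 2)"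
    and "Ageo G 2 1 = 0"
    and "Ageo G 2 2 = lapse G * j2 G / sqrt (metric G $ 2 $ 2)"
  using j2_eq(2)[OF assms] by (simp_all add: Ageo_def Theta_explicit(1)[OF assms])

lemma sum_option2: "(\<Sum>\<mu>\<in>UNIV. f (\<mu> :: 2 option)) = f None + f (Some 1) + f (Some 2)"
  for f :: "2 option \<Rightarrow> 'a::comm_monoid_add"
  by (simp add: UNIV_option_conv sum.reindex sum_2 add.assoc)

lemma forall_option2: "(\<forall>\<mu> :: 2 option. P \<mu>) \<longleftrightarrow> P None \<and> P (Some 1) \<and> P (Some 2)"
  by (metis exhaust_2 not_None_eq)

lemma st_metric_nth:
  "st_metric G $ None $ None = - (lapse G)\<^sup>2 + shift G \<bullet> (metric G *v shift G)"
  "st_metric G $ None $ Some I = (metric G *v shift G) $ I"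
  "st_metric G $ Some I $ None = (metric G *v shift G) $ I"
  "st_metric G $ Some I $ Some J = metric G $ I $ J"
  by (simp_all add: st_metric_def)

lemma matrix_inv_st_metric:
  assumes "geom_ok G"
  shows "matrix_inv (st_metric G) $ None $ None = - 1 / (lapse G)\<^sup>2"
    and "matrix_inv (st_metric G) $ None $ Some I = shift G $ I / (lapse G)\<^sup>2"
    and "matrix_inv (st_metric G) $ Some I $ None = shift G $ I / (lapse G)\<^sup>2"
    and "matrix_inv (st_metric G) $ Some I $ Some J = matrix_inv (metric G) $ I $ J - shift G $ I * shift G $ J / (lapse G)\<^sup>2"
proof -
  define B :: "real^(2 option)^(2 option)" where "B = (\<chi> \<mu> \<nu>. case (\<mu>, \<nu>) of
       (None, None) \<Rightarrow> - 1 / (lapse G)\<^sup>2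
     | (None, Some I) \<Rightarrow> shift G $ I / (lapse G)\<^sup>2
     | (Some I, None) \<Rightarrow> shift G $ I / (lapse G)\<^sup>2
     | (Some I, Some J) \<Rightarrow> matrix_inv (metric G) $ I $ J - shift G $ I * shift G $ J / (lapse G)\<^sup>2)"
  define H where "H = matrix_inv (metric G)"
  have al: "lapse G \<noteq> 0" using assms by (auto simp: geom_ok_iff)
  have s: "metric G $ 2 $ 1 = metric G $ 1 $ 2" using assms by (simp add: geom_ok_iff)
  have j: "(j2 G)\<^sup>2 \<noteq> 0" using j2_eq(2)[OF assms] by simp
  have mH: "metric G $ 1 $ 1 * H $ 1 $ 1 + metric G $ 1 $ 2 * H $ 1 $ 2 = 1"
       "metric G $ 1 $ 1 * H $ 1 $ 2 + metric G $ 1 $ 2 * H $ 2 $ 2 = 0"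
       "metric G $ 1 $ 2 * H $ 1 $ 1 + metric G $ 2 $ 2 * H $ 1 $ 2 = 0"
       "metric G $ 1 $ 2 * H $ 1 $ 2 + metric G $ 2 $ 2 * H $ 2 $ 2 = 1" "H $ 2 $ 1 = H $ 1 $ 2"
    using j j2_eq(3)[OF assms] unfolding H_def matrix_inv_metric[OF assms]
    by (simp_all add: field_simps power2_eq_square)
  define i where "i = 1 / lapse G"
  have ial: "lapse G * i = 1" using al by (simp add: i_def)
  have B: "B $ None $ None = - (i\<^sup>2)" "B $ None $ Some I = shift G $ I * i\<^sup>2" "B $ Some I $ None = shift G $ I * i\<^sup>2"
     "B $ Some I $ Some J = H $ I $ J - shift G $ I * shift G $ J * i\<^sup>2" for I J
    by (simp_all add: B_def i_def H_def power_divide)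
  have "st_metric G ** B = mat 1"
    unfolding vec_eq_iff forall_option2
    apply (simp add: matrix_matrix_mult_def sum_option2 mat_def B st_metric_nth inner_vec_def sum_2
        matrix_vector_mult_def s mH(5))
    using ial mH(1-4) by (intro conjI; (simp add: algebra_simps; fail)?; (algebra)?)
  then have "matrix_inv (st_metric G) = B" by (rule matrix_inv_eqI)
  then show "matrix_inv (st_metric G) $ None $ None = - 1 / (lapse G)\<^sup>2"
    and "matrix_inv (st_metric G) $ None $ Some I = shift G $ I / (lapse G)\<^sup>2"
    and "matrix_inv (st_metric G) $ Some I $ None = shift G $ I / (lapse G)\<^sup>2"
    and "matrix_inv (st_metric G) $ Some I $ Some J = matrix_inv (metric G) $ I $ J - shift G $ I * shift G $ J / (lapse G)\<^sup>2"
    by (simp_all add: B_def)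
qed

section \<open>Calculus of partial derivatives\<close>

text \<open>Differentiability is part of the notion, because \<open>partial\<close> is defined through the Frechet
  derivative and is unspecified without it.\<close>

definition has_partials :: "(real^2 \<Rightarrow> real) \<Rightarrow> (2 \<Rightarrow> real) \<Rightarrow> real^2 \<Rightarrow> bool" where
  "has_partials f d x \<longleftrightarrow> (f has_derivative (\<lambda>h. \<Sum>I\<in>UNIV. d I * h $ I)) (at x)"

lemma partial_eqI: "(f has_derivative f') (at x) \<Longrightarrow> partial I f x = f' (axis I 1)"
  unfolding partial_def by (simp add: frechet_derivative_at[symmetric])

lemma has_partials_partial: "has_partials f d x \<Longrightarrow> partial I f x = d I"
  using partial_eqI[of f "\<lambda>h. \<Sum>J\<in>UNIV. d J * h $ J" x I] exhaust_2[of I]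
  unfolding has_partials_def by (auto simp: sum_2 axis_def)

lemma has_partials_const: "has_partials (\<lambda>y. c) (\<lambda>I. 0) x"
  by (simp add: has_partials_def)

lemma has_partials_add:
  "has_partials f d x \<Longrightarrow> has_partials g e x \<Longrightarrow> has_partials (\<lambda>y. f y + g y) (\<lambda>I. d I + e I) x"
  unfolding has_partials_def
  by (rule has_derivative_eq_rhs[OF has_derivative_add]) (auto simp: fun_eq_iff sum_2 algebra_simps)

lemma has_partials_minus:
  "has_partials f d x \<Longrightarrow> has_partials (\<lambda>y. - f y) (\<lambda>I. - d I) x"
  unfolding has_partials_def
  by (rule has_derivative_eq_rhs[OF has_derivative_minus]) (auto simp: fun_eq_iff sum_2)

lemma has_partials_diff:
  "has_partials f d x \<Longrightarrow> has_partials g e x \<Longrightarrow> has_partials (\<lambda>y. f y - g y) (\<lambda>I. d I - e I) x"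
  using has_partials_add[of f d x "\<lambda>y. - g y" "\<lambda>I. - e I"] has_partials_minus[of g e x] by simp

lemma has_partials_mult:
  "has_partials f d x \<Longrightarrow> has_partials g e x \<Longrightarrow> has_partials (\<lambda>y. f y * g y) (\<lambda>I. f x * e I + d I * g x) x"
  unfolding has_partials_def
  by (rule has_derivative_eq_rhs[OF has_derivative_mult]) (auto simp: fun_eq_iff sum_2 algebra_simps)

lemma has_partials_power2:
  "has_partials f d x \<Longrightarrow> has_partials (\<lambda>y. (f y)\<^sup>2) (\<lambda>I. 2 * f x * d I) x"
proof -
  assume f: "has_partials f d x"
  have "(\<lambda>I. f x * d I + d I * f x) = (\<lambda>I. 2 * f x * d I)" by (simp add: fun_eq_iff)
  then show "has_partials (\<lambda>y. (f y)\<^sup>2) (\<lambda>I. 2 * f x * d I) x"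
    using has_partials_mult[OF f f] by (simp add: power2_eq_square)
qed

lemma has_partials_chain:
  assumes "has_partials f d x" "(g has_real_derivative c) (at (f x))"
  shows "has_partials (\<lambda>y. g (f y)) (\<lambda>I. c * d I) x"
proof -
  have "((\<lambda>y. g (f y)) has_derivative (\<lambda>h. (\<Sum>I\<in>UNIV. d I * h $ I) * c)) (at x)"
    using DERIV_compose_FDERIV[OF assms(2) assms(1)[unfolded has_partials_def]] .
  moreover have "(\<lambda>h. (\<Sum>I\<in>UNIV. d I * h $ I) * c) = (\<lambda>h::real^2. \<Sum>I\<in>UNIV. c * d I * h $ I)"
    by (rule ext) (simp add: sum_2 algebra_simps)
  ultimately show ?thesis by (simp add: has_partials_def)
qed

lemma has_partials_sqrt:
  assumes "has_partials f d x" "f x > 0"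
  shows "has_partials (\<lambda>y. sqrt (f y)) (\<lambda>I. d I / (2 * sqrt (f x))) x"
proof -
  have eq: "inverse (sqrt (f x)) / 2 * d I = d I / (2 * sqrt (f x))" for I
    by (simp only: inverse_eq_divide times_divide_eq_left mult_1_left divide_divide_eq_left mult.commute[of 2])
  show ?thesis
    by (rule has_partials_chain[OF assms(1) DERIV_real_sqrt[OF assms(2)], unfolded eq])
qed

lemma has_partials_inverse:
  assumes "has_partials f d x" "f x \<noteq> 0"
  shows "has_partials (\<lambda>y. inverse (f y)) (\<lambda>I. - d I / (f x)\<^sup>2) x"
proof -
  have eq: "- (inverse (f x) ^ Suc (Suc 0)) * d I = - d I / (f x)\<^sup>2" for I
    using assms(2) by (simp add: power2_eq_square field_simps)
  show ?thesis
    by (rule has_partials_chain[OF assms(1) DERIV_inverse[OF assms(2)], unfolded eq])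
qed

lemma has_partials_divide:
  assumes "has_partials f d x" "has_partials g e x" "g x \<noteq> 0"
  shows "has_partials (\<lambda>y. f y / g y) (\<lambda>I. d I / g x - f x * e I / (g x)\<^sup>2) x"
proof -
  have "(\<lambda>I. f x * (- e I / (g x)\<^sup>2) + d I * inverse (g x)) = (\<lambda>I. d I / g x - f x * e I / (g x)\<^sup>2)"
    by (rule ext) (simp add: inverse_eq_divide)
  moreover have "(\<lambda>y. f y * inverse (g y)) = (\<lambda>y. f y / g y)"
    by (rule ext) (rule divide_inverse[symmetric])
  ultimately show ?thesis
    using has_partials_mult[OF assms(1) has_partials_inverse[OF assms(2,3)]] by simp
qed

lemma has_partials_cong:
  assumes "has_partials f d x" "open X" "x \<in> X" "\<And>y. y \<in> X \<Longrightarrow> f y = g y"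
  shows "has_partials g d x"
  unfolding has_partials_def
  by (rule has_derivative_transform_within_open[OF assms(1)[unfolded has_partials_def] assms(2,3,4)])

lemma has_partials_unique: "has_partials f d x \<Longrightarrow> has_partials f e x \<Longrightarrow> d = e"
  using has_partials_partial[of f d x] has_partials_partial[of f e x] by (intro ext) simp


lemma has_partials_self: "has_partials f d x \<Longrightarrow> has_partials f (\<lambda>I. partial I f x) x"
  using has_partials_partial[of f d x] by (simp add: has_partials_def)

section \<open>First-order jets of stationary geometries\<close>

definition geom_at :: "(real^2) set \<Rightarrow> real^2 \<Rightarrow> (real^2 \<Rightarrow> geom) \<Rightarrow> geom \<Rightarrow> bool" where
  "geom_at X x \<G> G \<longleftrightarrow> open X \<and> x \<in> X \<and> smooth_geom_on X \<G> \<and> \<G> x = G"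

lemma geom_at_ok: "geom_at X x \<G> G \<Longrightarrow> y \<in> X \<Longrightarrow> geom_ok (\<G> y)" "geom_at X x \<G> G \<Longrightarrow> geom_ok G"
  by (auto simp: geom_at_def smooth_geom_on_def)

lemma smooth_on_has_partials:
  assumes "smooth_on X f" "open X" "x \<in> X"
  shows "has_partials f (\<lambda>I. partial I f x) x"
proof -
  have "Ck_on 1 X f" using assms(1) by (simp only: smooth_on_def)
  then obtain g :: "2 \<Rightarrow> real^2 \<Rightarrow> real"
    where "\<forall>x\<in>X. (f has_derivative (\<lambda>y. \<Sum>I\<in>UNIV. g I x * y $ I)) (at x within X)"
    by auto
  then have "(f has_derivative (\<lambda>y. \<Sum>I\<in>UNIV. g I x * y $ I)) (at x)"
    using assms(3) by (simp only: at_within_open[OF assms(3,2), symmetric])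
  then have "has_partials f (\<lambda>I. g I x) x" by (simp add: has_partials_def)
  then show ?thesis by (rule has_partials_self)
qed

lemma geom_at_has_partials:
  assumes "geom_at X x \<G> G"
  shows "has_partials (\<lambda>y. lapse (\<G> y)) (\<lambda>I. partial I (\<lambda>y. lapse (\<G> y)) x) x"
    and "has_partials (\<lambda>y. shift (\<G> y) $ J) (\<lambda>I. partial I (\<lambda>y. shift (\<G> y) $ J) x) x"
    and "has_partials (\<lambda>y. metric (\<G> y) $ J $ K) (\<lambda>I. partial I (\<lambda>y. metric (\<G> y) $ J $ K) x) x"
proof -
  have s: "open X" "x \<in> X" "smooth_on X (\<lambda>x. lapse (\<G> x))" "smooth_on X (\<lambda>x. shift (\<G> x) $ J)"
    "smooth_on X (\<lambda>x. metric (\<G> x) $ J $ K)"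
    using assms unfolding geom_at_def smooth_geom_on_def by auto
  show "has_partials (\<lambda>y. lapse (\<G> y)) (\<lambda>I. partial I (\<lambda>y. lapse (\<G> y)) x) x"
    and "has_partials (\<lambda>y. shift (\<G> y) $ J) (\<lambda>I. partial I (\<lambda>y. shift (\<G> y) $ J) x) x"
    and "has_partials (\<lambda>y. metric (\<G> y) $ J $ K) (\<lambda>I. partial I (\<lambda>y. metric (\<G> y) $ J $ K) x) x"
    using s(3-5)[THEN smooth_on_has_partials[OF _ s(1,2)]] by blast+
qed

text \<open>The six independent variables in which the source is expanded.  The entry \<open>Ageo G 2 1\<close> is
  absent since it vanishes identically.\<close>

definition geovar :: "nat \<Rightarrow> geom \<Rightarrow> real" where
  "geovar k G = [j2 G, Ageo G 1 1, Ageo G 1 2, Ageo G 2 2, Cgeo G 1, Cgeo G 2] ! k"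

lemma sum_lessThan_6: "(\<Sum>k<(6::nat). f k) = f 0 + f 1 + f 2 + f 3 + f 4 + (f 5 :: 'a::comm_monoid_add)"
  by (simp add: eval_nat_numeral)

lemma geovar_nth [simp]:
  "geovar 0 = j2" "geovar (Suc 0) = (\<lambda>G. Ageo G 1 1)" "geovar 2 = (\<lambda>G. Ageo G 1 2)" "geovar 3 = (\<lambda>G. Ageo G 2 2)"
  "geovar 4 = (\<lambda>G. Cgeo G 1)" "geovar 5 = (\<lambda>G. Cgeo G 2)"
  by (simp_all add: geovar_def fun_eq_iff)

lemma geovar_derivs:
  assumes at: "geom_at X x \<G> G"
    and a: "has_partials (\<lambda>y. lapse (\<G> y)) a x"
    and b: "\<And>J. has_partials (\<lambda>y. shift (\<G> y) $ J) (b J) x"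
    and g: "\<And>J K. has_partials (\<lambda>y. metric (\<G> y) $ J $ K) (g J K) x"
  defines "r \<equiv> sqrt (metric G $ 2 $ 2)"
  defines "dr \<equiv> \<lambda>I. g 2 2 I / (2 * r)"
  defines "dj \<equiv> \<lambda>I. (metric G $ 1 $ 1 * g 2 2 I + g 1 1 I * metric G $ 2 $ 2 - 2 * metric G $ 1 $ 2 * g 1 2 I) / (2 * j2 G)"
  shows "has_partials (\<lambda>y. j2 (\<G> y)) dj x"
    and "has_partials (\<lambda>y. Ageo (\<G> y) 1 1) (\<lambda>I. lapse G * dr I + a I * r) x"
    and "has_partials (\<lambda>y. Ageo (\<G> y) 1 2) (\<lambda>I. (- lapse G * g 1 2 I + - a I * metric G $ 1 $ 2) / r
           - (- lapse G * metric G $ 1 $ 2) * dr I / r\<^sup>2) x"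
    and "has_partials (\<lambda>y. Ageo (\<G> y) 2 2) (\<lambda>I. (lapse G * dj I + a I * j2 G) / r - (lapse G * j2 G) * dr I / r\<^sup>2) x"
    and "has_partials (\<lambda>y. Cgeo (\<G> y) J) (\<lambda>I. j2 G * b J I + dj I * shift G $ J) x"
proof -
  have X: "open X" "x \<in> X" "\<G> x = G" and okG: "geom_ok G" and ok: "\<And>y. y \<in> X \<Longrightarrow> geom_ok (\<G> y)"
    using at geom_at_ok by (auto simp: geom_at_def)
  note cong = has_partials_cong[OF _ X(1,2)]
  have pos: "metric G $ 2 $ 2 > 0" "metric G $ 1 $ 1 * metric G $ 2 $ 2 - (metric G $ 1 $ 2)\<^sup>2 > 0"
    using okG by (auto simp: geom_ok_iff)
  have hr: "has_partials (\<lambda>y. sqrt (metric (\<G> y) $ 2 $ 2)) dr x"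
    using has_partials_sqrt[OF g[of 2 2]] pos by (simp add: X r_def dr_def)
  have hd: "has_partials (\<lambda>y. metric (\<G> y) $ 1 $ 1 * metric (\<G> y) $ 2 $ 2 - (metric (\<G> y) $ 1 $ 2)\<^sup>2)
     (\<lambda>I. metric G $ 1 $ 1 * g 2 2 I + g 1 1 I * metric G $ 2 $ 2 - 2 * metric G $ 1 $ 2 * g 1 2 I) x"
    using has_partials_diff[OF has_partials_mult[OF g[of 1 1] g[of 2 2]] has_partials_power2[OF g[of 1 2]]] by (simp add: X)
  show hj: "has_partials (\<lambda>y. j2 (\<G> y)) dj x"
    using has_partials_sqrt[OF hd, unfolded X(3), OF pos(2)] unfolding j2_eq(1)[OF okG, symmetric] dj_def[symmetric]
    by (rule cong) (use ok in \<open>auto simp: j2_eq(1)\<close>)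
  show "has_partials (\<lambda>y. Ageo (\<G> y) 1 1) (\<lambda>I. lapse G * dr I + a I * r) x"
    using has_partials_mult[OF a hr] unfolding X(3) r_def[symmetric]
    by (rule cong) (use ok in \<open>auto simp: Ageo_explicit\<close>)
  have r0: "sqrt (metric (\<G> x) $ 2 $ 2) \<noteq> 0" using pos by (simp add: X)
  show "has_partials (\<lambda>y. Ageo (\<G> y) 1 2) (\<lambda>I. (- lapse G * g 1 2 I + - a I * metric G $ 1 $ 2) / r
           - (- lapse G * metric G $ 1 $ 2) * dr I / r\<^sup>2) x"
    using has_partials_divide[OF has_partials_mult[OF has_partials_minus[OF a] g[of 1 2]] hr r0] unfolding X(3) r_def[symmetric]
    by (rule cong) (use ok in \<open>auto simp: Ageo_explicit\<close>)
  show "has_partials (\<lambda>y. Ageo (\<G> y) 2 2) (\<lambda>I. (lapse G * dj I + a I * j2 G) / r - (lapse G * j2 G) * dr I / r\<^sup>2) x"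
    using has_partials_divide[OF has_partials_mult[OF a hj] hr r0] unfolding X(3) r_def[symmetric]
    by (rule cong) (use ok in \<open>auto simp: Ageo_explicit\<close>)
  show "has_partials (\<lambda>y. Cgeo (\<G> y) J) (\<lambda>I. j2 G * b J I + dj I * shift G $ J) x"
    using has_partials_mult[OF hj b[of J]] unfolding X(3) Cgeo_def .
qed

lemma geovar_has_partials:
  assumes "geom_at X x \<G> G" "k < 6"
  shows "has_partials (\<lambda>y. geovar k (\<G> y)) (\<lambda>I. partial I (\<lambda>y. geovar k (\<G> y)) x) x"
proof -
  note d = geovar_derivs[OF assms(1) geom_at_has_partials[OF assms(1)]]
  have "k \<in> {0, 1, 2, 3, 4, 5}" using assms(2) by auto
  then show ?thesis using d[THEN has_partials_self] by (elim insertE; simp)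
qed

lemma Ck_on_const: "Ck_on k X (\<lambda>y. c)"
proof (induction k arbitrary: c)
  case (Suc k)
  show ?case
    unfolding Ck_on.simps by (intro exI[of _ "\<lambda>I y. 0"] conjI ballI allI) (auto intro: Suc)
qed auto

lemma smooth_on_affine: "smooth_on X (\<lambda>y. c + (\<Sum>I\<in>UNIV. d I * y $ I))"
proof -
  have "((\<lambda>y. c + (\<Sum>I\<in>UNIV. d I * y $ I)) has_derivative (\<lambda>y. \<Sum>I\<in>UNIV. d I * y $ I)) F" for F :: "(real^2) filter"
    by (rule has_derivative_eq_rhs, (rule derivative_intros bounded_linear_imp_has_derivative bounded_linear_vec_nth bounded_linear_ident)+) auto
  moreover from this[THEN has_derivative_continuous_on] have "continuous_on X (\<lambda>y. c + (\<Sum>I\<in>UNIV. d I * y $ I))"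
    by blast
  ultimately have "Ck_on k X (\<lambda>y. c + (\<Sum>I\<in>UNIV. d I * y $ I))" for k
    by (cases k) (auto intro!: exI[of _ "\<lambda>I y. d I"] Ck_on_const)
  then show ?thesis by (simp add: smooth_on_def)
qed

lemma has_partials_affine: "has_partials (\<lambda>y. c + (\<Sum>I\<in>UNIV. d I * y $ I)) d x"
  unfolding has_partials_def
  by (rule has_derivative_eq_rhs, (rule derivative_intros bounded_linear_imp_has_derivative bounded_linear_vec_nth bounded_linear_ident)+) auto

text \<open>Lapse, shift and metric are taken affine in the coordinates, which makes smoothness immediate;
  their slopes are obtained from the prescribed derivatives \<open>t\<close> by inverting the linearised change
  of variables.\<close>

lemma exists_geometry_with_jet:
  assumes ok: "geom_ok G"
  shows "\<exists>X x \<G>. geom_at X x \<G> G \<and> (\<forall>k<6. \<forall>I. partial I (\<lambda>y. geovar k (\<G> y)) x = t k I)"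
proof -
  define al j r g11 g12 g22 where "al = lapse G" and "j = j2 G" and "r = sqrt (metric G $ 2 $ 2)"
    and "g11 = metric G $ 1 $ 1" and "g12 = metric G $ 1 $ 2" and "g22 = metric G $ 2 $ 2"
  have pos: "al > 0" "j > 0" "r > 0" "g22 > 0" "r\<^sup>2 = g22" "g11 * g22 - g12\<^sup>2 > 0"
    using ok j2_eq[OF ok] by (auto simp: geom_ok_iff al_def j_def r_def g22_def g11_def g12_def)
  \<comment> \<open>With \<open>r = \<surd>\<gamma>\<^sub>2\<^sub>2\<close> the variables are \<open>A\<^sub>1\<^sub>1 = \<alpha> r\<close>, \<open>A\<^sub>1\<^sub>2 = - \<alpha> \<gamma>\<^sub>1\<^sub>2 / r\<close>, \<open>A\<^sub>2\<^sub>2 = \<alpha> j\<^sub>2 / r\<close>; adding the logarithmic derivatives of the first and the last eliminates \<open>r\<close> and yields that of \<open>\<alpha>\<close>.\<close>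
  define a where "a I = al / 2 * (t 1 I / (al * r) + t 3 I * r / (al * j) - t 0 I / j)" for I
  define dr where "dr I = r * (t 1 I / (al * r) - a I / al)" for I
  define d22 where "d22 I = 2 * r * dr I" for I
  define e12 where "e12 I = t 2 I * r / al - g12 * dr I / r + g12 * a I / al" for I
  define d12 where "d12 I = - e12 I" for I
  define d11 where "d11 I = (2 * j * t 0 I - g11 * d22 I + 2 * g12 * d12 I) / g22" for I
  define b where "b J I = (t (if J = 1 then 4 else 5) I - shift G $ J * t 0 I) / j" for J I
  define aff where "aff c d y = c + (\<Sum>I\<in>UNIV. d I * y $ I)" for c and d :: "2 \<Rightarrow> real" and y :: "real^2"
  define dg where "dg J K = (if J = 1 then if K = 1 then d11 else d12 else if K = 1 then d12 else d22)" for J K :: 2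
  define \<G> where "\<G> y = \<lparr>lapse = aff al a y, shift = (\<chi> J. aff (shift G $ J) (b J) y),
       metric = (\<chi> J K. aff (metric G $ J $ K) (dg J K) y)\<rparr>" for y
  have sel: "lapse (\<G> y) = aff al a y" "shift (\<G> y) $ J = aff (shift G $ J) (b J) y"
     "metric (\<G> y) $ J $ K = aff (metric G $ J $ K) (dg J K) y" for y J K
    by (simp_all add: \<G>_def)
  have sy: "metric G $ 2 $ 1 = g12" using ok by (simp add: geom_ok_iff g12_def)
  define X where "X = {y. aff al a y > 0} \<inter> {y. aff g22 d22 y > 0}
     \<inter> {y. aff g11 d11 y * aff g22 d22 y - (aff g12 d12 y)\<^sup>2 > 0}"
  have "open X" unfolding X_def aff_def
    by (intro open_Int open_Collect_less continuous_intros)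
  have aff0: "aff c d 0 = c" for c d by (simp add: aff_def)
  have "0 \<in> X" using pos by (simp add: X_def aff0)
  have "\<G> 0 = G" by (simp add: \<G>_def aff0 al_def)
  have "geom_ok (\<G> y)" if "y \<in> X" for y
    using that by (simp add: geom_ok_iff sel X_def dg_def sy g11_def g12_def g22_def)
  then have "smooth_geom_on X \<G>"
    unfolding smooth_geom_on_def sel by (auto simp: aff_def intro!: smooth_on_affine)
  then have at: "geom_at X 0 \<G> G"
    using \<open>open X\<close> \<open>0 \<in> X\<close> \<open>\<G> 0 = G\<close> by (simp add: geom_at_def)
  have hp: "has_partials (\<lambda>y. lapse (\<G> y)) a 0" "has_partials (\<lambda>y. shift (\<G> y) $ J) (b J) 0"
     "has_partials (\<lambda>y. metric (\<G> y) $ J $ K) (dg J K) 0" for J K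
    unfolding sel aff_def by (rule has_partials_affine)+
  have dr: "dg 2 2 I / (2 * r) = dr I" for I using pos by (simp add: dg_def d22_def)
  have dj: "(g11 * dg 2 2 I + dg 1 1 I * g22 - 2 * g12 * dg 1 2 I) / (2 * j) = t 0 I" for I
  proof -
    have "d11 I * g22 = 2 * j * t 0 I - g11 * d22 I + 2 * g12 * d12 I" using pos by (simp add: d11_def)
    then show ?thesis using pos by (simp add: dg_def)
  qed
  note d = geovar_derivs[OF at hp, folded al_def j_def r_def g11_def g12_def g22_def, unfolded dr dj, THEN has_partials_partial]
  have "partial I (\<lambda>y. Ageo (\<G> y) 1 1) 0 = t 1 I" for I
    unfolding d using pos by (simp add: dr_def right_diff_distrib)
  moreover have "partial I (\<lambda>y. Ageo (\<G> y) 1 2) 0 = t 2 I" for I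
  proof -
    have "(- al * d12 I + - a I * g12) / r - - al * g12 * dr I / r\<^sup>2
      = (al * e12 I - a I * g12) / r + al * g12 * dr I / r\<^sup>2"
      unfolding d12_def by simp
    also have "\<dots> = t 2 I" unfolding e12_def using pos by (simp add: field_simps power2_eq_square)
    finally show ?thesis unfolding d by (simp add: dg_def)
  qed
  moreover have "partial I (\<lambda>y. Ageo (\<G> y) 2 2) 0 = t 3 I" for I
  proof -
    have "(al * t 0 I + a I * j) / r - al * j * dr I / r\<^sup>2
       = (al * t 0 I + 2 * a I * j) / r - j * t 1 I / r\<^sup>2"
      unfolding dr_def using pos(1-3) by (simp add: field_simps power2_eq_square)
    also have "2 * a I = t 1 I / r + t 3 I * r / j - al * t 0 I / j"
      unfolding a_def using pos(1-3) by (simp add: field_simps)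
    also have "(al * t 0 I + (t 1 I / r + t 3 I * r / j - al * t 0 I / j) * j) / r - j * t 1 I / r\<^sup>2 = t 3 I"
      using pos(1-3) by (simp add: field_simps power2_eq_square)
    finally show ?thesis unfolding d .
  qed
  moreover have "partial I (\<lambda>y. Cgeo (\<G> y) J) 0 = t (if J = 1 then 4 else 5) I" for I J
    unfolding d using pos by (simp add: b_def)
  moreover have "k \<in> {0, 1, 2, 3, 4, 5}" if "k < 6" for k :: nat using that by auto
  ultimately have "partial I (\<lambda>y. geovar k (\<G> y)) 0 = t k I" if "k < 6" for k I
    using d(1)[of I] that by fastforce
  then show ?thesis using at by blast
qed

lemma has_partials_eq: "has_partials f d x \<Longrightarrow> (\<And>I. d I = e I) \<Longrightarrow> has_partials f e x"
  by (simp add: has_partials_def)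

section \<open>Existence of the source coefficients\<close>

text \<open>A function of the geometry whose gradient is a fixed linear combination of the gradients of the
  variables \<open>geovar\<close>, with coefficients that depend only on the value \<open>G\<close> at the point.
  The closure properties below replace differentiating the inverse of the change of variables.\<close>

definition determined :: "geom \<Rightarrow> (geom \<Rightarrow> real) \<Rightarrow> bool" where
  "determined G f \<longleftrightarrow> (\<exists>m. \<forall>X x \<G>. geom_at X x \<G> G \<longrightarrow>
     has_partials (\<lambda>y. f (\<G> y)) (\<lambda>I. \<Sum>k<(6::nat). m k * partial I (\<lambda>y. geovar k (\<G> y)) x) x)"

lemma determinedI:
  assumes "\<And>X x \<G>. geom_at X x \<G> G \<Longrightarrow>
     has_partials (\<lambda>y. f (\<G> y)) (\<lambda>I. \<Sum>k<(6::nat). m k * partial I (\<lambda>y. geovar k (\<G> y)) x) x"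
  shows "determined G f"
  using assms unfolding determined_def by blast

lemma determined_geovar:
  assumes "k < 6" shows "determined G (geovar k)"
proof (rule determinedI[where m = "\<lambda>l. if l = k then 1 else 0"])
  fix X x \<G> assume "geom_at X x \<G> G"
  from geovar_has_partials[OF this assms]
  show "has_partials (\<lambda>y. geovar k (\<G> y)) (\<lambda>I. \<Sum>l<6. (if l = k then 1 else 0) * partial I (\<lambda>y. geovar l (\<G> y)) x) x"
    by (rule has_partials_eq) (use assms in \<open>simp add: if_distrib[where f="\<lambda>z. z * _"] cong: if_cong\<close>)
qed

lemma determined_const: "determined G (\<lambda>_. c)"
  by (rule determinedI[where m = "\<lambda>_. 0"]) (simp add: has_partials_const)

lemma determined_add:
  assumes "determined G f" "determined G g" shows "determined G (\<lambda>G. f G + g G)"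
proof -
  obtain m n where m: "\<And>X x \<G>. geom_at X x \<G> G \<Longrightarrow> has_partials (\<lambda>y. f (\<G> y)) (\<lambda>I. \<Sum>k<(6::nat). m k * partial I (\<lambda>y. geovar k (\<G> y)) x) x"
    and n: "\<And>X x \<G>. geom_at X x \<G> G \<Longrightarrow> has_partials (\<lambda>y. g (\<G> y)) (\<lambda>I. \<Sum>k<(6::nat). n k * partial I (\<lambda>y. geovar k (\<G> y)) x) x"
    using assms unfolding determined_def by blast
  show ?thesis
    by (rule determinedI[where m = "\<lambda>k. m k + n k"], rule has_partials_eq, rule has_partials_add, erule m, erule n)
      (simp add: sum.distrib distrib_right)
qed

lemma determined_mult:
  assumes "determined G f" "determined G g" shows "determined G (\<lambda>G. f G * g G)"
proof -
  obtain m n where m: "\<And>X x \<G>. geom_at X x \<G> G \<Longrightarrow> has_partials (\<lambda>y. f (\<G> y)) (\<lambda>I. \<Sum>k<(6::nat). m k * partial I (\<lambda>y. geovar k (\<G> y)) x) x"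
    and n: "\<And>X x \<G>. geom_at X x \<G> G \<Longrightarrow> has_partials (\<lambda>y. g (\<G> y)) (\<lambda>I. \<Sum>k<(6::nat). n k * partial I (\<lambda>y. geovar k (\<G> y)) x) x"
    using assms unfolding determined_def by blast
  show ?thesis
  proof (rule determinedI[where m = "\<lambda>k. f G * n k + m k * g G"])
    fix X x \<G> assume at: "geom_at X x \<G> G"
    then have "\<G> x = G" by (simp add: geom_at_def)
    then show "has_partials (\<lambda>y. f (\<G> y) * g (\<G> y)) (\<lambda>I. \<Sum>k<6. (f G * n k + m k * g G) * partial I (\<lambda>y. geovar k (\<G> y)) x) x"
      using has_partials_mult[OF m[OF at] n[OF at]]
      by (elim has_partials_eq) (simp add: sum.distrib sum_distrib_left sum_distrib_right algebra_simps)
  qed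
qed

lemma determined_chain:
  assumes "determined G f" "(h has_real_derivative c) (at (f G))"
  shows "determined G (\<lambda>G. h (f G))"
proof -
  obtain m where m: "\<And>X x \<G>. geom_at X x \<G> G \<Longrightarrow> has_partials (\<lambda>y. f (\<G> y)) (\<lambda>I. \<Sum>k<(6::nat). m k * partial I (\<lambda>y. geovar k (\<G> y)) x) x"
    using assms unfolding determined_def by blast
  show ?thesis
  proof (rule determinedI[where m = "\<lambda>k. c * m k"])
    fix X x \<G> assume at: "geom_at X x \<G> G"
    then have "\<G> x = G" by (simp add: geom_at_def)
    then show "has_partials (\<lambda>y. h (f (\<G> y))) (\<lambda>I. \<Sum>k<6. (c * m k) * partial I (\<lambda>y. geovar k (\<G> y)) x) x"
      using has_partials_chain[OF m[OF at], of h c] assms(2)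
      by (auto elim!: has_partials_eq simp: sum_distrib_left mult.assoc)
  qed
qed

lemma determined_cong:
  assumes "determined G f" "\<And>G. geom_ok G \<Longrightarrow> f G = g G"
  shows "determined G g"
proof -
  obtain m where m: "\<And>X x \<G>. geom_at X x \<G> G \<Longrightarrow> has_partials (\<lambda>y. f (\<G> y)) (\<lambda>I. \<Sum>k<(6::nat). m k * partial I (\<lambda>y. geovar k (\<G> y)) x) x"
    using assms unfolding determined_def by blast
  show ?thesis
  proof (rule determinedI[where m = m])
    fix X x \<G> assume at: "geom_at X x \<G> G"
    then have X: "open X" "x \<in> X" by (auto simp: geom_at_def)
    show "has_partials (\<lambda>y. g (\<G> y)) (\<lambda>I. \<Sum>k<(6::nat). m k * partial I (\<lambda>y. geovar k (\<G> y)) x) x"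
      by (rule has_partials_cong[OF m[OF at] X]) (use geom_at_ok(1)[OF at] assms(2) in auto)
  qed
qed

lemma determined_minus: "determined G f \<Longrightarrow> determined G (\<lambda>G. - f G)"
  using determined_mult[OF determined_const[of G "-1"], of f] by simp

lemma determined_diff: "determined G f \<Longrightarrow> determined G g \<Longrightarrow> determined G (\<lambda>G. f G - g G)"
  using determined_add[OF _ determined_minus, of G f g] by simp

lemma determined_divide:
  assumes "determined G f" "determined G g" "g G \<noteq> 0"
  shows "determined G (\<lambda>G. f G / g G)"
proof -
  have "determined G (\<lambda>G. f G * inverse (g G))"
    by (intro determined_mult assms(1) determined_chain[OF assms(2) DERIV_inverse[OF assms(3)]])
  then show ?thesis by (rule determined_cong) (rule divide_inverse[symmetric])
qed

lemma determined_sqrt: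
  assumes "determined G f" "f G > 0" shows "determined G (\<lambda>G. sqrt (f G))"
  by (rule determined_chain[OF assms(1) DERIV_real_sqrt[OF assms(2)]])

lemma determined_power2: "determined G f \<Longrightarrow> determined G (\<lambda>G. (f G)\<^sup>2)"
  using determined_mult[of G f f] by (simp add: power2_eq_square)

text \<open>The change of variables is inverted by \<open>\<alpha>\<^sup>2 = A\<^sub>1\<^sub>1 A\<^sub>2\<^sub>2 / j\<^sub>2\<close>, \<open>\<Theta> = A / (\<alpha> j\<^sub>2)\<close>,
  \<open>\<beta> = C / j\<^sub>2\<close>, \<open>\<gamma>\<^sub>2\<^sub>2 = (A\<^sub>1\<^sub>1 / \<alpha>)\<^sup>2\<close>, \<open>\<gamma>\<^sub>1\<^sub>2 = - A\<^sub>1\<^sub>2 \<surd>\<gamma>\<^sub>2\<^sub>2 / \<alpha>\<close> and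
  \<open>\<gamma>\<^sub>1\<^sub>1 = (j\<^sub>2\<^sup>2 + \<gamma>\<^sub>1\<^sub>2\<^sup>2) / \<gamma>\<^sub>2\<^sub>2\<close>.\<close>

lemma primitive_geometry_determined:
  assumes ok: "geom_ok G"
  shows "determined G lapse" "determined G (\<lambda>G. shift G $ J)" "determined G (\<lambda>G. metric G $ I $ J)"
    "determined G (\<lambda>G. Theta G $ I $ J)"
proof -
  have dj: "determined G j2" and dA: "determined G (\<lambda>G. Ageo G 1 1)" "determined G (\<lambda>G. Ageo G 1 2)" "determined G (\<lambda>G. Ageo G 2 2)"
    and dC: "determined G (\<lambda>G. Cgeo G 1)" "determined G (\<lambda>G. Cgeo G 2)"
    using determined_geovar[of 0 G] determined_geovar[of "Suc 0" G] determined_geovar[of 2 G] determined_geovar[of 3 G]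
      determined_geovar[of 4 G] determined_geovar[of 5 G] by simp_all
  have A: "Ageo G 1 1 = lapse G * sqrt (metric G $ 2 $ 2)" "Ageo G 2 2 = lapse G * j2 G / sqrt (metric G $ 2 $ 2)"
    "Ageo G 1 2 = - lapse G * metric G $ 1 $ 2 / sqrt (metric G $ 2 $ 2)"
    and pos: "lapse G > 0" "metric G $ 2 $ 2 > 0" "j2 G > 0" "sqrt (metric G $ 2 $ 2) > 0" if "geom_ok G" for G
    using that j2_eq(2) by (auto simp: Ageo_explicit geom_ok_iff)
  have Apos: "Ageo G 1 1 > 0" "Ageo G 2 2 > 0" using ok pos by (auto simp: A)
  have "determined G (\<lambda>G. sqrt (Ageo G 1 1 * Ageo G 2 2 / j2 G))"
    using pos[OF ok] Apos by (intro determined_sqrt determined_divide determined_mult dj dA) auto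
  then show dl: "determined G lapse"
  proof (rule determined_cong)
    fix G :: geom assume g: "geom_ok G"
    have "Ageo G 1 1 * Ageo G 2 2 / j2 G = (lapse G)\<^sup>2"
      using pos[OF g] by (simp add: A[OF g] power2_eq_square)
    then show "sqrt (Ageo G 1 1 * Ageo G 2 2 / j2 G) = lapse G" using pos[OF g] by simp
  qed
  show "determined G (\<lambda>G. shift G $ J)"
  proof -
    have "determined G (\<lambda>G. Cgeo G J / j2 G)"
      using pos[OF ok] dC exhaust_2[of J] by (intro determined_divide dj) auto
    then show ?thesis by (rule determined_cong) (use pos in \<open>force simp: Cgeo_def\<close>)
  qed
  show dT: "determined G (\<lambda>G. Theta G $ I $ J)" for I J
  proof -
    have d21: "determined G (\<lambda>G. Ageo G 2 1)"
      using determined_const[of G 0] by (rule determined_cong) (simp add: Ageo_explicit)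
    have "determined G (\<lambda>G. Ageo G I J / (lapse G * j2 G))"
      using pos[OF ok] dA d21 exhaust_2[of I] exhaust_2[of J] by (intro determined_divide determined_mult dl dj) auto
    then show ?thesis by (rule determined_cong) (use pos in \<open>force simp: Ageo_def\<close>)
  qed
  have d22: "determined G (\<lambda>G. metric G $ 2 $ 2)"
  proof -
    have "determined G (\<lambda>G. (Ageo G 1 1 / lapse G)\<^sup>2)"
      using pos[OF ok] by (intro determined_power2 determined_divide dA dl) auto
    then show ?thesis by (rule determined_cong) (use pos in \<open>force simp: A power_divide power_mult_distrib\<close>)
  qed
  have d12: "determined G (\<lambda>G. metric G $ 1 $ 2)"
  proof -
    have "determined G (\<lambda>G. - (Ageo G 1 2 * sqrt (metric G $ 2 $ 2) / lapse G))"
      using pos[OF ok] by (intro determined_minus determined_divide determined_mult determined_sqrt dA dl d22) auto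
    then show ?thesis by (rule determined_cong) (use pos in \<open>force simp: A\<close>)
  qed
  have d11: "determined G (\<lambda>G. metric G $ 1 $ 1)"
  proof -
    have "determined G (\<lambda>G. ((j2 G)\<^sup>2 + (metric G $ 1 $ 2)\<^sup>2) / metric G $ 2 $ 2)"
      using pos[OF ok] by (intro determined_divide determined_add determined_power2 dj d12 d22) auto
    then show ?thesis by (rule determined_cong) (use pos in \<open>force simp: j2_eq(3)\<close>)
  qed
  have d21: "determined G (\<lambda>G. metric G $ 2 $ 1)"
    using d12 by (rule determined_cong) (simp add: geom_ok_iff)
  show "determined G (\<lambda>G. metric G $ I $ J)"
    using exhaust_2[of I] exhaust_2[of J] d11 d12 d21 d22 by auto
qed

text \<open>The vector-valued counterpart for expressions that already contain derivatives: such an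
  expression is linear in the first derivatives of the geometry variables.\<close>

definition jet_linear :: "geom \<Rightarrow> ((real^2 \<Rightarrow> geom) \<Rightarrow> real^2 \<Rightarrow> 'v::real_vector) \<Rightarrow> bool" where
  "jet_linear G F \<longleftrightarrow> (\<exists>b. \<forall>X x \<G>. geom_at X x \<G> G \<longrightarrow>
      F \<G> x = (\<Sum>I\<in>UNIV. \<Sum>k<(6::nat). partial I (\<lambda>y. geovar k (\<G> y)) x *\<^sub>R b I k))"

lemma jet_linear_zero: "jet_linear G (\<lambda>\<G> x. 0)"
  unfolding jet_linear_def by (intro exI[of _ "\<lambda>_ _. 0"]) simp

lemma jet_linear_add:
  assumes "jet_linear G F" "jet_linear G F'" shows "jet_linear G (\<lambda>\<G> x. F \<G> x + F' \<G> x)"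
proof -
  obtain b b' where b: "\<And>X x \<G>. geom_at X x \<G> G \<Longrightarrow> F \<G> x = (\<Sum>I\<in>UNIV. \<Sum>k<(6::nat). partial I (\<lambda>y. geovar k (\<G> y)) x *\<^sub>R b I k)"
    and b': "\<And>X x \<G>. geom_at X x \<G> G \<Longrightarrow> F' \<G> x = (\<Sum>I\<in>UNIV. \<Sum>k<(6::nat). partial I (\<lambda>y. geovar k (\<G> y)) x *\<^sub>R b' I k)"
    using assms unfolding jet_linear_def by blast
  show ?thesis unfolding jet_linear_def
    by (intro exI[of _ "\<lambda>I k. b I k + b' I k"] allI impI) (simp add: b b' scaleR_right_distrib sum.distrib)
qed

lemma jet_linear_linear:
  fixes L :: "geom \<Rightarrow> 'v::real_vector \<Rightarrow> 'w::real_vector"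
  assumes "jet_linear G F" "\<And>G. linear (L G)" shows "jet_linear G (\<lambda>\<G> x. L (\<G> x) (F \<G> x))"
proof -
  obtain b where b: "\<And>X x \<G>. geom_at X x \<G> G \<Longrightarrow> F \<G> x = (\<Sum>I\<in>UNIV. \<Sum>k<(6::nat). partial I (\<lambda>y. geovar k (\<G> y)) x *\<^sub>R b I k)"
    using assms unfolding jet_linear_def by blast
  have "L (\<G> x) (F \<G> x) = (\<Sum>I\<in>UNIV. \<Sum>k<(6::nat). partial I (\<lambda>y. geovar k (\<G> y)) x *\<^sub>R L G (b I k))"
    if "geom_at X x \<G> G" for X x \<G>
  proof -
    have "\<G> x = G" using that by (simp add: geom_at_def)
    then show ?thesis
      unfolding b[OF that] by (simp only: linear_sum[OF assms(2)] linear_scale[OF assms(2)])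
  qed
  then show ?thesis unfolding jet_linear_def by (intro exI[of _ "\<lambda>I k. L G (b I k)"]) blast
qed

lemma jet_linear_mult: "jet_linear G F \<Longrightarrow> jet_linear G (\<lambda>\<G> x. c (\<G> x) * (F \<G> x :: real))"
  by (rule jet_linear_linear[where L = "\<lambda>G y. c G * y"]) (auto intro!: linearI simp: algebra_simps)

lemma jet_linear_uminus: "jet_linear G F \<Longrightarrow> jet_linear G (\<lambda>\<G> x. - F \<G> x)"
  by (rule jet_linear_linear[where L = "\<lambda>G y. - y"]) (auto intro!: linearI simp: algebra_simps)

lemma jet_linear_diff: "jet_linear G F \<Longrightarrow> jet_linear G F' \<Longrightarrow> jet_linear G (\<lambda>\<G> x. F \<G> x - F' \<G> x)"
  using jet_linear_add[OF _ jet_linear_uminus, of G F F'] by simp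

lemma jet_linear_half: "jet_linear G F \<Longrightarrow> jet_linear G (\<lambda>\<G> x. F \<G> x / (2::real))"
  using jet_linear_mult[of G F "\<lambda>_. 1/2"] by simp

lemma jet_linear_sum:
  assumes "\<And>i. i \<in> A \<Longrightarrow> jet_linear G (F i)" shows "jet_linear G (\<lambda>\<G> x. \<Sum>i\<in>A. F i \<G> x)"
  using assms by (induction A rule: infinite_finite_induct) (auto intro: jet_linear_zero jet_linear_add)

lemma jet_linear_partial:
  assumes "determined G f" shows "jet_linear G (\<lambda>\<G> x. partial J (\<lambda>y. f (\<G> y)) x)"
proof -
  obtain m where m: "\<And>X x \<G>. geom_at X x \<G> G \<Longrightarrow> has_partials (\<lambda>y. f (\<G> y)) (\<lambda>I. \<Sum>k<(6::nat). m k * partial I (\<lambda>y. geovar k (\<G> y)) x) x"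
    using assms unfolding determined_def by blast
  have "partial J (\<lambda>y. f (\<G> y)) x = (\<Sum>I\<in>UNIV. \<Sum>k<(6::nat). partial I (\<lambda>y. geovar k (\<G> y)) x *\<^sub>R (if I = J then m k else 0))"
    if "geom_at X x \<G> G" for X x \<G>
    unfolding has_partials_partial[OF m[OF that]] using exhaust_2[of J]
    by (auto simp: sum_2 mult.commute)
  then show ?thesis unfolding jet_linear_def by (intro exI[of _ "\<lambda>I k. if I = J then m k else 0"]) blast
qed

lemma jet_linear_vec:
  fixes F :: "(real^2 \<Rightarrow> geom) \<Rightarrow> real^2 \<Rightarrow> real^'n"
  assumes "\<And>i. jet_linear G (\<lambda>\<G> x. F \<G> x $ i)" shows "jet_linear G F"
proof -
  have "jet_linear G (\<lambda>\<G> x. \<Sum>i\<in>UNIV. F \<G> x $ i *\<^sub>R axis i (1::real))"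
    by (intro jet_linear_sum jet_linear_linear[OF assms, of "\<lambda>G y. y *\<^sub>R axis _ 1"]) (auto intro!: linearI simp: algebra_simps)
  also have "(\<lambda>\<G> x. \<Sum>i\<in>UNIV. F \<G> x $ i *\<^sub>R axis i (1::real)) = F"
    by (intro ext) (simp add: vec_eq_iff axis_def if_distrib[where f="(*) _"] cong: if_cong)
  finally show ?thesis .
qed

text \<open>The first and last rows of the frame matrix are constant, so the source of \<open>D\<close> and the energy
  equation receive no frame rotation.\<close>

lemma partial_Lmat:
  assumes "\<And>a J. has_partials (\<lambda>y. Theta (\<G> y) $ a $ J) (d a J) x"
  shows "partial I (\<lambda>y. Lmat (\<G> y)) x = vector
     [vector [0, 0, 0, 0], vector [0, d 1 1 I, d 1 2 I, 0], vector [0, d 2 1 I, d 2 2 I, 0], vector [0, 0, 0, 0]]"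
proof -
  define E :: "2 \<Rightarrow> 2 \<Rightarrow> real^4^4" where "E a J =
     (if a = 1 then if J = 1 then vector [0, vector [0, 1, 0, 0], 0, 0] else vector [0, vector [0, 0, 1, 0], 0, 0]
      else if J = 1 then vector [0, 0, vector [0, 1, 0, 0], 0] else vector [0, 0, vector [0, 0, 1, 0], 0])" for a J
  define E0 :: "real^4^4" where "E0 = vector [vector [1, 0, 0, 0], 0, 0, vector [0, 0, 0, 1]]"
  have L: "Lmat G = E0 + (\<Sum>a\<in>UNIV. \<Sum>J\<in>UNIV. Theta G $ a $ J *\<^sub>R E a J)" for G
    by (simp add: Lmat_def E0_def E_def sum_2 vec_eq_iff forall_4)
  have "((\<lambda>y. Theta (\<G> y) $ a $ J *\<^sub>R E a J) has_derivative (\<lambda>h. (\<Sum>K\<in>UNIV. d a J K * h $ K) *\<^sub>R E a J)) (at x)" for a J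
    using assms[of a J] unfolding has_partials_def by (rule has_derivative_scaleR_left)
  then have "((\<lambda>y. Lmat (\<G> y)) has_derivative (\<lambda>h. 0 + (\<Sum>a\<in>UNIV. \<Sum>J\<in>UNIV. (\<Sum>K\<in>UNIV. d a J K * h $ K) *\<^sub>R E a J))) (at x)"
    unfolding L by (intro has_derivative_add has_derivative_sum has_derivative_const)
  from partial_eqI[OF this, of I] show ?thesis
    using exhaust_2[of I] by (auto simp: sum_2 axis_def E_def vec_eq_iff forall_4)
qed

lemma Theta_has_partials:
  assumes "geom_at X x \<G> G"
  shows "has_partials (\<lambda>y. Theta (\<G> y) $ a $ J) (\<lambda>I. partial I (\<lambda>y. Theta (\<G> y) $ a $ J) x) x"
  using primitive_geometry_determined(4)[OF geom_at_ok(2)[OF assms], of a J] assms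
  unfolding determined_def by (blast intro: has_partials_self)

lemma st_metric_determined:
  assumes "geom_ok G" shows "determined G (\<lambda>G. st_metric G $ \<mu> $ \<nu>)"
proof -
  note d = primitive_geometry_determined[OF assms]
  have s: "determined G (\<lambda>G. (metric G *v shift G) $ I)" for I
    unfolding matrix_vector_mult_def by (simp add: sum_2) (intro determined_add determined_mult d)
  have "determined G (\<lambda>G. - (lapse G)\<^sup>2 + shift G \<bullet> (metric G *v shift G))"
    unfolding inner_vec_def by (simp add: sum_2) (intro determined_add determined_diff determined_mult determined_power2 d s)
  then show ?thesis
    by (cases \<mu>; cases \<nu>) (simp_all add: st_metric_nth d s)
qed

text \<open>Every summand of the source contains exactly one derivative of the spacetime metric, the lapse or
  the frame, and all of these are \<open>determined\<close>.\<close>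

lemma SW_jet_linear:
  assumes ok: "geom_ok G"
  shows "jet_linear G (SW \<Gamma> q)"
proof -
  have p: "jet_linear G (\<lambda>\<G> x. partial I (\<lambda>y. st_metric (\<G> y) $ \<mu> $ \<nu>) x)" for I \<mu> \<nu>
    by (rule jet_linear_partial[OF st_metric_determined[OF ok]])
  have sp: "jet_linear G (\<lambda>\<G> x. st_partial \<sigma> (\<lambda>y. st_metric (\<G> y) $ \<mu> $ \<nu>) x)" for \<sigma> \<mu> \<nu>
    by (cases \<sigma>) (simp_all add: st_partial_def jet_linear_zero p)
  have c: "jet_linear G (\<lambda>\<G> x. christoffel \<G> x \<sigma> \<mu> \<nu>)" for \<sigma> \<mu> \<nu>
    unfolding christoffel_def
    by (intro jet_linear_sum jet_linear_half
        jet_linear_mult[where c = "\<lambda>G. matrix_inv (st_metric G) $ _ $ _"] jet_linear_diff jet_linear_add sp)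
  have l: "jet_linear G (\<lambda>\<G> x. partial I (\<lambda>y. lapse (\<G> y)) x)" for I
    by (rule jet_linear_partial[OF primitive_geometry_determined(1)[OF ok]])
  have SV: "jet_linear G (SV \<Gamma> q)"
  proof (rule jet_linear_vec)
    fix i :: 4
    have "jet_linear G (\<lambda>\<G> x. (\<Sum>\<mu>\<in>UNIV. \<Sum>\<nu>\<in>UNIV. stress \<Gamma> q (\<G> x) \<mu> \<nu> * partial I (\<lambda>y. st_metric (\<G> y) $ \<mu> $ \<nu>) x) / 2)" for I
      by (intro jet_linear_half jet_linear_sum jet_linear_mult[where c = "\<lambda>G. stress \<Gamma> q G _ _"] p)
    moreover have "jet_linear G (\<lambda>\<G> x. (\<Sum>I\<in>UNIV. stress \<Gamma> q (\<G> x) (Some I) None * partial I (\<lambda>y. lapse (\<G> y)) x)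
        - lapse (\<G> x) * (\<Sum>\<mu>\<in>UNIV. \<Sum>\<nu>\<in>UNIV. stress \<Gamma> q (\<G> x) \<mu> \<nu> * christoffel \<G> x None \<mu> \<nu>))"
      by (intro jet_linear_diff jet_linear_sum jet_linear_mult[where c = "\<lambda>G. stress \<Gamma> q G _ _"] l c
          jet_linear_mult[where c = lapse])
    ultimately show "jet_linear G (\<lambda>\<G> x. SV \<Gamma> q \<G> x $ i)"
      using exhaust_4[of i] by (auto simp: SV_def Let_def jet_linear_zero)
  qed
  define dL where "dL = (\<lambda>I \<G> x. partial I (\<lambda>y. Lmat (\<G> y)) x)"
  define dT where "dT = (\<lambda>a J I \<G> x. partial I (\<lambda>y. Theta (\<G> y) $ a $ J) x)"
  define dL' :: "2 \<Rightarrow> (real^2 \<Rightarrow> geom) \<Rightarrow> real^2 \<Rightarrow> real^4^4" where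
    "dL' I \<G> x = vector
     [vector [0, 0, 0, 0], vector [0, dT 1 1 I \<G> x, dT 1 2 I \<G> x, 0], vector [0, dT 2 1 I \<G> x, dT 2 2 I \<G> x, 0], vector [0, 0, 0, 0]]" for I \<G> x
  have dLv: "jet_linear G (\<lambda>\<G> x. dL' I \<G> x *v FV \<Gamma> q (\<G> x) I)" for I
  proof (rule jet_linear_vec)
    fix i :: 4
    have "jet_linear G (dT a J I)" for a J
      unfolding dT_def by (rule jet_linear_partial[OF primitive_geometry_determined(4)[OF ok]])
    then have "jet_linear G (\<lambda>\<G> x. FV \<Gamma> q (\<G> x) I $ 2 * dT a 1 I \<G> x + FV \<Gamma> q (\<G> x) I $ 3 * dT a 2 I \<G> x)" for a
      by (intro jet_linear_add jet_linear_mult[where c = "\<lambda>G. FV \<Gamma> q G I $ _"])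
    then show "jet_linear G (\<lambda>\<G> x. (dL' I \<G> x *v FV \<Gamma> q (\<G> x) I) $ i)"
      using exhaust_4[of i]
      by (auto simp: dL'_def matrix_vector_mult_def sum_4 jet_linear_zero mult.commute[of _ "FV _ _ _ _ $ _"])
  qed
  have "jet_linear G (\<lambda>\<G> x. (lapse (\<G> x) * j2 (\<G> x)) *\<^sub>R (Lmat (\<G> x) *v SV \<Gamma> q \<G> x + (\<Sum>I\<in>UNIV. dL' I \<G> x *v FV \<Gamma> q (\<G> x) I)))"
    by (intro jet_linear_linear[where L = "\<lambda>G y. (lapse G * j2 G) *\<^sub>R y"] jet_linear_add jet_linear_sum dLv
        jet_linear_linear[where L = "\<lambda>G y. Lmat G *v y", OF SV])
      (auto intro!: linearI simp: algebra_simps matrix_vector_right_distrib vector_scalar_commute)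
  then obtain b where b: "\<And>X x \<G>. geom_at X x \<G> G \<Longrightarrow> (lapse (\<G> x) * j2 (\<G> x)) *\<^sub>R (Lmat (\<G> x) *v SV \<Gamma> q \<G> x + (\<Sum>I\<in>UNIV. dL' I \<G> x *v FV \<Gamma> q (\<G> x) I))
     = (\<Sum>I\<in>UNIV. \<Sum>k<(6::nat). partial I (\<lambda>y. geovar k (\<G> y)) x *\<^sub>R b I k)"
    unfolding jet_linear_def by blast
  have "SW \<Gamma> q \<G> x = (\<Sum>I\<in>UNIV. \<Sum>k<(6::nat). partial I (\<lambda>y. geovar k (\<G> y)) x *\<^sub>R b I k)" if "geom_at X x \<G> G" for X x \<G>
  proof -
    have "partial I (\<lambda>y. Lmat (\<G> y)) x = dL' I \<G> x" for I
      unfolding dL'_def dT_def by (rule partial_Lmat[OF Theta_has_partials[OF that]])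
    then show ?thesis using b[OF that] by (simp add: SW_def)
  qed
  then show ?thesis unfolding jet_linear_def by blast
qed

lemma sum_upper_idx: "(\<Sum>(a, J)\<in>upper_idx. f a J) = f 1 1 + f 1 2 + (f 2 2 :: 'a::comm_monoid_add)"
  by (simp add: upper_idx_def add.assoc)

definition coef :: "coeffs \<Rightarrow> 2 \<Rightarrow> nat \<Rightarrow> real^4" where
  "coef B I k = [bj B I, bA B I 1 1, bA B I 1 2, bA B I 2 2, bC B I 1, bC B I 2] ! k"

lemma is_source_coeffs_iff:
  "is_source_coeffs \<Gamma> q G B \<longleftrightarrow> (\<forall>X x \<G>. geom_at X x \<G> G \<longrightarrow>
      SW \<Gamma> q \<G> x = (\<Sum>I\<in>UNIV. \<Sum>k<(6::nat). partial I (\<lambda>y. geovar k (\<G> y)) x *\<^sub>R coef B I k))"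
  unfolding is_source_coeffs_def geom_at_def[symmetric] sum_upper_idx sum_lessThan_6
  by (simp add: coef_def sum_2 add.assoc)

lemma source_coeffs_exist:
  assumes "geom_ok G" shows "is_source_coeffs \<Gamma> q G (source_coeffs \<Gamma> q G)"
proof -
  obtain b where b: "\<And>X x \<G>. geom_at X x \<G> G \<Longrightarrow> SW \<Gamma> q \<G> x = (\<Sum>I\<in>UNIV. \<Sum>k<(6::nat). partial I (\<lambda>y. geovar k (\<G> y)) x *\<^sub>R b I k)"
    using SW_jet_linear[OF assms, of \<Gamma> q] unfolding jet_linear_def by blast
  define B where "B = \<lparr>bj = (\<lambda>I. b I 0), bA = (\<lambda>I a J. b I (if a = 1 then if J = 1 then 1 else 2 else 3)),
      bC = (\<lambda>I J. b I (if J = 1 then 4 else 5))\<rparr>"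
  have "coef B I k = b I k" if "k < 6" for I k
  proof -
    have "k \<in> {0, 1, 2, 3, 4, 5}" using that by auto
    then show ?thesis by (auto simp: coef_def B_def)
  qed
  then have "is_source_coeffs \<Gamma> q G B" unfolding is_source_coeffs_iff using b by simp
  then show ?thesis unfolding source_coeffs_def by (rule someI)
qed

text \<open>A linear functional of the source determines its values on the coefficient vectors, because the
  derivatives of the geometry variables can be chosen to be unit vectors.  In particular these
  values do not depend on which solution of the defining identity is selected.\<close>

lemma coef_functional:
  assumes ok: "geom_ok G" and B: "is_source_coeffs \<Gamma> q G B"
    and c: "\<And>X x \<G>. geom_at X x \<G> G \<Longrightarrow>
       c \<bullet> SW \<Gamma> q \<G> x = (\<Sum>I\<in>UNIV. \<Sum>k<(6::nat). partial I (\<lambda>y. geovar k (\<G> y)) x * w I k)"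
    and k: "k < 6"
  shows "c \<bullet> coef B I k = w I k"
proof -
  obtain X x \<G> where at: "geom_at X x \<G> G"
    and t: "\<And>l J. l < 6 \<Longrightarrow> partial J (\<lambda>y. geovar l (\<G> y)) x = (if l = k \<and> J = I then 1 else 0)"
    using exists_geometry_with_jet[OF ok, of "\<lambda>l J. if l = k \<and> J = I then 1 else 0"] by blast
  have "c \<bullet> SW \<Gamma> q \<G> x = (\<Sum>J\<in>UNIV. \<Sum>l<(6::nat). (if l = k \<and> J = I then 1 else 0) * (c \<bullet> coef B J l))"
    using B at unfolding is_source_coeffs_iff by (simp add: inner_sum_right t)
  moreover have "c \<bullet> SW \<Gamma> q \<G> x = (\<Sum>J\<in>UNIV. \<Sum>l<(6::nat). (if l = k \<and> J = I then 1 else 0) * w J l)"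
    using c[OF at] by (simp add: t)
  moreover have "(\<Sum>J\<in>UNIV. \<Sum>l<(6::nat). (if l = k \<and> J = I then 1 else 0) * f J l) = (f I k :: real)" for f
    using exhaust_2[of I] k by (auto simp: sum_2 if_distrib[where f="\<lambda>z. z * _"] cong: if_cong)
  ultimately show ?thesis by metis
qed

section \<open>Entropy balance of the gravitational source\<close>

text \<open>Contraction of a symmetric tensor with \<open>\<Gamma>\<^sup>0\<^sub>\<mu>\<^sub>\<nu>\<close> for a stationary metric; \<open>c\<close> takes the
  place of the row \<open>g\<^sup>0\<^sup>\<tau>\<close> of the inverse metric.\<close>

lemma christoffel_contraction:
  fixes T :: "2 option \<Rightarrow> 2 option \<Rightarrow> real" and dS :: "2 \<Rightarrow> 2 option \<Rightarrow> 2 option \<Rightarrow> real"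
  assumes T: "\<And>\<mu> \<nu>. T \<mu> \<nu> = T \<nu> \<mu>" and dS: "\<And>K \<mu> \<nu>. dS K \<mu> \<nu> = dS K \<nu> \<mu>"
  defines "D \<equiv> \<lambda>\<sigma> \<mu> \<nu>. case \<sigma> of None \<Rightarrow> 0 | Some K \<Rightarrow> dS K \<mu> \<nu>"
  shows "(\<Sum>\<mu>\<in>UNIV. \<Sum>\<nu>\<in>UNIV. T \<mu> \<nu> * (\<Sum>\<tau>\<in>UNIV. c \<tau> * (D \<mu> \<tau> \<nu> + D \<nu> \<tau> \<mu> - D \<tau> \<mu> \<nu>) / 2))
     = (\<Sum>\<tau>\<in>UNIV. c \<tau> * (\<Sum>I\<in>UNIV. \<Sum>\<nu>\<in>UNIV. T (Some I) \<nu> * dS I \<tau> \<nu>))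
       - (\<Sum>K\<in>UNIV. c (Some K) * ((\<Sum>\<mu>\<in>UNIV. \<Sum>\<nu>\<in>UNIV. T \<mu> \<nu> * dS K \<mu> \<nu>) / 2))"
proof -
  have s: "T (Some I) None = T None (Some I)" "T (Some 2) (Some 1) = T (Some 1) (Some 2)"
     "dS K (Some I) None = dS K None (Some I)" "dS K (Some 2) (Some 1) = dS K (Some 1) (Some 2)" for I K
    using T dS by blast+
  show ?thesis unfolding D_def sum_option2 sum_2 by (simp add: s field_simps)
qed

text \<open>The power of a stress tensor \<open>T\<close> against a variation of the metric, sorted by variations of the
  lapse (\<open>a\<close>), the shift (\<open>e\<close>) and the spatial metric (\<open>g\<close>).  The numbers \<open>n\<close> are the components
  of \<open>T\<close> in the frame of the normal observers; \<open>m\<close> is the spatial metric and \<open>b\<close> the shift.\<close>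

lemma scalar_metric_variation:
  fixes T :: "2 option \<Rightarrow> 2 option \<Rightarrow> real"
  assumes T: "T (Some 1) None = T None (Some 1)" "T (Some 2) None = T None (Some 2)" "T (Some 2) (Some 1) = T (Some 1) (Some 2)"
    and dS: "dS None None = - 2 * al * a + (g11 * b1\<^sup>2 + 2 * g12 * b1 * b2 + g22 * b2\<^sup>2)
        + 2 * (m11 * b1 * e1 + m12 * b1 * e2 + m12 * b2 * e1 + m22 * b2 * e2)"
      "dS None (Some 1) = g11 * b1 + g12 * b2 + m11 * e1 + m12 * e2" "dS (Some 1) None = dS None (Some 1)"
      "dS None (Some 2) = g12 * b1 + g22 * b2 + m12 * e1 + m22 * e2" "dS (Some 2) None = dS None (Some 2)"
      "dS (Some 1) (Some 1) = g11" "dS (Some 1) (Some 2) = g12" "dS (Some 2) (Some 1) = g12" "dS (Some 2) (Some 2) = g22"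
    and t: "T None (Some 1) + b1 * T None None = n1" "T None (Some 2) + b2 * T None None = n2"
      "T (Some 1) (Some 1) + 2 * b1 * T None (Some 1) + b1\<^sup>2 * T None None = n11"
      "T (Some 1) (Some 2) + b1 * T None (Some 2) + b2 * T None (Some 1) + b1 * b2 * T None None = n12"
      "T (Some 2) (Some 2) + 2 * b2 * T None (Some 2) + b2\<^sup>2 * T None None = n22"
  shows "(\<Sum>\<mu>\<in>UNIV. \<Sum>\<nu>\<in>UNIV. T \<mu> \<nu> * dS \<mu> \<nu>) / 2
     = - al * T None None * a + (n11 * g11 + 2 * n12 * g12 + n22 * g22) / 2
       + (m11 * e1 + m12 * e2) * n1 + (m12 * e1 + m22 * e2) * n2"
  unfolding sum_option2 T dS t[symmetric] by (simp add: field_simps power2_eq_square)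

text \<open>In the frame of the normal observers the stress tensor has energy \<open>E\<close>, momentum \<open>H v\<close> and
  spatial part \<open>H v v + p \<gamma>\<^sup>-\<^sup>1\<close>.  With these values the shift and lapse terms cancel up to
  pressure terms, leaving the spatial metric terms.\<close>

lemma stationary_source_work:
  fixes \<Gamma> :: real
  assumes at: "geom_at X x \<G> G" and q: "prim_ok q"
    and hp: "has_partials (\<lambda>y. lapse (\<G> y)) da x" "\<And>J. has_partials (\<lambda>y. shift (\<G> y) $ J) (db J) x"
     "\<And>J K. has_partials (\<lambda>y. metric (\<G> y) $ J $ K) (dg J K) x"
  defines "v \<equiv> vup q G" and "u \<equiv> vtil q G" and "H \<equiv> rho q * enthalpy \<Gamma> q * (lorentz q)\<^sup>2"
    and "h \<equiv> matrix_inv (metric G)"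
  shows "v $ 1 * SV \<Gamma> q \<G> x $ 2 + v $ 2 * SV \<Gamma> q \<G> x $ 3 - SV \<Gamma> q \<G> x $ 4
    = prs q / lapse G * (v $ 1 * da 1 + v $ 2 * da 2)
      + (\<Sum>K\<in>UNIV. u $ K * (H * ((v $ 1)\<^sup>2 * dg 1 1 K + 2 * v $ 1 * v $ 2 * dg 1 2 K + (v $ 2)\<^sup>2 * dg 2 2 K)
           + prs q * (h $ 1 $ 1 * dg 1 1 K + 2 * h $ 1 $ 2 * dg 1 2 K + h $ 2 $ 2 * dg 2 2 K)) / 2)
      - prs q / lapse G * (db 1 1 + db 2 2)"
proof -
  have X: "open X" "x \<in> X" "\<G> x = G" and okG: "geom_ok G" and ok: "\<And>y. y \<in> X \<Longrightarrow> geom_ok (\<G> y)"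
    using at geom_at_ok by (auto simp: geom_at_def)
  define al i p b1 b2 m11 m12 m22 where "al = lapse G" and "i = 1 / lapse G" and "p = prs q"
    and "b1 = shift G $ 1" and "b2 = shift G $ 2" and "m11 = metric G $ 1 $ 1" and "m12 = metric G $ 1 $ 2" and "m22 = metric G $ 2 $ 2"
  have ali: "al * i = 1" using okG by (simp add: al_def i_def geom_ok_iff)
  have m21: "metric G $ 2 $ 1 = m12" using okG by (simp add: geom_ok_iff m12_def)
  define T where "T = stress \<Gamma> q G"
  define dS where "dS K \<mu> \<nu> = partial K (\<lambda>y. st_metric (\<G> y) $ \<mu> $ \<nu>) x" for K \<mu> \<nu>
  have dg21: "dg 2 1 K = dg 1 2 K" for K
    using has_partials_partial[OF has_partials_cong[OF hp(3)[of 1 2] X(1,2), of "\<lambda>y. metric (\<G> y) $ 2 $ 1"]] ok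
    using has_partials_partial[OF hp(3)[of 2 1]] by (auto simp: geom_ok_iff)
  have u: "u $ K = v $ K - i * shift G $ K" for K
    by (simp add: u_def v_def vtil_def i_def)
  have inv: "matrix_inv (st_metric G) $ None $ None = - (i\<^sup>2)" "matrix_inv (st_metric G) $ None $ Some I = shift G $ I * i\<^sup>2"
     "matrix_inv (st_metric G) $ Some I $ None = shift G $ I * i\<^sup>2"
     "matrix_inv (st_metric G) $ Some I $ Some J = h $ I $ J - shift G $ I * shift G $ J * i\<^sup>2" for I J
    by (simp_all add: matrix_inv_st_metric[OF okG] i_def h_def power_divide)
  have T: "T None None = i\<^sup>2 * (H - p)" "T None (Some I) = i * H * u $ I + p * shift G $ I * i\<^sup>2"
    "T (Some I) None = T None (Some I)"
    "T (Some I) (Some J) = H * u $ I * u $ J + p * (h $ I $ J - shift G $ I * shift G $ J * i\<^sup>2)" for I J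
    by (simp_all add: T_def stress_def inv four_vel_def H_def u_def p_def i_def power2_eq_square algebra_simps)
  have h21: "h $ 2 $ 1 = h $ 1 $ 2" by (simp add: h_def matrix_inv_metric[OF okG])
  have T21: "T (Some 2) (Some 1) = T (Some 1) (Some 2)" by (simp add: T h21)
  have Tsym: "T \<mu> \<nu> = T \<nu> \<mu>" for \<mu> \<nu>
  proof -
    have "\<forall>\<mu> \<nu>. T \<mu> \<nu> = T \<nu> \<mu>" unfolding forall_option2 using T21 T(3) by simp
    then show ?thesis by blast
  qed
  have hs: "has_partials (\<lambda>y. (metric (\<G> y) *v shift (\<G> y)) $ J)
      (\<lambda>K. (metric G $ J $ 1 * db 1 K + dg J 1 K * b1) + (metric G $ J $ 2 * db 2 K + dg J 2 K * b2)) x" for J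
    using has_partials_add[OF has_partials_mult[OF hp(3)[of J 1] hp(2)[of 1]] has_partials_mult[OF hp(3)[of J 2] hp(2)[of 2]]]
    by (simp add: matrix_vector_mult_def sum_2 X b1_def b2_def)
  have ms: "(metric G *v shift G) $ J = metric G $ J $ 1 * b1 + metric G $ J $ 2 * b2" for J
    by (simp add: matrix_vector_mult_def sum_2 b1_def b2_def)
  have h00: "has_partials (\<lambda>y. st_metric (\<G> y) $ None $ None)
     (\<lambda>K. - (2 * al * da K) + ((b1 * ((m11 * db 1 K + dg 1 1 K * b1) + (m12 * db 2 K + dg 1 2 K * b2)) + db 1 K * (m11 * b1 + m12 * b2))
        + (b2 * ((m12 * db 1 K + dg 1 2 K * b1) + (m22 * db 2 K + dg 2 2 K * b2)) + db 2 K * (m12 * b1 + m22 * b2)))) x"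
    using has_partials_add[OF has_partials_minus[OF has_partials_power2[OF hp(1)]]
      has_partials_add[OF has_partials_mult[OF hp(2)[of 1] hs[of 1]] has_partials_mult[OF hp(2)[of 2] hs[of 2]]]]
    by (simp add: st_metric_nth inner_real2 X ms dg21 m21 al_def[symmetric] b1_def[symmetric] b2_def[symmetric]
        m11_def[symmetric] m12_def[symmetric] m22_def[symmetric])
  have dS: "dS K None None = - 2 * al * da K + (dg 1 1 K * b1\<^sup>2 + 2 * dg 1 2 K * b1 * b2 + dg 2 2 K * b2\<^sup>2)
        + 2 * (m11 * b1 * db 1 K + m12 * b1 * db 2 K + m12 * b2 * db 1 K + m22 * b2 * db 2 K)"
      "dS K None (Some 1) = dg 1 1 K * b1 + dg 1 2 K * b2 + m11 * db 1 K + m12 * db 2 K" "dS K (Some J) None = dS K None (Some J)"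
      "dS K None (Some 2) = dg 1 2 K * b1 + dg 2 2 K * b2 + m12 * db 1 K + m22 * db 2 K"
      "dS K (Some 1) (Some 1) = dg 1 1 K" "dS K (Some 1) (Some 2) = dg 1 2 K" "dS K (Some 2) (Some 1) = dg 1 2 K" "dS K (Some 2) (Some 2) = dg 2 2 K" for K J
    using has_partials_partial[OF h00, of K] has_partials_partial[OF hs, of K 1] has_partials_partial[OF hs, of K 2] dg21[of K]
    by (simp_all add: dS_def st_metric_nth has_partials_partial[OF hp(3)] m21 m11_def m12_def m22_def power2_eq_square algebra_simps)
  have dSsym: "dS K \<mu> \<nu> = dS K \<nu> \<mu>" for K \<mu> \<nu>
  proof -
    have "\<forall>\<mu> \<nu>. dS K \<mu> \<nu> = dS K \<nu> \<mu>" unfolding forall_option2 using dS by simp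
    then show ?thesis by blast
  qed
  define P where "P K = (\<Sum>\<mu>\<in>UNIV. \<Sum>\<nu>\<in>UNIV. T \<mu> \<nu> * dS K \<mu> \<nu>) / 2" for K
  have P: "P K = - al * T None None * da K
       + ((H * (v $ 1)\<^sup>2 + p * h $ 1 $ 1) * dg 1 1 K + 2 * (H * v $ 1 * v $ 2 + p * h $ 1 $ 2) * dg 1 2 K + (H * (v $ 2)\<^sup>2 + p * h $ 2 $ 2) * dg 2 2 K) / 2
       + (m11 * db 1 K + m12 * db 2 K) * (i * H * v $ 1) + (m12 * db 1 K + m22 * db 2 K) * (i * H * v $ 2)" for K
    unfolding P_def
    by (rule scalar_metric_variation[where ?b1.0 = b1 and ?b2.0 = b2, OF T(3) T(3) T21 dS(1) dS(2) dS(3) dS(4) dS(3) dS(5-8)])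
      (simp_all add: T u b1_def b2_def power2_eq_square algebra_simps)
  define R where "R = (\<Sum>\<tau>\<in>UNIV. matrix_inv (st_metric G) $ None $ \<tau> * (\<Sum>I\<in>UNIV. \<Sum>\<nu>\<in>UNIV. T (Some I) \<nu> * dS I \<tau> \<nu>))"
  have C: "(\<Sum>\<mu>\<in>UNIV. \<Sum>\<nu>\<in>UNIV. T \<mu> \<nu> * christoffel \<G> x None \<mu> \<nu>) = R - (b1 * i\<^sup>2 * P 1 + b2 * i\<^sup>2 * P 2)"
  proof -
    have "christoffel \<G> x None \<mu> \<nu> = (\<Sum>\<tau>\<in>UNIV. matrix_inv (st_metric G) $ None $ \<tau> *
       ((case \<mu> of None \<Rightarrow> 0 | Some K \<Rightarrow> dS K \<tau> \<nu>) + (case \<nu> of None \<Rightarrow> 0 | Some K \<Rightarrow> dS K \<tau> \<mu>)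
          - (case \<tau> of None \<Rightarrow> 0 | Some K \<Rightarrow> dS K \<mu> \<nu>)) / 2)" for \<mu> \<nu>
      unfolding christoffel_def st_partial_def dS_def X(3) ..
    then have "(\<Sum>\<mu>\<in>UNIV. \<Sum>\<nu>\<in>UNIV. T \<mu> \<nu> * christoffel \<G> x None \<mu> \<nu>)
      = R - (\<Sum>K\<in>UNIV. matrix_inv (st_metric G) $ None $ Some K * P K)"
      using christoffel_contraction[of T dS "\<lambda>\<tau>. matrix_inv (st_metric G) $ None $ \<tau>", OF Tsym dSsym]
      by (simp only: R_def P_def)
    then show ?thesis by (simp add: sum_2 inv b1_def b2_def)
  qed
  have contr: "i\<^sup>2 * (b1 * dS I (Some 1) (Some J) + b2 * dS I (Some 2) (Some J) - dS I None (Some J))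
      = - (i\<^sup>2) * (metric G $ 1 $ J * db 1 I + metric G $ 2 $ J * db 2 I)"
     "i\<^sup>2 * (b1 * dS I (Some 1) None + b2 * dS I (Some 2) None - dS I None None)
      = i\<^sup>2 * (2 * al * da I - (b1 * (m11 * db 1 I + m12 * db 2 I) + b2 * (m12 * db 1 I + m22 * db 2 I)))" for I J
    using exhaust_2[of J] by (auto simp: dS m21 m11_def[symmetric] m12_def[symmetric] m22_def[symmetric] power2_eq_square algebra_simps)
  \<comment> \<open>The part of the stress against which the shift gradient works; one index is projected onto the normal frame.\<close>
  define N where "N I J = T (Some I) (Some J) + shift G $ J * T (Some I) None" for I J
  have N: "N I J = H * u $ I * v $ J + p * h $ I $ J" for I J
    by (simp add: N_def T u power2_eq_square algebra_simps)
  have Rexp: "R = (\<Sum>I\<in>UNIV. \<Sum>\<nu>\<in>UNIV. T (Some I) \<nu> * (i\<^sup>2 * (b1 * dS I (Some 1) \<nu> + b2 * dS I (Some 2) \<nu> - dS I None \<nu>)))"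
    unfolding R_def sum_option2 sum_2 inv b1_def b2_def by (simp add: algebra_simps)
  have R: "R = i\<^sup>2 * (2 * al * (T None (Some 1) * da 1 + T None (Some 2) * da 2)
      - (\<Sum>I\<in>UNIV. (m11 * db 1 I + m12 * db 2 I) * N I 1 + (m12 * db 1 I + m22 * db 2 I) * N I 2))"
    unfolding Rexp sum_option2 sum_2 contr N_def
    by (simp add: T(3) m21 m11_def[symmetric] m12_def[symmetric] m22_def[symmetric] b1_def[symmetric] b2_def[symmetric] algebra_simps)
  have mh: "m11 * h $ 1 $ 1 + m12 * h $ 1 $ 2 = 1" "m12 * h $ 1 $ 1 + m22 * h $ 1 $ 2 = 0"
     "m11 * h $ 1 $ 2 + m12 * h $ 2 $ 2 = 0" "m12 * h $ 1 $ 2 + m22 * h $ 2 $ 2 = 1"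
    using j2_eq(2,3)[OF okG] unfolding h_def matrix_inv_metric[OF okG] m11_def m12_def m22_def
    by (simp_all add: field_simps power2_eq_square)
  have R2: "(\<Sum>I\<in>UNIV. (m11 * db 1 I + m12 * db 2 I) * N I 1 + (m12 * db 1 I + m22 * db 2 I) * N I 2)
     = H * (\<Sum>I\<in>UNIV. u $ I * ((m11 * db 1 I + m12 * db 2 I) * v $ 1 + (m12 * db 1 I + m22 * db 2 I) * v $ 2)) + p * (db 1 1 + db 2 2)"
    (is "?L = ?R")
  proof -
    have "?L = ?R - p * (db 1 1 + db 2 2)
      + p * (db 1 1 * (m11 * h $ 1 $ 1 + m12 * h $ 1 $ 2) + db 2 1 * (m12 * h $ 1 $ 1 + m22 * h $ 1 $ 2)
           + db 1 2 * (m11 * h $ 1 $ 2 + m12 * h $ 2 $ 2) + db 2 2 * (m12 * h $ 1 $ 2 + m22 * h $ 2 $ 2))"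
      unfolding sum_2 N h21 by (simp add: algebra_simps)
    also have "\<dots> = ?R" unfolding mh by (simp add: algebra_simps)
    finally show ?thesis .
  qed
  have S: "SV \<Gamma> q \<G> x $ 2 = P 1" "SV \<Gamma> q \<G> x $ 3 = P 2"
     "SV \<Gamma> q \<G> x $ 4 = T None (Some 1) * da 1 + T None (Some 2) * da 2 - al * (R - (b1 * i\<^sup>2 * P 1 + b2 * i\<^sup>2 * P 2))"
    unfolding C[symmetric] by (simp_all add: SV_def Let_def P_def T_def dS_def X sum_2 T(3)[unfolded T_def] has_partials_partial[OF hp(1)] al_def)
  have ali2: "al * i\<^sup>2 = i" using ali by (simp add: power2_eq_square mult.assoc[symmetric])
  have "v $ 1 * SV \<Gamma> q \<G> x $ 2 + v $ 2 * SV \<Gamma> q \<G> x $ 3 - SV \<Gamma> q \<G> x $ 4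
     = (v $ 1 - (al * i\<^sup>2) * b1) * P 1 + (v $ 2 - (al * i\<^sup>2) * b2) * P 2
       - (T None (Some 1) * da 1 + T None (Some 2) * da 2) + al * R"
    unfolding S by (simp add: algebra_simps)
  also have "al * R = 2 * (al * i) * (T None (Some 1) * da 1 + T None (Some 2) * da 2)
     - i * (H * (\<Sum>I\<in>UNIV. u $ I * ((m11 * db 1 I + m12 * db 2 I) * v $ 1 + (m12 * db 1 I + m22 * db 2 I) * v $ 2)) + p * (db 1 1 + db 2 2))"
  proof -
    have "al * R = (al * i\<^sup>2) * (2 * al * (T None (Some 1) * da 1 + T None (Some 2) * da 2) -
       (H * (\<Sum>I\<in>UNIV. u $ I * ((m11 * db 1 I + m12 * db 2 I) * v $ 1 + (m12 * db 1 I + m22 * db 2 I) * v $ 2)) + p * (db 1 1 + db 2 2)))"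
      unfolding R R2 by simp
    then show ?thesis unfolding ali2 by (simp add: algebra_simps)
  qed
  also have "(v $ 1 - (al * i\<^sup>2) * b1) * P 1 + (v $ 2 - (al * i\<^sup>2) * b2) * P 2 = (\<Sum>K\<in>UNIV. u $ K * P K)"
    unfolding ali2 by (simp add: sum_2 u b1_def b2_def)
  also have "(\<Sum>K\<in>UNIV. u $ K * P K) - (T None (Some 1) * da 1 + T None (Some 2) * da 2)
    + (2 * (al * i) * (T None (Some 1) * da 1 + T None (Some 2) * da 2)
     - i * (H * (\<Sum>I\<in>UNIV. u $ I * ((m11 * db 1 I + m12 * db 2 I) * v $ 1 + (m12 * db 1 I + m22 * db 2 I) * v $ 2)) + p * (db 1 1 + db 2 2)))
    = (\<Sum>K\<in>UNIV. u $ K * (H * ((v $ 1)\<^sup>2 * dg 1 1 K + 2 * v $ 1 * v $ 2 * dg 1 2 K + (v $ 2)\<^sup>2 * dg 2 2 K)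
           + p * (h $ 1 $ 1 * dg 1 1 K + 2 * h $ 1 $ 2 * dg 1 2 K + h $ 2 $ 2 * dg 2 2 K)) / 2)
      + (\<Sum>K\<in>UNIV. (T None (Some K) - u $ K * (al * T None None)) * da K) - i * p * (db 1 1 + db 2 2)"
    unfolding ali P sum_2 by (simp add: field_simps)
  also have "(\<Sum>K\<in>UNIV. (T None (Some K) - u $ K * (al * T None None)) * da K) = i * p * (v $ 1 * da 1 + v $ 2 * da 2)"
  proof -
    have "T None (Some K) - u $ K * (al * T None None) = i * p * v $ K" for K
    proof -
      have *: "al * T None None = i * (H - p)" unfolding T mult.assoc[symmetric] ali2 ..
      show ?thesis unfolding * by (simp add: T(2) u power2_eq_square algebra_simps)
    qed
    then show ?thesis by (simp add: sum_2 algebra_simps)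
  qed
  finally show ?thesis by (simp add: i_def p_def algebra_simps)
qed


lemma metric_vup:
  assumes "geom_ok G"
  shows "metric G $ 1 $ 1 * (vup q G $ 1)\<^sup>2 + 2 * metric G $ 1 $ 2 * vup q G $ 1 * vup q G $ 2 + metric G $ 2 $ 2 * (vup q G $ 2)\<^sup>2
     = (vel q $ 1)\<^sup>2 + (vel q $ 2)\<^sup>2"
proof -
  define m11 m12 j r c1 c2 where "m11 = metric G $ 1 $ 1" and "m12 = metric G $ 1 $ 2" and "j = j2 G"
    and "r = sqrt (metric G $ 2 $ 2)" and "c1 = vel q $ 1" and "c2 = vel q $ 2"
  have r: "metric G $ 2 $ 2 = r\<^sup>2" "r > 0" using assms by (auto simp: r_def geom_ok_iff)
  have j: "j > 0" "j\<^sup>2 = m11 * r\<^sup>2 - m12\<^sup>2" using j2_eq[OF assms] by (auto simp: j_def m11_def m12_def r(1))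
  have v: "vup q G $ 1 = r / j * c1" "vup q G $ 2 = (c2 - m12 / j * c1) / r"
    using r j by (simp_all add: vup_def sum_2 Theta_explicit(1)[OF assms] m12_def[symmetric] j_def[symmetric] r_def[symmetric]
        c1_def[symmetric] c2_def[symmetric] diff_divide_distrib)
  have "m11 * (r / j * c1)\<^sup>2 + 2 * m12 * (r / j * c1) * ((c2 - m12 / j * c1) / r) + r\<^sup>2 * ((c2 - m12 / j * c1) / r)\<^sup>2
     = (m11 * r\<^sup>2 - m12\<^sup>2) / j\<^sup>2 * c1\<^sup>2 + c2\<^sup>2"
    using r(2) j(1) by (simp add: field_simps power2_eq_square)
  also have "\<dots> = c1\<^sup>2 + c2\<^sup>2" unfolding j(2)[symmetric] using j(1) by simp
  finally show ?thesis by (simp add: v r(1) m11_def[symmetric] m12_def[symmetric] c1_def[symmetric] c2_def[symmetric])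
qed

text \<open>The orthonormal components of the velocity are held fixed while the frame rotates, so
  \<open>\<gamma>\<^sub>I\<^sub>J v\<^sup>I v\<^sup>J\<close> is constant; this is its derivative.\<close>

lemma frame_variation:
  fixes q :: prim
  assumes at: "geom_at X x \<G> G"
    and hg: "\<And>J L. has_partials (\<lambda>y. metric (\<G> y) $ J $ L) (dg J L) x"
    and hT: "\<And>a J. has_partials (\<lambda>y. Theta (\<G> y) $ a $ J) (dT a J) x"
    and w: "\<And>J K. w J K = dT 1 J K * vel q $ 1 + dT 2 J K * vel q $ 2"
  defines "v \<equiv> vup q G"
  shows "(v $ 1)\<^sup>2 * dg 1 1 K + 2 * v $ 1 * v $ 2 * dg 1 2 K + (v $ 2)\<^sup>2 * dg 2 2 K
     = - 2 * ((metric G *v v) $ 1 * w 1 K + (metric G *v v) $ 2 * w 2 K)"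
proof -
  have X: "open X" "x \<in> X" "\<G> x = G" and okG: "geom_ok G" and ok: "\<And>y. y \<in> X \<Longrightarrow> geom_ok (\<G> y)"
    using at geom_at_ok by (auto simp: geom_at_def)
  have hv: "has_partials (\<lambda>y. vup q (\<G> y) $ J) (w J) x" for J
  proof -
    have "has_partials (\<lambda>y. Theta (\<G> y) $ 1 $ J * vel q $ 1 + Theta (\<G> y) $ 2 $ J * vel q $ 2) (w J) x"
      using has_partials_add[OF has_partials_mult[OF hT[of 1 J] has_partials_const[of "vel q $ 1"]]
          has_partials_mult[OF hT[of 2 J] has_partials_const[of "vel q $ 2"]]]
      by (rule has_partials_eq) (simp add: w)
    then show ?thesis by (simp add: vup_def sum_2)
  qed
  have "has_partials (\<lambda>y. metric (\<G> y) $ 1 $ 1 * (vup q (\<G> y) $ 1)\<^sup>2 + (2 * metric (\<G> y) $ 1 $ 2 * vup q (\<G> y) $ 1 * vup q (\<G> y) $ 2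
      + metric (\<G> y) $ 2 $ 2 * (vup q (\<G> y) $ 2)\<^sup>2)) (\<lambda>K. (v $ 1)\<^sup>2 * dg 1 1 K + 2 * v $ 1 * v $ 2 * dg 1 2 K + (v $ 2)\<^sup>2 * dg 2 2 K
     + 2 * ((metric G $ 1 $ 1 * v $ 1 + metric G $ 1 $ 2 * v $ 2) * w 1 K + (metric G $ 1 $ 2 * v $ 1 + metric G $ 2 $ 2 * v $ 2) * w 2 K)) x"
    using has_partials_add[OF has_partials_mult[OF hg[of 1 1] has_partials_power2[OF hv[of 1]]]
       has_partials_add[OF has_partials_mult[OF has_partials_mult[OF has_partials_mult[OF has_partials_const[of 2] hg[of 1 2]] hv[of 1]] hv[of 2]]
         has_partials_mult[OF hg[of 2 2] has_partials_power2[OF hv[of 2]]]]]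
    by (rule has_partials_eq) (simp add: X v_def algebra_simps)
  moreover have "has_partials (\<lambda>y. metric (\<G> y) $ 1 $ 1 * (vup q (\<G> y) $ 1)\<^sup>2 + (2 * metric (\<G> y) $ 1 $ 2 * vup q (\<G> y) $ 1 * vup q (\<G> y) $ 2
      + metric (\<G> y) $ 2 $ 2 * (vup q (\<G> y) $ 2)\<^sup>2)) (\<lambda>K. 0) x"
    by (rule has_partials_cong[OF has_partials_const[of "(vel q $ 1)\<^sup>2 + (vel q $ 2)\<^sup>2"] X(1,2)])
      (use metric_vup[OF ok, of _ q] in \<open>simp add: add.assoc\<close>)
  note fun_cong[OF has_partials_unique[OF calculation this], of K]
  then have "(v $ 1)\<^sup>2 * dg 1 1 K + 2 * v $ 1 * v $ 2 * dg 1 2 K + (v $ 2)\<^sup>2 * dg 2 2 K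
     + 2 * ((metric G $ 1 $ 1 * v $ 1 + metric G $ 1 $ 2 * v $ 2) * w 1 K + (metric G $ 1 $ 2 * v $ 1 + metric G $ 2 $ 2 * v $ 2) * w 2 K) = 0" .
  then show ?thesis using okG by (simp add: matrix_vector_mult_def sum_2 geom_ok_iff)
qed

text \<open>The spatial metric terms of \<open>stationary_source_work\<close> that carry the inertia \<open>H\<close> cancel against
  the rotation of the frame by \<open>frame_variation\<close>.  In the pressure terms \<open>\<gamma>\<^sup>-\<^sup>1 : \<partial>\<gamma>\<close> is the
  logarithmic derivative of \<open>j\<^sub>2\<^sup>2\<close>, and \<open>\<zeta> p = \<rho>\<close> turns the pressure into the density.\<close>

theorem entropy_source_balance:
  assumes at: "geom_at X x \<G> G" and q: "prim_ok q"
  shows "entropy_var \<Gamma> q \<bullet> SW \<Gamma> q \<G> x = dens q *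
    (vel q $ 1 * (partial 1 (\<lambda>y. Ageo (\<G> y) 1 1) x + partial 2 (\<lambda>y. Ageo (\<G> y) 1 2) x)
     + vel q $ 2 * partial 2 (\<lambda>y. Ageo (\<G> y) 2 2) x
     - partial 1 (\<lambda>y. Cgeo (\<G> y) 1) x - partial 2 (\<lambda>y. Cgeo (\<G> y) 2) x)"
proof -
  have X: "open X" "x \<in> X" "\<G> x = G" and okG: "geom_ok G" and ok: "\<And>y. y \<in> X \<Longrightarrow> geom_ok (\<G> y)"
    using at geom_at_ok by (auto simp: geom_at_def)
  define v u H p z L where "v = vup q G" and "u = vtil q G" and "H = rho q * enthalpy \<Gamma> q * (lorentz q)\<^sup>2"
    and "p = prs q" and "z = rho q / prs q" and "L = lorentz q"
  define h where "h = matrix_inv (metric G)"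
  define da where "da = (\<lambda>I. partial I (\<lambda>y. lapse (\<G> y)) x)"
  define db where "db = (\<lambda>J I. partial I (\<lambda>y. shift (\<G> y) $ J) x)"
  define dg where "dg = (\<lambda>J K I. partial I (\<lambda>y. metric (\<G> y) $ J $ K) x)"
  define dT where "dT = (\<lambda>a J I. partial I (\<lambda>y. Theta (\<G> y) $ a $ J) x)"
  define w where "w = (\<lambda>J I. dT 1 J I * vel q $ 1 + dT 2 J I * vel q $ 2)"
  define dj where "dj = (\<lambda>I. partial I (\<lambda>y. j2 (\<G> y)) x)"
  define al j c1 c2 where "al = lapse G" and "j = j2 G" and "c1 = vel q $ 1" and "c2 = vel q $ 2"
  have pos: "al > 0" "j > 0" "p > 0" using okG j2_eq(2)[OF okG] q by (auto simp: geom_ok_iff al_def j_def p_def prim_ok_def)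
  have hT: "has_partials (\<lambda>y. Theta (\<G> y) $ a $ J) (dT a J) x" for a J
    unfolding dT_def by (rule Theta_has_partials[OF at])
  have hp: "has_partials (\<lambda>y. lapse (\<G> y)) da x" "has_partials (\<lambda>y. shift (\<G> y) $ J) (db J) x"
     "has_partials (\<lambda>y. metric (\<G> y) $ J $ K) (dg J K) x" for J K
    unfolding da_def db_def dg_def by (rule geom_at_has_partials[OF at])+
  have hj: "has_partials (\<lambda>y. j2 (\<G> y)) dj x"
    using geovar_derivs(1)[OF at hp, THEN has_partials_self] by (simp add: dj_def)
  have djh: "h $ 1 $ 1 * dg 1 1 K + 2 * h $ 1 $ 2 * dg 1 2 K + h $ 2 $ 2 * dg 2 2 K = 2 * dj K / j" for K

  proof -
    have "dj K = (metric G $ 1 $ 1 * dg 2 2 K + dg 1 1 K * metric G $ 2 $ 2 - 2 * metric G $ 1 $ 2 * dg 1 2 K) / (2 * j)"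
      using fun_cong[OF has_partials_unique[OF hj geovar_derivs(1)[OF at hp]], of K] by (simp add: j_def)
    then have "2 * dj K / j = (metric G $ 1 $ 1 * dg 2 2 K + dg 1 1 K * metric G $ 2 $ 2 - 2 * metric G $ 1 $ 2 * dg 1 2 K) / j\<^sup>2"
    proof -
      have "2 * (y / (2 * j)) / j = y / j\<^sup>2" for y by (simp add: power2_eq_square)
      then show ?thesis unfolding \<open>dj K = _\<close> .
    qed
    then show ?thesis
      by (simp add: h_def matrix_inv_metric[OF okG] j_def[symmetric] diff_divide_distrib add_divide_distrib mult.commute)
  qed
  have wJ: "w J I = dT 1 J I * vel q $ 1 + dT 2 J I * vel q $ 2" for J I by (simp add: w_def)
  have work: "v $ 1 * SV \<Gamma> q \<G> x $ 2 + v $ 2 * SV \<Gamma> q \<G> x $ 3 - SV \<Gamma> q \<G> x $ 4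
      = p / al * (v $ 1 * da 1 + v $ 2 * da 2)
      + (\<Sum>K\<in>UNIV. u $ K * (H * (- 2 * ((metric G *v v) $ 1 * w 1 K + (metric G *v v) $ 2 * w 2 K)) + p * (2 * dj K / j)) / 2)
      - p / al * (db 1 1 + db 2 2)"
    using stationary_source_work[OF at q hp, of \<Gamma>] frame_variation[OF at hp(3) hT wJ, folded v_def]
    unfolding v_def[symmetric] u_def[symmetric] H_def[symmetric] h_def[symmetric] p_def[symmetric] al_def[symmetric]
    by (simp only: djh)
  have FV: "FV \<Gamma> q G I $ 2 = H * (metric G *v v) $ 1 * u $ I + p * kron I 1"
    "FV \<Gamma> q G I $ 3 = H * (metric G *v v) $ 2 * u $ I + p * kron I 2" for I
    by (simp_all add: FV_def Slow_def H_def v_def u_def p_def)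
  have dL: "partial I (\<lambda>y. Lmat (\<G> y)) x = vector
     [vector [0, 0, 0, 0], vector [0, dT 1 1 I, dT 1 2 I, 0], vector [0, dT 2 1 I, dT 2 2 I, 0], vector [0, 0, 0, 0]]" for I
    by (rule partial_Lmat[OF hT])
  have V: "entropy_var \<Gamma> q $ 2 = z * L * c1" "entropy_var \<Gamma> q $ 3 = z * L * c2" "entropy_var \<Gamma> q $ 4 = - z * L"
    by (simp_all add: entropy_var_def Let_def z_def L_def c1_def c2_def)
  have vJ: "v $ J = Theta G $ 1 $ J * c1 + Theta G $ 2 $ J * c2" for J
    by (simp add: v_def vup_def sum_2 c1_def c2_def)
  have S1: "SV \<Gamma> q \<G> x $ 1 = 0" by (simp add: SV_def Let_def)
  have "entropy_var \<Gamma> q \<bullet> SW \<Gamma> q \<G> x = al * j * z * L *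
     ((v $ 1 * SV \<Gamma> q \<G> x $ 2 + v $ 2 * SV \<Gamma> q \<G> x $ 3 - SV \<Gamma> q \<G> x $ 4)
      + (\<Sum>I\<in>UNIV. w 1 I * FV \<Gamma> q G I $ 2 + w 2 I * FV \<Gamma> q G I $ 3))"
    unfolding SW_def X(3) dL
    by (simp add: inner_real4 V Lmat_def matrix_vector_mult_def sum_4 sum_2 S1 vJ wJ c1_def[symmetric] c2_def[symmetric] al_def[symmetric] j_def[symmetric] algebra_simps)
  also have "(\<Sum>I\<in>UNIV. w 1 I * FV \<Gamma> q G I $ 2 + w 2 I * FV \<Gamma> q G I $ 3)
     = (\<Sum>I\<in>UNIV. u $ I * H * ((metric G *v v) $ 1 * w 1 I + (metric G *v v) $ 2 * w 2 I)) + p * (w 1 1 + w 2 2)"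
    unfolding FV sum_2 by (simp add: kron_def algebra_simps)
  also have "(v $ 1 * SV \<Gamma> q \<G> x $ 2 + v $ 2 * SV \<Gamma> q \<G> x $ 3 - SV \<Gamma> q \<G> x $ 4) + \<dots>
     = p * ((v $ 1 * da 1 + v $ 2 * da 2) / al + (u $ 1 * dj 1 + u $ 2 * dj 2) / j - (db 1 1 + db 2 2) / al + (w 1 1 + w 2 2))"
    unfolding work sum_2 by (simp add: algebra_simps add_divide_distrib diff_divide_distrib)
  also have "al * j * z * L * \<dots> = (p * z) * L * (j * (v $ 1 * da 1 + v $ 2 * da 2) + al * (u $ 1 * dj 1 + u $ 2 * dj 2)
      - j * (db 1 1 + db 2 2) + al * j * (w 1 1 + w 2 2))"
    using pos(1,2) by (simp add: field_simps)
  also have "p * z * L = dens q" using pos by (simp add: p_def z_def L_def dens_def)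
  also have "al * (u $ 1 * dj 1 + u $ 2 * dj 2) = al * (v $ 1 * dj 1 + v $ 2 * dj 2) - (shift G $ 1 * dj 1 + shift G $ 2 * dj 2)"
    using pos by (simp add: u_def vtil_def v_def al_def[symmetric] field_simps)
  finally have main: "entropy_var \<Gamma> q \<bullet> SW \<Gamma> q \<G> x = dens q * (j * (v $ 1 * da 1 + v $ 2 * da 2)
      + (al * (v $ 1 * dj 1 + v $ 2 * dj 2) - (shift G $ 1 * dj 1 + shift G $ 2 * dj 2)) - j * (db 1 1 + db 2 2) + al * j * (w 1 1 + w 2 2))" .
  have dA: "partial I (\<lambda>y. Ageo (\<G> y) a J) x = al * j * dT a J I + (al * dj I + da I * j) * Theta G $ a $ J" for a J I
    using has_partials_partial[OF has_partials_mult[OF has_partials_mult[OF hp(1) hj] hT[of a J]], of I]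
    by (simp add: Ageo_def X al_def j_def)
  have dA21: "partial 1 (\<lambda>y. Ageo (\<G> y) 2 1) x = 0"
    using has_partials_partial[OF has_partials_cong[OF has_partials_const[of 0] X(1,2), of "\<lambda>y. Ageo (\<G> y) 2 1"]] ok
    by (simp add: Ageo_explicit)
  have dC: "partial I (\<lambda>y. Cgeo (\<G> y) J) x = j * db J I + dj I * shift G $ J" for J I
    using has_partials_partial[OF has_partials_mult[OF hj hp(2)[of J]], of I] by (simp add: Cgeo_def X j_def)
  have "dens q * (c1 * (partial 1 (\<lambda>y. Ageo (\<G> y) 1 1) x + partial 2 (\<lambda>y. Ageo (\<G> y) 1 2) x)
     + c2 * partial 2 (\<lambda>y. Ageo (\<G> y) 2 2) x
     - partial 1 (\<lambda>y. Cgeo (\<G> y) 1) x - partial 2 (\<lambda>y. Cgeo (\<G> y) 2) x)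
    = dens q * (c1 * (partial 1 (\<lambda>y. Ageo (\<G> y) 1 1) x + partial 2 (\<lambda>y. Ageo (\<G> y) 1 2) x)
     + c2 * (partial 1 (\<lambda>y. Ageo (\<G> y) 2 1) x + partial 2 (\<lambda>y. Ageo (\<G> y) 2 2) x)
     - partial 1 (\<lambda>y. Cgeo (\<G> y) 1) x - partial 2 (\<lambda>y. Cgeo (\<G> y) 2) x)"
    by (simp add: dA21)
  also have "\<dots> = entropy_var \<Gamma> q \<bullet> SW \<Gamma> q \<G> x"
    unfolding main dA dC vJ wJ c1_def[symmetric] c2_def[symmetric] by (simp add: algebra_simps)
  finally show ?thesis by (simp add: c1_def c2_def)
qed

lemma SW_density: "SW \<Gamma> q \<G> x $ 1 = 0" if "geom_at X x \<G> G"
proof -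
  have "partial I (\<lambda>y. Lmat (\<G> y)) x $ 1 = 0" for I
    unfolding partial_Lmat[OF Theta_has_partials[OF that]] by (simp add: vec_eq_iff forall_4)
  then show ?thesis
    by (simp add: SW_def sum_2 Lmat_def matrix_vector_mult_def sum_4 SV_def Let_def)
qed

text \<open>The correction \<open>Rw\<close> is designed so that the last contraction vanishes: the entropy variables
  map \<open>Pperp\<close> to the potential of the flux, which is also what they make of the other terms.\<close>

theorem source_coeffs_entropy:
  fixes \<Gamma> :: real
  assumes G: "geom_ok G" and q: "prim_ok q"
  defines "B \<equiv> source_coeffs \<Gamma> q G"
  shows "entropy_var \<Gamma> q \<bullet> bj B I = 0"
    and "(a, J) \<in> upper_idx \<Longrightarrow> entropy_var \<Gamma> q \<bullet> bA B I a J = dens q * vel q $ a * kron I J"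
    and "entropy_var \<Gamma> q \<bullet> bC B I J = - dens q * kron I J"
    and "entropy_var \<Gamma> q \<bullet> Rw \<Gamma> q G I = 0"
proof -
  define w where "w I k = [0, dens q * vel q $ 1 * kron I 1, dens q * vel q $ 1 * kron I 2, dens q * vel q $ 2 * kron I 2,
     - dens q * kron I 1, - dens q * kron I 2] ! k" for I :: 2 and k
  have c: "entropy_var \<Gamma> q \<bullet> coef B I k = w I k" if "k < 6" for I k
  proof (rule coef_functional[OF G _ _ that])
    show "is_source_coeffs \<Gamma> q G B" unfolding B_def by (rule source_coeffs_exist[OF G])
    fix X x \<G> assume "geom_at X x \<G> G"
    from entropy_source_balance[OF this q, of \<Gamma>]
    show "entropy_var \<Gamma> q \<bullet> SW \<Gamma> q \<G> x = (\<Sum>I\<in>UNIV. \<Sum>k<6. partial I (\<lambda>y. geovar k (\<G> y)) x * w I k)"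
      unfolding sum_lessThan_6 sum_2 by (simp add: w_def kron_def algebra_simps)
  qed
  show j: "entropy_var \<Gamma> q \<bullet> bj B I = 0" using c[of 0 I] by (simp add: coef_def w_def)
  have A: "entropy_var \<Gamma> q \<bullet> bA B I 1 1 = dens q * vel q $ 1 * kron I 1"
      "entropy_var \<Gamma> q \<bullet> bA B I 1 2 = dens q * vel q $ 1 * kron I 2"
      "entropy_var \<Gamma> q \<bullet> bA B I 2 2 = dens q * vel q $ 2 * kron I 2"
    using c[of 1 I] c[of 2 I] c[of 3 I] by (simp_all add: coef_def w_def)
  then show "(a, J) \<in> upper_idx \<Longrightarrow> entropy_var \<Gamma> q \<bullet> bA B I a J = dens q * vel q $ a * kron I J"
    by (auto simp: upper_idx_def)
  show C: "entropy_var \<Gamma> q \<bullet> bC B I J = - dens q * kron I J" for J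
    using c[of 4 I] c[of 5 I] exhaust_2[of J] by (auto simp: coef_def w_def)
  have P: "entropy_var \<Gamma> q \<bullet> Pperp q G I = dens q * (vel q $ 1 * Ageo G 1 I + vel q $ 2 * Ageo G 2 I) - dens q * Cgeo G I"
  proof -
    have "prs q > 0" "lapse G > 0" using q G by (auto simp: prim_ok_def geom_ok_iff)
    then show ?thesis
      by (simp add: inner_real4 entropy_var_def Pperp_def Let_def matrix_inv_st_metric[OF G] Ageo_def Cgeo_def dens_def
          field_simps power2_eq_square)
  qed
  show "entropy_var \<Gamma> q \<bullet> Rw \<Gamma> q G I = 0"
    unfolding Rw_def Let_def B_def[symmetric] inner_diff_right P sum_upper_idx sum_2 inner_add_right inner_scaleR_right A C
    using exhaust_2[of I] Ageo_explicit(3)[OF G] by (auto simp: kron_def algebra_simps)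
qed

text \<open>The continuity equation has no source.\<close>

theorem source_coeffs_density:
  fixes \<Gamma> :: real and q :: prim
  assumes G: "geom_ok G"
  defines "B \<equiv> source_coeffs \<Gamma> q G"
  shows "bj B I $ 1 = 0" and "(a, J) \<in> upper_idx \<Longrightarrow> bA B I a J $ 1 = 0" and "bC B I J $ 1 = 0" and "Rw \<Gamma> q G I $ 1 = 0"
proof -
  have e: "axis 1 1 \<bullet> y = y $ 1" for y :: "real^4" by (simp add: inner_axis' )
  have c: "axis 1 1 \<bullet> coef B I k = 0" if "k < 6" for I k
  proof (rule coef_functional[OF G _ _ that])
    show "is_source_coeffs \<Gamma> q G B" unfolding B_def by (rule source_coeffs_exist[OF G])
    fix X x \<G> assume "geom_at X x \<G> G"
    from SW_density[OF this, of \<Gamma> q]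
    show "axis 1 1 \<bullet> SW \<Gamma> q \<G> x = (\<Sum>I\<in>UNIV. \<Sum>k<6. partial I (\<lambda>y. geovar k (\<G> y)) x * 0)"
      by (simp add: e)
  qed
  show "bj B I $ 1 = 0" using c[of 0 I] by (simp add: coef_def e)
  have A: "bA B I 1 1 $ 1 = 0" "bA B I 1 2 $ 1 = 0" "bA B I 2 2 $ 1 = 0"
    using c[of 1 I] c[of 2 I] c[of 3 I] by (simp_all add: coef_def e)
  then show "(a, J) \<in> upper_idx \<Longrightarrow> bA B I a J $ 1 = 0" by (auto simp: upper_idx_def)
  show C: "bC B I J $ 1 = 0" for J using c[of 4 I] c[of 5 I] exhaust_2[of J] by (auto simp: coef_def e)
  show "Rw \<Gamma> q G I $ 1 = 0"
    by (simp add: Rw_def Let_def B_def[symmetric] sum_upper_idx sum_2 A C Pperp_def)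
qed

section \<open>Gauss--Legendre--Lobatto quadrature\<close>

definition ref_integral :: "real poly \<Rightarrow> real" where
  "ref_integral p = integral {-1..1} (poly p)"

lemma poly_integrable: "poly (p :: real poly) integrable_on {-1..1}"
  by (intro integrable_continuous_real continuous_intros)

lemma ref_integral_add: "ref_integral (p + q) = ref_integral p + ref_integral q"
  unfolding ref_integral_def poly_add[abs_def] by (intro integral_add poly_integrable)

lemma ref_integral_smult: "ref_integral (smult c p) = c * ref_integral p"
  unfolding ref_integral_def poly_smult[abs_def] by simp

lemma ref_integral_0 [simp]: "ref_integral 0 = 0"
  using ref_integral_smult[of 0 0] by simp

lemma ref_integral_sum: "ref_integral (\<Sum>i\<in>A. f i) = (\<Sum>i\<in>A. ref_integral (f i))"
  by (induction A rule: infinite_finite_induct) (simp_all add: ref_integral_add)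

lemma ref_integral_pderiv: "ref_integral (pderiv p) = poly p 1 - poly p (-1)"
  unfolding ref_integral_def
proof (rule integral_unique, rule fundamental_theorem_of_calculus)
  fix x :: real
  show "(poly p has_vector_derivative poly (pderiv p) x) (at x within {-1..1})"
    by (rule has_vector_derivative_at_within)
      (rule poly_DERIV[of p x, unfolded has_real_derivative_iff_has_vector_derivative])
qed simp

lemma ref_integral_by_parts: "ref_integral (f * pderiv g) = poly (f * g) 1 - poly (f * g) (-1) - ref_integral (pderiv f * g)"
  using ref_integral_pderiv[of "f * g"] by (simp add: pderiv_mult ref_integral_add mult.commute)

lemma ref_integral_pos:
  assumes "p \<noteq> 0" "\<And>x. x \<in> {-1..1} \<Longrightarrow> poly p x \<ge> 0"
  shows "ref_integral p > 0"
proof (rule ccontr)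
  assume "\<not> ref_integral p > 0"
  moreover have "ref_integral p \<ge> 0"
    unfolding ref_integral_def using assms(2) by (intro integral_nonneg poly_integrable)
  ultimately have "(poly p has_integral 0) (cbox (-1) 1)"
    using integrable_integral[OF poly_integrable[of p]] unfolding ref_integral_def cbox_interval by simp
  note int0 = this
  have "poly p x = 0" if "x \<in> cbox (-1) 1" for x
  proof (rule has_integral_0_cbox_imp_0[of "-1" 1 "poly p"])
    show "continuous_on (cbox (-1) 1) (poly p)" by (intro continuous_intros)
    show "0 \<le> poly p x" if "x \<in> box (-1) 1" for x using that assms(2) by simp
  qed (use that int0 in simp_all)
  then have "{-1..1} \<subseteq> {x. poly p x = 0}" by auto
  then have "finite {-1..(1::real)}" using poly_roots_finite[OF assms(1)] by (rule finite_subset)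
  then show False using infinite_Icc[of "-1" "1::real"] by simp
qed

text \<open>Each differentiation removes at most one of the \<open>N\<close> factors \<open>x\<^sup>2 - 1\<close>.\<close>

lemma Rodrigues_boundary:
  assumes "k < N" "x \<in> {-1, 1 :: real}"
  shows "poly ((pderiv ^^ k) ([:-1, 0, 1:] ^ N)) x = 0"
proof -
  define W :: "real poly" where "W = [:-1, 0, 1:]"
  have "W ^ (N - k) dvd (pderiv ^^ k) (W ^ N)"
    using assms(1)
  proof (induction k)
    case (Suc k)
    define m where "m = N - Suc k"
    have m: "N - k = Suc m" using Suc.prems by (simp add: m_def)
    have "W ^ Suc m dvd (pderiv ^^ k) (W ^ N)" using Suc m by simp
    then obtain g where g: "(pderiv ^^ k) (W ^ N) = W ^ Suc m * g" by (elim dvdE)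
    have "pderiv (W ^ Suc m * g) = W ^ m * (W * pderiv g + smult (of_nat (Suc m)) (pderiv W * g))"
      unfolding pderiv_mult pderiv_power_Suc by (simp add: algebra_simps)
    then show ?case unfolding m_def[symmetric] by (simp add: g del: power_Suc)
  qed simp
  then have "W dvd (pderiv ^^ k) (W ^ N)"
    using assms(1) by (meson dvd_power dvd_trans zero_less_diff)
  then obtain g where "(pderiv ^^ k) (W ^ N) = W * g" by (elim dvdE)
  then show ?thesis using assms(2) unfolding W_def[symmetric] by (auto simp: W_def)
qed

text \<open>Repeated integration by parts in Rodrigues' formula moves all derivatives to \<open>f\<close>; the boundary
  terms vanish by \<open>Rodrigues_boundary\<close>.\<close>

lemma legendre_orthogonal:
  assumes "degree f < N"
  shows "ref_integral (f * legendre N) = 0"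
proof -
  have "ref_integral (f * (pderiv ^^ k) ([:-1, 0, 1:] ^ N)) = 0" if "degree f < k" "k \<le> N" for f k
    using that
  proof (induction k arbitrary: f)
    case (Suc k)
    have "ref_integral (f * (pderiv ^^ Suc k) ([:-1, 0, 1:] ^ N)) = - ref_integral (pderiv f * (pderiv ^^ k) ([:-1, 0, 1:] ^ N))"
      using ref_integral_by_parts[of f "(pderiv ^^ k) ([:-1, 0, 1:] ^ N)"] Rodrigues_boundary[of k N] Suc.prems by simp
    also have "\<dots> = 0"
    proof (cases "degree f = 0")
      case True
      then have "pderiv f = 0" by (simp add: pderiv_eq_0_iff)
      then show ?thesis by simp
    next
      case False
      then show ?thesis using Suc by (simp add: degree_pderiv)
    qed
    finally show ?case .
  qed simp
  from this[OF assms] show ?thesis by (simp add: legendre_def ref_integral_smult)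
qed

lemma degree_legendre: "degree (legendre N) = N"
proof -
  have "degree ((pderiv ^^ k) p) = degree p - k" for k and p :: "real poly"
    by (induction k) (simp_all add: degree_pderiv)
  then show ?thesis by (simp add: legendre_def degree_power_eq)
qed

text \<open>The nodal polynomial of the GLL points, up to a constant factor.\<close>

definition gll_poly :: "nat \<Rightarrow> real poly" where
  "gll_poly N = [:1, 0, -1:] * pderiv (legendre N)"

lemma degree_gll_poly:
  assumes "N \<ge> 1" shows "degree (gll_poly N) = N + 1" "gll_poly N \<noteq> 0"
proof -
  have "pderiv (legendre N) \<noteq> 0"
    using assms by (simp add: pderiv_eq_0_iff degree_legendre)
  then show "degree (gll_poly N) = N + 1" "gll_poly N \<noteq> 0"
    using assms unfolding gll_poly_def
    by (simp_all add: degree_mult_eq degree_pderiv degree_legendre del: mult_pCons_left mult_pCons_right)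
qed

lemma gll_poly_orthogonal:
  assumes "g = 0 \<or> degree g + 2 \<le> N"
  shows "ref_integral (g * gll_poly N) = 0"
proof (cases "g = 0")
  case False
  then have d: "degree g + 2 \<le> N" using assms by simp
  define f where "f = g * [:1, 0, -1:]"
  have "degree f = degree g + 2" using False by (simp add: f_def degree_mult_eq del: mult_pCons_left mult_pCons_right)
  then have "degree (pderiv f) < N" using d by (simp add: degree_pderiv)
  then have "ref_integral (pderiv f * legendre N) = 0" by (rule legendre_orthogonal)
  then have "ref_integral (f * pderiv (legendre N)) = 0"
    using ref_integral_by_parts[of f "legendre N"] by (simp add: f_def)
  then show ?thesis by (simp only: f_def gll_poly_def mult.assoc)
qed simp

text \<open>Together with the factor \<open>1 - x\<^sup>2\<close> this places all nodes in \<open>[-1, 1]\<close>, so that the extreme nodes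
  are the end points.\<close>

lemma legendre_deriv_no_outer_roots:
  assumes "N \<ge> 1" "\<bar>x\<bar> > 1"
  shows "poly (pderiv (legendre N)) x \<noteq> 0"
proof -
  \<comment> \<open>The substitution \<open>x = s (1 + y)\<close> turns \<open>x\<^sup>2 - 1\<close> into \<open>y (2 + y)\<close>, whose powers have derivatives with nonnegative coefficients; \<open>|x| > 1\<close> becomes \<open>y > 0\<close>.\<close>
  define s :: real where "s = (if x > 0 then 1 else -1)"
  have s: "s * s = 1" "s * x = \<bar>x\<bar>" "s \<noteq> 0" by (auto simp: s_def)
  define y where "y = \<bar>x\<bar> - 1"
  have y: "y > 0" "s + s * y = x" using assms s by (auto simp: y_def s_def)
  define R :: "real poly" where "R = [:0, 2, 1:] ^ N"
  define Q :: "real poly" where "Q = [:-1, 0, 1:] ^ N"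
  have "pcompose [:-1, 0, 1:] [:s, s:] = [:0, 2, 1:]"
    using s(1) by (simp add: pcompose_pCons algebra_simps)
  then have Q: "pcompose Q [:s, s:] = R"
    unfolding Q_def R_def by (induction N) (simp_all add: pcompose_mult pcompose_1 del: mult_pCons_left mult_pCons_right)
  have comp: "pcompose ((pderiv ^^ k) Q) [:s, s:] = smult (s ^ k) ((pderiv ^^ k) R)" for k
  proof (induction k)
    case (Suc k)
    have "smult s (pcompose ((pderiv ^^ Suc k) Q) [:s, s:]) = pderiv (pcompose ((pderiv ^^ k) Q) [:s, s:])"
      by (simp add: pderiv_pcompose pderiv_pCons)
    also have "\<dots> = smult (s ^ k) ((pderiv ^^ Suc k) R)" by (simp add: Suc pderiv_smult)
    finally have eq: "smult s (pcompose ((pderiv ^^ Suc k) Q) [:s, s:]) = smult (s ^ k) ((pderiv ^^ Suc k) R)" .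
    have "pcompose ((pderiv ^^ Suc k) Q) [:s, s:] = smult s (smult s (pcompose ((pderiv ^^ Suc k) Q) [:s, s:]))"
      by (simp only: smult_smult s(1) smult_1_left)
    also have "\<dots> = smult (s ^ Suc k) ((pderiv ^^ Suc k) R)"
      by (simp only: eq smult_smult power_Suc)
    finally show ?case .
  qed (simp add: Q)
  have nonneg: "coeff ((pderiv ^^ k) R) i \<ge> 0" for k i
  proof -
    have "coeff R i \<ge> 0" for i
      unfolding R_def
    proof (induction N arbitrary: i)
      case (Suc N)
      have "coeff [:0, 2, 1 :: real:] j \<ge> 0" for j by (simp add: coeff_pCons split: nat.split)
      then show ?case unfolding power_Suc coeff_mult by (intro sum_nonneg mult_nonneg_nonneg Suc)
    qed (simp add: coeff_pCons split: nat.split)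
    then show ?thesis by (induction k arbitrary: i) (auto simp: coeff_pderiv)
  qed
  define P where "P = (pderiv ^^ Suc N) R"
  have "P \<noteq> 0"
  proof
    assume "P = 0"
    have "degree ((pderiv ^^ k) p) = degree p - k" for k and p :: "real poly"
      by (induction k) (simp_all add: degree_pderiv)
    then have "degree ((pderiv ^^ N) R) = N" by (simp add: R_def degree_power_eq)
    then show False using \<open>P = 0\<close> assms(1) by (simp add: P_def pderiv_eq_0_iff)
  qed
  have "poly P y > 0"
    unfolding poly_altdef
  proof (rule sum_pos2[of _ "degree P"])
    have "lead_coeff P \<ge> 0" by (rule nonneg[of "Suc N", folded P_def])
    moreover have "lead_coeff P \<noteq> 0" using \<open>P \<noteq> 0\<close> by simp
    ultimately have "lead_coeff P > 0" by linarith
    then show "coeff P (degree P) * y ^ degree P > 0" using y by simp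
    show "coeff P i * y ^ i \<ge> 0" for i
      using y by (intro mult_nonneg_nonneg zero_le_power nonneg[of "Suc N" i, folded P_def]) simp
  qed auto
  moreover have "poly ((pderiv ^^ Suc N) Q) x = s ^ Suc N * poly P y"
  proof -
    have "poly [:s, s:] y = x" using y(2) by (simp add: mult.commute)
    then have "poly ((pderiv ^^ Suc N) Q) x = poly (pcompose ((pderiv ^^ Suc N) Q) [:s, s:]) y"
      by (simp only: poly_pcompose)
    then show ?thesis by (simp only: comp P_def poly_smult)
  qed
  ultimately have "poly ((pderiv ^^ Suc N) Q) x \<noteq> 0" using s(3) by (simp del: funpow.simps)
  then show ?thesis by (simp add: legendre_def pderiv_smult Q_def)
qed

lemma gll_nodes_bounds:
  assumes N: "N \<ge> 1" and nodes: "gll_nodes N \<xi>"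
  shows "\<And>i. i \<le> N \<Longrightarrow> \<xi> i \<in> {-1..1}" "\<xi> 0 = -1" "\<xi> N = 1" "inj_on \<xi> {..N}"
    "\<And>i. i \<le> N \<Longrightarrow> poly (gll_poly N) (\<xi> i) = 0"
proof -
  have im: "\<xi> ` {..N} = {x. poly (gll_poly N) x = 0}" and mono: "strict_mono_on {..N} \<xi>"
    using nodes by (auto simp: gll_nodes_def gll_poly_def)
  show z: "poly (gll_poly N) (\<xi> i) = 0" if "i \<le> N" for i using im that by blast
  show b: "\<xi> i \<in> {-1..1}" if "i \<le> N" for i
  proof (rule ccontr)
    assume "\<xi> i \<notin> {-1..1}"
    then have "\<bar>\<xi> i\<bar> > 1" by auto
    moreover from this have "\<xi> i * \<xi> i \<noteq> 1" by (auto simp: square_eq_1_iff)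
    moreover have "(1 - \<xi> i * \<xi> i) * poly (pderiv (legendre N)) (\<xi> i) = 0"
      using z[OF that] by (simp add: gll_poly_def algebra_simps)
    ultimately show False
      using legendre_deriv_no_outer_roots[OF N, of "\<xi> i"] by simp
  qed
  have e: "-1 \<in> \<xi> ` {..N}" "1 \<in> \<xi> ` {..N}" unfolding im by (simp_all add: gll_poly_def)
  show "inj_on \<xi> {..N}" using mono by (rule strict_mono_on_imp_inj_on)
  have le: "\<xi> i \<le> \<xi> j" if "i \<le> j" "j \<le> N" for i j
    using mono that by (cases "i = j") (auto simp: strict_mono_on_def less_imp_le)
  obtain k where "k \<le> N" "\<xi> k = -1" using e(1) by auto
  then show "\<xi> 0 = -1" using le[of 0 k] b[of 0] by auto
  obtain k where "k \<le> N" "\<xi> k = 1" using e(2) by auto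
  then show "\<xi> N = 1" using le[of k N] b[of N] by auto
qed

lemma poly_lagrange:
  assumes "inj_on \<xi> {..N}" "i \<le> N" "j \<le> N"
  shows "poly (lagrange N \<xi> i) (\<xi> j) = (if i = j then 1 else 0)"
proof (cases "i = j")
  case True
  have "\<xi> i - \<xi> k \<noteq> 0" if "k \<in> {..N} - {i}" for k
    using assms that by (auto dest: inj_onD)
  then have "(\<Prod>k\<in>{..N} - {i}. poly (smult (1 / (\<xi> i - \<xi> k)) [:- \<xi> k, 1:]) (\<xi> i)) = 1"
    by (intro prod.neutral) (auto simp: diff_divide_distrib[symmetric])
  then show ?thesis using True by (simp only: lagrange_def poly_prod if_True refl)
next
  case False
  then show ?thesis using assms by (auto simp: lagrange_def poly_prod intro!: prod_zero bexI[of _ j])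
qed

lemma degree_lagrange: "i \<le> N \<Longrightarrow> degree (lagrange N \<xi> i) \<le> N"
proof -
  assume i: "i \<le> N"
  have "degree (lagrange N \<xi> i) \<le> (\<Sum>k\<in>{..N} - {i}. degree (smult (1 / (\<xi> i - \<xi> k)) [:- \<xi> k, 1:]))"
    unfolding lagrange_def using degree_prod_sum_le[of "{..N} - {i}" "\<lambda>k. smult (1 / (\<xi> i - \<xi> k)) [:- \<xi> k, 1:]"] by (simp add: o_def)
  also have "\<dots> \<le> (\<Sum>k\<in>{..N} - {i}. 1)" by (intro sum_mono) simp
  also have "\<dots> = N" using i by simp
  finally show ?thesis .
qed

lemma lagrange_interpolation:
  assumes "inj_on \<xi> {..N}" "degree p \<le> N"
  shows "p = (\<Sum>i\<le>N. smult (poly p (\<xi> i)) (lagrange N \<xi> i))"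
proof (rule poly_eqI_degree[where A = "\<xi> ` {..N}"])
  have c: "card (\<xi> ` {..N}) = Suc N" using assms by (simp add: card_image)
  show "card (\<xi> ` {..N}) > degree p" using c assms by simp
  have "degree (\<Sum>i\<le>N. smult (poly p (\<xi> i)) (lagrange N \<xi> i)) \<le> N"
    by (intro degree_sum_le) (auto intro: order_trans[OF degree_smult_le] degree_lagrange)
  then show "card (\<xi> ` {..N}) > degree (\<Sum>i\<le>N. smult (poly p (\<xi> i)) (lagrange N \<xi> i))" using c by simp
  fix x assume "x \<in> \<xi> ` {..N}"
  then obtain j where j: "j \<le> N" "x = \<xi> j" by auto
  show "poly p x = poly (\<Sum>i\<le>N. smult (poly p (\<xi> i)) (lagrange N \<xi> i)) x"
    using j by (simp add: poly_sum poly_lagrange[OF assms(1)] if_distrib[where f="(*) _"] cong: if_cong)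
qed

text \<open>Division with remainder by the nodal polynomial: the remainder is interpolated exactly, and the
  quotient has degree at most \<open>N - 2\<close>, hence is orthogonal to the nodal polynomial.\<close>

lemma gll_quadrature_exact:
  assumes N: "N \<ge> 1" and nodes: "gll_nodes N \<xi>" and p: "degree p \<le> 2 * N - 1"
  shows "ref_integral p = (\<Sum>i\<le>N. gll_weight N \<xi> i * poly p (\<xi> i))"
proof -
  note b = gll_nodes_bounds[OF N nodes] and d = degree_gll_poly[OF N]
  define g r where "g = p div gll_poly N" and "r = p mod gll_poly N"
  have pgr: "p = g * gll_poly N + r" by (simp add: g_def r_def)
  have "degree r \<le> N" using d degree_mod_less'[of "gll_poly N" p] by (cases "r = 0") (auto simp: r_def)
  have "g = 0 \<or> degree g + 2 \<le> N"
  proof (cases "g = 0")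
    case False
    have "degree g + (N + 1) = degree (g * gll_poly N)" using False d by (simp add: degree_mult_eq)
    also have "g * gll_poly N = p - r" by (simp add: pgr)
    also have "degree (p - r) \<le> 2 * N - 1"
      using degree_diff_le[of p "2 * N - 1" r] p \<open>degree r \<le> N\<close> N by simp
    finally have "degree g + (N + 1) \<le> 2 * N - 1" .
    then show ?thesis using N by linarith
  qed simp
  then have "ref_integral p = ref_integral r" using gll_poly_orthogonal[of g N] by (simp add: pgr ref_integral_add)
  also have "\<dots> = (\<Sum>i\<le>N. gll_weight N \<xi> i * poly r (\<xi> i))"
    by (subst lagrange_interpolation[OF b(4) \<open>degree r \<le> N\<close>]) (simp add: ref_integral_sum ref_integral_smult gll_weight_def ref_integral_def[symmetric] mult.commute)
  also have "\<dots> = (\<Sum>i\<le>N. gll_weight N \<xi> i * poly p (\<xi> i))"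
    by (intro sum.cong) (auto simp: pgr b(5))
  finally show ?thesis .
qed

text \<open>The rule is applied to a nonnegative polynomial that vanishes at all other nodes.  The square of a
  Lagrange polynomial has degree \<open>2 N\<close>, one too many.  With \<open>P\<close> the derivative of the Legendre
  polynomial, \<open>(1 \<plusminus> x) P\<^sup>2\<close> serves for the end points and \<open>(1 - x\<^sup>2) (P / (x - \<xi>\<^sub>i))\<^sup>2\<close> for an
  interior node.\<close>

lemma gll_weight_pos:
  assumes N: "N \<ge> 1" and nodes: "gll_nodes N \<xi>" and i: "i \<le> N"
  shows "gll_weight N \<xi> i > 0"
proof -
  note b = gll_nodes_bounds[OF N nodes]
  define P where "P = pderiv (legendre N)"
  have P: "P \<noteq> 0" "degree P = N - 1"
    using N by (auto simp: P_def pderiv_eq_0_iff degree_legendre degree_pderiv)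
  have z: "\<xi> j = 1 \<or> \<xi> j = -1 \<or> poly P (\<xi> j) = 0" if "j \<le> N" for j

  proof -
    have "(1 - \<xi> j * \<xi> j) * poly P (\<xi> j) = 0"
      using b(5)[OF that] by (simp add: gll_poly_def P_def algebra_simps)
    then show ?thesis by (auto simp: square_eq_1_iff)
  qed
  have main: "gll_weight N \<xi> i > 0"
    if f: "f \<noteq> 0" "degree f \<le> 2 * N - 1" "\<And>x. x \<in> {-1..1} \<Longrightarrow> poly f x \<ge> 0"
      and f0: "\<And>j. j \<le> N \<Longrightarrow> j \<noteq> i \<Longrightarrow> poly f (\<xi> j) = 0" for f
  proof -
    have "0 < ref_integral f" using f by (intro ref_integral_pos)
    also have "\<dots> = (\<Sum>j\<le>N. gll_weight N \<xi> j * poly f (\<xi> j))" by (rule gll_quadrature_exact[OF N nodes f(2)])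
    also have "\<dots> = (\<Sum>j\<le>N. if j = i then gll_weight N \<xi> i * poly f (\<xi> i) else 0)" by (intro sum.cong) (auto simp: f0)
    also have "\<dots> = gll_weight N \<xi> i * poly f (\<xi> i)" using i by simp
    finally show ?thesis using f(3)[OF b(1)[OF i]] by (simp add: zero_less_mult_iff)
  qed
  have inj: "\<xi> j \<noteq> \<xi> i" if "j \<le> N" "j \<noteq> i" for j using b(4) i that by (auto dest: inj_onD)
  consider "\<xi> i = 1" | "\<xi> i = -1" | "\<xi> i \<noteq> 1" "\<xi> i \<noteq> -1" "poly P (\<xi> i) = 0" using z[OF i] by blast
  then show ?thesis
  proof cases
    case 1
    show ?thesis
    proof (rule main[of "[:1, 1:] * (P * P)"])
      show "degree ([:1, 1:] * (P * P)) \<le> 2 * N - 1" using P N by (simp add: degree_mult_eq del: mult_pCons_left mult_pCons_right)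
      show "poly ([:1, 1:] * (P * P)) (\<xi> j) = 0" if "j \<le> N" "j \<noteq> i" for j
        using z[OF that(1)] inj[OF that] 1 by auto
      show "[:1, 1:] * (P * P) \<noteq> 0" using P by (simp del: mult_pCons_left mult_pCons_right)
      show "poly ([:1, 1:] * (P * P)) x \<ge> 0" if "x \<in> {-1..1}" for x
        using that by (simp only: poly_mult) auto
    qed
  next
    case 2
    show ?thesis
    proof (rule main[of "[:1, -1:] * (P * P)"])
      show "degree ([:1, -1:] * (P * P)) \<le> 2 * N - 1" using P N by (simp add: degree_mult_eq del: mult_pCons_left mult_pCons_right)
      show "poly ([:1, -1:] * (P * P)) (\<xi> j) = 0" if "j \<le> N" "j \<noteq> i" for j
        using z[OF that(1)] inj[OF that] 2 by auto
      show "[:1, -1:] * (P * P) \<noteq> 0" using P by (simp del: mult_pCons_left mult_pCons_right)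
      show "poly ([:1, -1:] * (P * P)) x \<ge> 0" if "x \<in> {-1..1}" for x
        using that by (simp only: poly_mult) auto
    qed
  next
    case 3
    then obtain s where s: "P = [:- \<xi> i, 1:] * s" by (auto simp: poly_eq_0_iff_dvd elim: dvdE)
    have s0: "s \<noteq> 0" using s P by auto
    have ds: "degree s + 1 = N - 1" using s0 s P(2) by (simp add: degree_mult_eq del: mult_pCons_left)
    show ?thesis
    proof (rule main[of "[:1, 0, -1:] * (s * s)"])
      show "degree ([:1, 0, -1:] * (s * s)) \<le> 2 * N - 1" using s0 ds by (simp add: degree_mult_eq del: mult_pCons_left mult_pCons_right)
      show "poly ([:1, 0, -1:] * (s * s)) (\<xi> j) = 0" if "j \<le> N" "j \<noteq> i" for j
        using z[OF that(1)] inj[OF that] by (auto simp: s)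
      show "poly ([:1, 0, -1:] * (s * s)) x \<ge> 0" if "x \<in> {-1..1}" for x
      proof -
        have "\<bar>x\<bar> \<le> 1" using that by auto
        then have "x * x \<le> 1" by (simp add: abs_square_le_1 power2_eq_square[symmetric])
        then show ?thesis by (simp only: poly_mult) auto
      qed
      show "[:1, 0, -1:] * (s * s) \<noteq> 0" using s0 by (simp del: mult_pCons_left mult_pCons_right)
    qed
  qed
qed

text \<open>Both products have degree at most \<open>2 N - 1\<close>, so quadrature is exact and the sum is the integral of
  the derivative of the product of two Lagrange polynomials.\<close>

theorem gll_summation_by_parts:
  assumes N: "N \<ge> 1" and nodes: "gll_nodes N \<xi>" and ij: "i \<le> N" "j \<le> N"
  shows "gll_weight N \<xi> i * Dmat N \<xi> i j + gll_weight N \<xi> j * Dmat N \<xi> j i = (if i = j then Bdiag N i else 0)"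
proof -
  note b = gll_nodes_bounds[OF N nodes]
  have q: "gll_weight N \<xi> i * Dmat N \<xi> i j = ref_integral (lagrange N \<xi> i * pderiv (lagrange N \<xi> j))" if "i \<le> N" "j \<le> N" for i j
  proof -
    have "degree (lagrange N \<xi> i * pderiv (lagrange N \<xi> j)) \<le> N + (N - 1)"
      using degree_lagrange[OF that(1), of \<xi>] degree_lagrange[OF that(2), of \<xi>]
      by (intro order_trans[OF degree_mult_le]) (simp add: degree_pderiv add_mono diff_le_mono)
    then have "ref_integral (lagrange N \<xi> i * pderiv (lagrange N \<xi> j))
       = (\<Sum>k\<le>N. gll_weight N \<xi> k * poly (lagrange N \<xi> i * pderiv (lagrange N \<xi> j)) (\<xi> k))"
      using N by (intro gll_quadrature_exact[OF N nodes]) simp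
    also have "\<dots> = (\<Sum>k\<le>N. if k = i then gll_weight N \<xi> i * Dmat N \<xi> i j else 0)"
      by (intro sum.cong) (auto simp: poly_lagrange[OF b(4) that(1)] Dmat_def)
    finally show ?thesis using that by simp
  qed
  have "gll_weight N \<xi> i * Dmat N \<xi> i j + gll_weight N \<xi> j * Dmat N \<xi> j i = ref_integral (pderiv (lagrange N \<xi> i * lagrange N \<xi> j))"
    unfolding q[OF ij] q[OF ij(2,1)] pderiv_mult ref_integral_add by (simp add: mult.commute)
  also have "\<dots> = poly (lagrange N \<xi> i) (\<xi> N) * poly (lagrange N \<xi> j) (\<xi> N) - poly (lagrange N \<xi> i) (\<xi> 0) * poly (lagrange N \<xi> j) (\<xi> 0)"
    by (simp add: ref_integral_pderiv b(2,3))
  also have "\<dots> = (if i = j then Bdiag N i else 0)"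
    using N ij by (auto simp: poly_lagrange[OF b(4)] Bdiag_def)
  finally show ?thesis .
qed

lemma pderiv_sum_poly: "pderiv (\<Sum>i\<in>A. f i) = (\<Sum>i\<in>A. pderiv (f i :: real poly))"
  by (induction A rule: infinite_finite_induct) (simp_all add: pderiv_add)

lemma Dmat_row_sum:
  assumes N: "N \<ge> 1" and nodes: "gll_nodes N \<xi>"
  shows "(\<Sum>j\<le>N. Dmat N \<xi> i j) = 0"
proof -
  have "[:1:] = (\<Sum>j\<le>N. lagrange N \<xi> j)"
    using lagrange_interpolation[OF gll_nodes_bounds(4)[OF N nodes], of "[:1:]"] by simp
  then have "pderiv [:1:] = (\<Sum>j\<le>N. pderiv (lagrange N \<xi> j))" by (simp only: pderiv_sum_poly)
  then have "(\<Sum>j\<le>N. pderiv (lagrange N \<xi> j)) = 0" by (simp add: pderiv_pCons)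
  then show ?thesis unfolding Dmat_def by (metis poly_0 poly_sum)
qed

section \<open>Neighbours in a periodic mesh\<close>

lemma periods_diff: "\<sigma> \<in> periods lo hi \<Longrightarrow> \<tau> \<in> periods lo hi \<Longrightarrow> \<sigma> - \<tau> \<in> periods lo hi"
proof -
  assume a: "\<sigma> \<in> periods lo hi" "\<tau> \<in> periods lo hi"
  have "\<exists>k::int. (\<sigma> - \<tau>) $ I = of_int k * (hi $ I - lo $ I)" for I
  proof -
    obtain k l :: int where "\<sigma> $ I = of_int k * (hi $ I - lo $ I)" "\<tau> $ I = of_int l * (hi $ I - lo $ I)"
      using a unfolding periods_def by blast
    then have "(\<sigma> - \<tau>) $ I = of_int (k - l) * (hi $ I - lo $ I)" by (simp add: algebra_simps)
    then show ?thesis by blast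
  qed
  then show ?thesis by (simp add: periods_def)
qed

lemma periods_0: "0 \<in> periods lo hi"
  by (auto simp: periods_def intro: exI[of _ 0])

lemma periods_uminus: "\<tau> \<in> periods lo hi \<Longrightarrow> - \<tau> \<in> periods lo hi"
  using periods_diff[OF periods_0] by fastforce

lemma periodic_mesh_element:
  assumes "periodic_mesh lo hi M" "K \<in> M"
  obtains a b where "K = cbox a b" "\<And>I. a $ I < b $ I" "K \<subseteq> cbox lo hi"
proof -
  have d: "M division_of cbox lo hi" and i: "interior K \<noteq> {}" using assms by (auto simp: periodic_mesh_def)
  obtain a b where K: "K = cbox a b" using division_ofD(4)[OF d assms(2)] by blast
  have "a $ I < b $ I" for I using i unfolding K interior_cbox by (simp add: interval_ne_empty_cart)
  then show ?thesis using that[OF K] division_ofD(2)[OF d assms(2)] by blast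
qed

lemma side_cbox:
  assumes "\<And>I. a $ I < b $ I"
  shows "side (cbox a b) I \<epsilon> = {x \<in> cbox a b. x $ I = (if \<epsilon> = 1 then b $ I else a $ I)}"
proof -
  have "cbox a b \<noteq> {}" using assms by (simp add: interval_ne_empty_cart less_imp_le)
  then have "interval_upperbound (cbox a b) = b" "interval_lowerbound (cbox a b) = a"
    by simp_all
  then show ?thesis by (simp add: side_def)
qed

lemma side_translate:
  assumes "\<And>I. a $ I < b $ I"
  shows "side ((+) \<tau> ` cbox a b) I \<epsilon> = (+) \<tau> ` side (cbox a b) I \<epsilon>"
proof -
  have t: "(+) \<tau> ` cbox a b = cbox (\<tau> + a) (\<tau> + b)" by (simp add: cbox_translation)
  have "side (cbox (\<tau> + a) (\<tau> + b)) I \<epsilon> = {x \<in> cbox (\<tau> + a) (\<tau> + b). x $ I = (if \<epsilon> = 1 then (\<tau> + b) $ I else (\<tau> + a) $ I)}"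
    using assms by (intro side_cbox) simp
  also have "\<dots> = (+) \<tau> ` {x \<in> cbox a b. x $ I = (if \<epsilon> = 1 then b $ I else a $ I)}"
    unfolding t[symmetric] by auto
  finally show ?thesis unfolding t[symmetric] side_cbox[OF assms] .
qed

lemma face_with_interior_point:
  fixes S :: "(real^2) set"
  assumes "F face_of S" "z \<in> F" "z \<in> interior S"
  shows "S \<subseteq> F"
proof -
  have "rel_interior S = interior S" using assms(3) by (intro rel_interior_nonempty_interior) auto
  then show ?thesis using assms by (intro subset_of_face_of[OF assms(1)]) (auto simp: disjnt_def)
qed

text \<open>Conformity makes the overlap a face of both elements; a face with an interior point is
  everything, so the elements agree up to a period.  The period is zero because both lie in the
  fundamental domain and have positive width.\<close>

lemma overlapping_elements_equal:
  assumes mesh: "periodic_mesh lo hi M" and K: "K \<in> M" "K' \<in> M" and \<sigma>: "\<sigma> \<in> periods lo hi"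
    and z: "z \<in> interior K" "z \<in> interior ((+) \<sigma> ` K')"
  shows "K = K'"
proof -
  obtain a b where ab: "K = cbox a b" "\<And>I. a $ I < b $ I" "K \<subseteq> cbox lo hi"
    using periodic_mesh_element[OF mesh K(1)] by blast
  obtain c d where cd: "K' = cbox c d" "\<And>I. c $ I < d $ I" "K' \<subseteq> cbox lo hi"
    using periodic_mesh_element[OF mesh K(2)] by blast
  have F: "(K \<inter> (+) \<sigma> ` K') face_of K" "(K \<inter> (+) \<sigma> ` K') face_of ((+) \<sigma> ` K')"
    using mesh K \<sigma> by (auto simp: periodic_mesh_def)
  have zF: "z \<in> K \<inter> (+) \<sigma> ` K'" using z interior_subset by blast
  have "K = (+) \<sigma> ` K'"
    using face_with_interior_point[OF F(1) zF z(1)] face_with_interior_point[OF F(2) zF z(2)] by auto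
  then have eq: "cbox a b = cbox (\<sigma> + c) (\<sigma> + d)" by (simp add: ab cd cbox_translation)
  have ne: "cbox a b \<noteq> {}" using ab(2) by (simp add: interval_ne_empty_cart less_imp_le)
  then have e: "a = \<sigma> + c" using eq by (metis eq_cbox)
  have "\<sigma> $ I = 0" for I
  proof -
    obtain k :: int where k: "\<sigma> $ I = of_int k * (hi $ I - lo $ I)" using \<sigma> by (auto simp: periods_def)
    have "a \<in> cbox lo hi" "b \<in> cbox lo hi" "c \<in> cbox lo hi" "d \<in> cbox lo hi"
      using ab cd ne by (auto simp: mem_box_cart less_imp_le subset_iff)
    then have h: "lo $ I \<le> a $ I" "b $ I \<le> hi $ I" "lo $ I \<le> c $ I" "d $ I \<le> hi $ I" by (auto simp: mem_box_cart)
    have w: "hi $ I - lo $ I > 0" using h ab(2)[of I] by linarith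
    have "\<bar>\<sigma> $ I\<bar> < hi $ I - lo $ I" using h ab(2)[of I] cd(2)[of I] e by auto
    then have "\<bar>of_int k :: real\<bar> * (hi $ I - lo $ I) < 1 * (hi $ I - lo $ I)" using w unfolding k by (simp add: abs_mult)
    then have "\<bar>of_int k :: real\<bar> < 1" using w by (simp only: mult_less_cancel_right_pos)
    then have "k = 0" by linarith
    then show ?thesis by (simp add: k)
  qed
  then have "\<sigma> = 0" by (simp add: vec_eq_iff)
  then show ?thesis using \<open>K = (+) \<sigma> ` K'\<close> by simp
qed

text \<open>A face of a box that contains a relative interior point \<open>c\<close> of a side contains the side: every point
  \<open>x\<close> of the side is an end point of a segment through \<open>c\<close> that extends slightly beyond \<open>c\<close>.\<close>

lemma side_subset_face:
  assumes ab: "\<And>I. a $ I < b $ I" and F: "F face_of cbox a b" and c: "c \<in> F"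
    and cI: "c $ I = (if \<epsilon> = 1 then b $ I else a $ I)" and cJ: "\<And>J. J \<noteq> I \<Longrightarrow> a $ J < c $ J \<and> c $ J < b $ J"
  shows "side (cbox a b) I \<epsilon> \<subseteq> F"
proof
  fix x assume x: "x \<in> side (cbox a b) I \<epsilon>"
  then have xc: "x \<in> cbox a b" and xI: "x $ I = c $ I" by (auto simp: side_cbox[OF ab] cI)
  show "x \<in> F"
  proof (cases "x = c")
    case False
    have "\<exists>t>0. \<forall>J. a $ J \<le> c $ J + t * (c $ J - x $ J) \<and> c $ J + t * (c $ J - x $ J) \<le> b $ J"
    proof -
      have "\<exists>t>0. \<forall>s. 0 < s \<and> s \<le> t \<longrightarrow> a $ J \<le> c $ J + s * (c $ J - x $ J) \<and> c $ J + s * (c $ J - x $ J) \<le> b $ J" for J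
      proof (cases "J = I")
        case True
        then show ?thesis using xI ab[of I] cI by (intro exI[of _ 1]) auto
      next
        case False
        define m where "m = min (c $ J - a $ J) (b $ J - c $ J)"
        have m: "m > 0" "m \<le> c $ J - a $ J" "m \<le> b $ J - c $ J" using cJ[OF False] by (auto simp: m_def)
        define t where "t = m / (1 + \<bar>c $ J - x $ J\<bar>)"
        have t: "t > 0" using m by (simp add: t_def add_pos_nonneg)
        have "s * \<bar>c $ J - x $ J\<bar> \<le> m" if "0 < s" "s \<le> t" for s
        proof -
          have "s * \<bar>c $ J - x $ J\<bar> \<le> t * (1 + \<bar>c $ J - x $ J\<bar>)" using that by (intro mult_mono) auto
          also have "\<dots> = m" by (simp add: t_def add_nonneg_eq_0_iff)
          finally show ?thesis .
        qed
        then have "\<bar>s * (c $ J - x $ J)\<bar> \<le> m" if "0 < s" "s \<le> t" for s using that by (simp add: abs_mult)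
        then have "a $ J \<le> c $ J + s * (c $ J - x $ J) \<and> c $ J + s * (c $ J - x $ J) \<le> b $ J" if "0 < s" "s \<le> t" for s
          using m that by (smt (verit))
        then show ?thesis using t by blast
      qed
      then obtain t where t: "\<And>J. t J > 0" "\<And>J s. 0 < s \<Longrightarrow> s \<le> t J \<Longrightarrow> a $ J \<le> c $ J + s * (c $ J - x $ J) \<and> c $ J + s * (c $ J - x $ J) \<le> b $ J"
        by metis
      have "Min (range t) > 0" "\<And>J. Min (range t) \<le> t J" using t(1) by auto
      then show ?thesis using t(2) by blast
    qed
    then obtain t where t: "t > 0" "c + t *\<^sub>R (c - x) \<in> cbox a b" by (auto simp: mem_box_cart)
    define y where "y = c + t *\<^sub>R (c - x)"
    have "c \<in> open_segment x y"
      unfolding in_segment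
    proof (intro conjI exI[of _ "1 / (1 + t)"])
      have "y - x = (1 + t) *\<^sub>R (c - x)" by (simp add: y_def algebra_simps)
      then show "x \<noteq> y" using False t by auto
      have "(1 / (1 + t)) *\<^sub>R (y - x) = c - x" using t \<open>y - x = _\<close> by simp
      then show "c = (1 - 1 / (1 + t)) *\<^sub>R x + (1 / (1 + t)) *\<^sub>R y" by (simp add: algebra_simps)
    qed (use t in auto)
    then show ?thesis using F xc t(2) c unfolding face_of_def y_def by blast
  qed (use c in simp)
qed

lemma closure_finite_UN: "finite A \<Longrightarrow> closure (\<Union>i\<in>A. f i) = (\<Union>i\<in>A. closure (f i))"
  by (induction A rule: finite_induct) simp_all

text \<open>Points slightly beyond the midpoint \<open>c\<close> of the side lie, up to a period, in some element that also
  contains \<open>c\<close>.  Its intersection with \<open>K\<close> is a face of both that contains \<open>c\<close> but no interior point of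
  either, which forces it to be a full side of each.\<close>

lemma neighbour_exists:
  assumes mesh: "periodic_mesh lo hi M" and K: "K \<in> M" and \<epsilon>: "\<epsilon> \<in> {1, -1 :: real}"
  shows "\<exists>K' \<tau>. K' \<in> M \<and> \<tau> \<in> periods lo hi \<and> side K I \<epsilon> = (+) \<tau> ` side K' I (- \<epsilon>)"
proof -
  obtain a b where ab: "K = cbox a b" "\<And>I. a $ I < b $ I" "K \<subseteq> cbox lo hi"
    using periodic_mesh_element[OF mesh K] by blast
  have div: "M division_of cbox lo hi" using mesh by (auto simp: periodic_mesh_def)
  have "a \<in> K" "b \<in> K" by (simp_all add: ab(1) mem_box_cart less_imp_le[OF ab(2)])
  then have "a \<in> cbox lo hi" "b \<in> cbox lo hi" using ab(3) by blast+
  then have h: "lo $ J \<le> a $ J" "b $ J \<le> hi $ J" for J by (auto simp: mem_box_cart)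
  define e where "e = (if \<epsilon> = 1 then b $ I else a $ I)"
  define c :: "real^2" where "c = (\<chi> J. if J = I then e else (a $ J + b $ J) / 2)"
  have cI: "c $ I = e" and cJ: "J \<noteq> I \<Longrightarrow> a $ J < c $ J \<and> c $ J < b $ J" for J using ab(2)[of J] by (auto simp: c_def)
  have cK: "c \<in> K"
    unfolding ab(1) mem_box_cart
  proof
    fix J show "a $ J \<le> c $ J \<and> c $ J \<le> b $ J"
      using ab(2)[of J] by (auto simp: c_def e_def)
  qed
  \<comment> \<open>The shift is nonzero only if the side lies on the boundary of the domain.\<close>
  define k :: real where "k = (if \<epsilon> = 1 then if b $ I = hi $ I then 1 else 0 else if a $ I = lo $ I then -1 else 0)"
  define \<tau> :: "real^2" where "\<tau> = axis I (k * (hi $ I - lo $ I))"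
  have \<tau>: "\<tau> \<in> periods lo hi"
  proof -
    obtain l :: int where l: "k = of_int l"
    proof
      show "k = of_int (if \<epsilon> = 1 then if b $ I = hi $ I then 1 else 0 else if a $ I = lo $ I then -1 else 0)"
        by (simp add: k_def)
    qed
    have "\<tau> $ J = of_int (if J = I then l else 0) * (hi $ J - lo $ J)" for J
      by (simp add: \<tau>_def axis_def l)
    then have "\<exists>l::int. \<tau> $ J = of_int l * (hi $ J - lo $ J)" for J by blast
    then show ?thesis by (simp add: periods_def)
  qed
  define d where "d = (if k = 0 then if \<epsilon> = 1 then hi $ I - b $ I else a $ I - lo $ I else hi $ I - lo $ I)"
  have d: "d > 0" using \<epsilon> h[of I] ab(2)[of I] by (auto simp: d_def k_def)
  define y where "y \<delta> = c + (\<epsilon> * \<delta>) *\<^sub>R axis I 1" for \<delta>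
  have yI: "y \<delta> $ I = e + \<epsilon> * \<delta>" and yJ: "J \<noteq> I \<Longrightarrow> y \<delta> $ J = c $ J" for \<delta> J
    by (simp_all add: y_def cI axis_def)
  have ynK: "y \<delta> \<notin> K" if "\<delta> > 0" for \<delta>
  proof
    assume "y \<delta> \<in> K"
    then have "a $ I \<le> y \<delta> $ I" "y \<delta> $ I \<le> b $ I" by (auto simp: ab mem_box_cart)
    then show False using that \<epsilon> by (auto simp: yI e_def)
  qed
  have yM: "y \<delta> - \<tau> \<in> cbox lo hi" if "0 < \<delta>" "\<delta> < d" for \<delta>
    unfolding mem_box_cart
  proof
    fix J
    show "lo $ J \<le> (y \<delta> - \<tau>) $ J \<and> (y \<delta> - \<tau>) $ J \<le> hi $ J"
    proof (cases "J = I")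
      case True
      then show ?thesis using that \<epsilon> h[of I] ab(2)[of I]
        by (auto simp: yI \<tau>_def axis_def k_def d_def e_def split: if_splits)
    next
      case False
      then show ?thesis using yJ[OF False] cJ[OF False] h[of J] by (auto simp: \<tau>_def axis_def)
    qed
  qed
  \<comment> \<open>The points \<open>y \<delta>\<close> accumulate at \<open>c\<close> and are covered by finitely many shifted elements, so one of these contains \<open>c\<close> as well.\<close>
  define S where "S = y ` {0<..<d}"
  have cS: "c \<in> closure S"
  proof -
    have "y ` closure {0<..<d} \<subseteq> closure (y ` {0<..<d})"
      by (intro image_closure_subset[where f = y] closure_subset closed_closure) (auto simp: y_def intro!: continuous_intros)
    moreover have "0 \<in> closure {0<..<d}" using d by simp
    moreover have "y 0 = c" by (simp add: y_def)
    ultimately show ?thesis unfolding S_def by blast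
  qed
  have "S \<subseteq> (\<Union>K'\<in>M. S \<inter> (+) \<tau> ` K')"
  proof
    fix z assume z: "z \<in> S"
    then have "z - \<tau> \<in> \<Union>M" using yM division_ofD(6)[OF div] unfolding S_def by auto
    then obtain K' where "K' \<in> M" "z - \<tau> \<in> K'" by blast
    moreover from this(2) have "z \<in> (+) \<tau> ` K'" by (intro image_eqI[of _ _ "z - \<tau>"]) auto
    ultimately show "z \<in> (\<Union>K'\<in>M. S \<inter> (+) \<tau> ` K')" using z by blast
  qed
  then have "c \<in> closure (\<Union>K'\<in>M. S \<inter> (+) \<tau> ` K')" using cS closure_mono by (metis subsetD)
  then have "c \<in> (\<Union>K'\<in>M. closure (S \<inter> (+) \<tau> ` K'))"
    unfolding closure_finite_UN[OF division_ofD(1)[OF div]] .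
  then obtain K' where K': "K' \<in> M" and cl: "c \<in> closure (S \<inter> (+) \<tau> ` K')" by (elim UN_E)
  obtain a' b' where ab': "K' = cbox a' b'" "\<And>I. a' $ I < b' $ I"
    by (rule periodic_mesh_element[OF mesh K']) (rule that)
  define p r where "p = \<tau> + a'" and "r = \<tau> + b'"
  have P: "(+) \<tau> ` K' = cbox p r" by (simp add: ab' cbox_translation p_def r_def)
  have pr: "p $ J < r $ J" for J using ab'(2) by (simp add: p_def r_def)
  have "closure (S \<inter> (+) \<tau> ` K') \<subseteq> closure (cbox p r)" unfolding P by (rule closure_mono) blast
  then have cP: "c \<in> cbox p r" using cl by (simp add: closure_closed closed_cbox subset_iff)
  have "S \<inter> cbox p r \<noteq> {}" using cl unfolding P by (metis closure_empty empty_iff)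
  then obtain z where "z \<in> S" "z \<in> cbox p r" by blast
  then obtain \<delta> where \<delta>: "0 < \<delta>" "y \<delta> \<in> cbox p r" unfolding S_def by fastforce
  define F where "F = K \<inter> cbox p r"
  have F: "F face_of cbox a b" "F face_of cbox p r"
    using mesh K K' \<tau> unfolding F_def P[symmetric] periodic_mesh_def ab(1)[symmetric] by blast+
  have cF: "c \<in> F" using cK cP by (simp add: F_def)
  have sub1: "side K I \<epsilon> \<subseteq> F"
    unfolding ab(1) by (rule side_subset_face[OF ab(2) F(1) cF]) (use cI cJ e_def in auto)
  have noint: "\<not> cbox p r \<subseteq> F" using \<delta> ynK by (auto simp: F_def)
  have sub2: "F \<subseteq> side K I \<epsilon>"
  proof
    fix x assume x: "x \<in> F"
    show "x \<in> side K I \<epsilon>"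
    proof (rule ccontr)
      assume "x \<notin> side K I \<epsilon>"
      then have xI: "x $ I \<noteq> e" using x by (auto simp: ab(1) side_cbox[OF ab(2)] e_def F_def)
      have xK: "a $ J \<le> x $ J \<and> x $ J \<le> b $ J" for J using x by (auto simp: F_def ab(1) mem_box_cart)
      define z where "z = (1/2) *\<^sub>R c + (1/2) *\<^sub>R x"
      have zF: "z \<in> F"
        using face_of_imp_convex[OF F(1)] convex_box(1)[of a b] cF x unfolding z_def by (intro convexD) (auto intro: face_of_imp_convex)
      have "a $ J < z $ J \<and> z $ J < b $ J" for J
      proof (cases "J = I")
        case True
        then show ?thesis using xI xK[of I] ab(2)[of I] \<epsilon> by (auto simp: z_def cI e_def)
      next
        case False
        then show ?thesis using cJ[OF False] xK[of J] by (auto simp: z_def)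
      qed
      then have zi: "z \<in> interior (cbox a b)" by (simp add: interior_cbox mem_box_cart)
      then have "cbox a b \<subseteq> F" by (rule face_with_interior_point[OF F(1) zF])
      then have "cbox a b \<subseteq> cbox p r" by (auto simp: F_def)
      then have "z \<in> interior (cbox p r)" using interior_mono zi by blast
      then show False using face_with_interior_point[OF F(2) zF] noint by blast
    qed
  qed
  have FK: "F = side K I \<epsilon>" using sub1 sub2 by blast
  have pb: "p $ J \<le> a $ J \<and> b $ J \<le> r $ J" if "J \<noteq> I" for J
  proof -
    define u v :: "real^2" where "u = (\<chi> J. if J = I then e else a $ J)" and "v = (\<chi> J. if J = I then e else b $ J)"
    have "u \<in> side K I \<epsilon>" "v \<in> side K I \<epsilon>"
      using ab(2) unfolding ab(1) side_cbox[OF ab(2)] by (auto simp: u_def v_def e_def mem_box_cart less_imp_le)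
    then have "u \<in> cbox p r" "v \<in> cbox p r" using sub1 by (auto simp: F_def)
    then have "p $ J \<le> u $ J" "v $ J \<le> r $ J" by (auto simp: mem_box_cart)
    then show ?thesis using that by (simp add: u_def v_def)
  qed
  have pc: "J \<noteq> I \<Longrightarrow> p $ J < c $ J \<and> c $ J < r $ J" for J using pb[of J] cJ[of J] by auto
  have pI: "c $ I = (if - \<epsilon> = 1 then r $ I else p $ I)"
  proof (rule ccontr)
    assume neq: "c $ I \<noteq> (if - \<epsilon> = 1 then r $ I else p $ I)"
    have "p $ I \<le> c $ I" "c $ I \<le> r $ I" "p $ I \<le> c $ I + \<epsilon> * \<delta>" "c $ I + \<epsilon> * \<delta> \<le> r $ I"
      using cP \<delta>(2) yI[of \<delta>] cI by (auto simp: mem_box_cart dest!: spec[of _ I])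
    then have "p $ I < c $ I \<and> c $ I < r $ I" using neq \<epsilon> \<delta>(1) by auto
    then have "c \<in> interior (cbox p r)" using pc by (auto simp: interior_cbox mem_box_cart) metis+
    then show False using face_with_interior_point[OF F(2) cF] noint by blast
  qed
  have "side (cbox p r) I (- \<epsilon>) \<subseteq> F"
    by (rule side_subset_face[OF pr F(2) cF pI pc])
  moreover have "F \<subseteq> side (cbox p r) I (- \<epsilon>)"
  proof
    fix x assume x: "x \<in> F"
    then have "x \<in> side (cbox a b) I \<epsilon>" using FK ab(1) by simp
    then have "x $ I = c $ I" unfolding side_cbox[OF ab(2)] cI e_def by simp
    moreover have "x \<in> cbox p r" using x by (simp add: F_def)
    ultimately show "x \<in> side (cbox p r) I (- \<epsilon>)" unfolding side_cbox[OF pr] pI by simp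
  qed
  ultimately have "side K I \<epsilon> = side (cbox p r) I (- \<epsilon>)" using FK by blast
  also have "\<dots> = (+) \<tau> ` side K' I (- \<epsilon>)"
    unfolding P[symmetric] ab'(1) by (rule side_translate[OF ab'(2)])
  finally show ?thesis using K' \<tau> by blast
qed

text \<open>Boxes with a common side and the same outward normal overlap near that side.\<close>

lemma same_side_imp_equal:
  assumes mesh: "periodic_mesh lo hi M" and K: "K \<in> M" "K' \<in> M" and \<sigma>: "\<sigma> \<in> periods lo hi"
    and s: "side K I \<epsilon> = (+) \<sigma> ` side K' I \<epsilon>"
  shows "K = K'"
proof -
  obtain a b where ab: "K = cbox a b" "\<And>I. a $ I < b $ I" using periodic_mesh_element[OF mesh K(1)] by blast
  obtain c d where cd: "K' = cbox c d" "\<And>I. c $ I < d $ I" using periodic_mesh_element[OF mesh K(2)] by blast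
  define p r where "p = \<sigma> + c" and "r = \<sigma> + d"
  have P: "(+) \<sigma> ` K' = cbox p r" by (simp add: cd cbox_translation p_def r_def)
  have pr: "p $ J < r $ J" for J using cd(2) by (simp add: p_def r_def)
  have s: "side (cbox a b) I \<epsilon> = side (cbox p r) I \<epsilon>"
    using s side_translate[OF cd(2), of \<sigma> I \<epsilon>] unfolding ab(1) P[symmetric] cd(1) by simp
  define e where "e = (if \<epsilon> = 1 then b $ I else a $ I)"
  define m :: "real^2" where "m = (\<chi> J. if J = I then e else (a $ J + b $ J) / 2)"
  have m: "m \<in> side (cbox a b) I \<epsilon>"
    using ab(2) by (auto simp: side_cbox[OF ab(2)] m_def e_def mem_box_cart less_imp_le)
  then have eP: "e = (if \<epsilon> = 1 then r $ I else p $ I)" unfolding s by (auto simp: side_cbox[OF pr] m_def)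
  have pb: "p $ J \<le> a $ J \<and> b $ J \<le> r $ J" if "J \<noteq> I" for J
  proof -
    define u v :: "real^2" where "u = (\<chi> J. if J = I then e else a $ J)" and "v = (\<chi> J. if J = I then e else b $ J)"
    have "u \<in> side (cbox a b) I \<epsilon>" "v \<in> side (cbox a b) I \<epsilon>"
      using ab(2) unfolding side_cbox[OF ab(2)] by (auto simp: u_def v_def e_def mem_box_cart less_imp_le)
    then have "u \<in> cbox p r" "v \<in> cbox p r" unfolding s by (auto simp: side_def)
    then have "p $ J \<le> u $ J" "v $ J \<le> r $ J" by (auto simp: mem_box_cart)
    then show ?thesis using that by (simp add: u_def v_def)
  qed
  \<comment> \<open>The point \<open>z\<close> lies half of the smaller width inside both boxes.\<close>
  define w where "w = min (b $ I - a $ I) (r $ I - p $ I) / 2"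
  have w: "w > 0" "w < b $ I - a $ I" "w < r $ I - p $ I" using ab(2)[of I] pr[of I] by (auto simp: w_def min_def)
  define z :: "real^2" where "z = (\<chi> J. if J = I then if \<epsilon> = 1 then e - w else e + w else (a $ J + b $ J) / 2)"
  have "z \<in> interior K"
    unfolding ab(1) interior_cbox using w ab(2) by (auto simp: mem_box_cart z_def e_def)
  moreover have "z \<in> interior (cbox p r)"
  proof -
    have "p $ J < z $ J \<and> z $ J < r $ J" for J
    proof (cases "J = I")
      case True then show ?thesis using w by (auto simp: z_def eP)
    next
      case False then show ?thesis using pb[OF False] ab(2)[of J] by (auto simp: z_def)
    qed
    then show ?thesis by (simp add: interior_cbox mem_box_cart)
  qed
  ultimately show ?thesis using overlapping_elements_equal[OF mesh K \<sigma>, of z] by (simp add: P)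
qed

lemma neighbour_eqI:
  assumes mesh: "periodic_mesh lo hi M" and K': "K' \<in> M" and \<tau>: "\<tau> \<in> periods lo hi"
    and s: "side K I \<epsilon> = (+) \<tau> ` side K' I (- \<epsilon>)"
  shows "neighbour lo hi M K I \<epsilon> = K'"
  unfolding neighbour_def
proof (rule the_equality)
  show "K' \<in> M \<and> (\<exists>\<tau>\<in>periods lo hi. side K I \<epsilon> = (+) \<tau> ` side K' I (- \<epsilon>))" using assms by blast
  fix K'' assume "K'' \<in> M \<and> (\<exists>\<tau>\<in>periods lo hi. side K I \<epsilon> = (+) \<tau> ` side K'' I (- \<epsilon>))"
  then obtain \<tau>' where K'': "K'' \<in> M" "\<tau>' \<in> periods lo hi" "side K I \<epsilon> = (+) \<tau>' ` side K'' I (- \<epsilon>)" by blast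
  have "side K'' I (- \<epsilon>) = (+) (- \<tau>') ` ((+) \<tau>' ` side K'' I (- \<epsilon>))" by (simp add: image_image)
  also have "\<dots> = (+) (\<tau> - \<tau>') ` side K' I (- \<epsilon>)"
    unfolding K''(3)[symmetric] s by (simp add: image_image algebra_simps)
  finally show "K'' = K'" by (rule same_side_imp_equal[OF mesh K''(1) K' periods_diff[OF \<tau> K''(2)]])
qed

lemma side_extent:
  assumes "\<And>I. a $ I < b $ I" "J \<noteq> I"
  shows "(\<lambda>x. x $ J) ` side (cbox a b) I \<epsilon> = {a $ J .. b $ J}"
proof
  show "{a $ J .. b $ J} \<subseteq> (\<lambda>x. x $ J) ` side (cbox a b) I \<epsilon>"
  proof
    fix t assume t: "t \<in> {a $ J .. b $ J}"
    define x :: "real^2" where "x = (\<chi> L. if L = I then if \<epsilon> = 1 then b $ I else a $ I else if L = J then t else a $ L)"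
    have "x \<in> side (cbox a b) I \<epsilon>" using t assms(1) by (auto simp: side_cbox[OF assms(1)] x_def mem_box_cart less_imp_le)
    moreover have "t = x $ J" using assms(2) by (simp add: x_def)
    ultimately show "t \<in> (\<lambda>x. x $ J) ` side (cbox a b) I \<epsilon>" by blast
  qed
qed (auto simp: side_cbox[OF assms(1)] mem_box_cart)

lemma width_cbox:
  assumes "\<And>I. a $ I < b $ I"
  shows "width (cbox a b) I = b $ I - a $ I" "interval_lowerbound (cbox a b) = a"
proof -
  have "cbox a b \<noteq> {}" using assms by (simp add: interval_ne_empty_cart less_imp_le)
  then show "width (cbox a b) I = b $ I - a $ I" "interval_lowerbound (cbox a b) = a"
    by (auto simp: width_def)
qed

theorem neighbour_properties:
  assumes mesh: "periodic_mesh lo hi M" and K: "K \<in> M" and \<epsilon>: "\<epsilon> \<in> {1, -1 :: real}"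
  shows "neighbour lo hi M K I \<epsilon> \<in> M"
    and "neighbour lo hi M (neighbour lo hi M K I \<epsilon>) I (- \<epsilon>) = K"
    and "J \<noteq> I \<Longrightarrow> width (neighbour lo hi M K I \<epsilon>) J = width K J"
proof -
  obtain K' \<tau> where K': "K' \<in> M" "\<tau> \<in> periods lo hi" "side K I \<epsilon> = (+) \<tau> ` side K' I (- \<epsilon>)"
    using neighbour_exists[OF mesh K \<epsilon>] by blast
  have n: "neighbour lo hi M K I \<epsilon> = K'" by (rule neighbour_eqI[OF mesh K'])
  show "neighbour lo hi M K I \<epsilon> \<in> M" using n K' by simp
  have "side K' I (- \<epsilon>) = (+) (- \<tau>) ` side K I (- (- \<epsilon>))" by (simp add: K'(3) image_image)
  then show "neighbour lo hi M (neighbour lo hi M K I \<epsilon>) I (- \<epsilon>) = K"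
    unfolding n by (rule neighbour_eqI[OF mesh K periods_uminus[OF K'(2)]])
  obtain a b where ab: "K = cbox a b" "\<And>I. a $ I < b $ I" using periodic_mesh_element[OF mesh K] by blast
  obtain c d where cd: "K' = cbox c d" "\<And>I. c $ I < d $ I" using periodic_mesh_element[OF mesh K'(1)] by blast
  show "width (neighbour lo hi M K I \<epsilon>) J = width K J" if J: "J \<noteq> I"
  proof -
    have "{a $ J .. b $ J} = (\<lambda>x. x $ J) ` side K I \<epsilon>" using side_extent[OF ab(2) J] ab(1) by simp
    also have "\<dots> = (+) (\<tau> $ J) ` ((\<lambda>x. x $ J) ` side K' I (- \<epsilon>))" by (simp add: K'(3) image_image)
    also have "\<dots> = (+) (\<tau> $ J) ` {c $ J .. d $ J}" using side_extent[OF cd(2) J] cd(1) by simp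
    also have "\<dots> = {\<tau> $ J + c $ J .. \<tau> $ J + d $ J}" by simp
    finally have "a $ J = \<tau> $ J + c $ J" "b $ J = \<tau> $ J + d $ J" using ab(2)[of J] by (auto simp: Icc_eq_Icc)
    then show ?thesis unfolding n by (simp add: ab(1) cd(1) width_cbox[OF ab(2)] width_cbox[OF cd(2)])
  qed
qed

section \<open>Summation by parts for two-point fluxes\<close>

text \<open>The discrete product rule: expanding the product of averages and jumps gives four double sums, of
  which one vanishes by the row sums and two are integrated by parts.\<close>

lemma sbp_scalar_line:
  fixes Q :: "nat \<Rightarrow> nat \<Rightarrow> real"
  assumes Q: "\<And>i m. i \<le> N \<Longrightarrow> m \<le> N \<Longrightarrow> Q i m + Q m i = (if i = m then B i else 0)"
    and row: "\<And>i. i \<le> N \<Longrightarrow> (\<Sum>m\<le>N. Q i m) = 0"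
  shows "(\<Sum>i\<le>N. \<Sum>m\<le>N. Q i m * ((A i + A m) / 2 * (p m - p i)))
     = (\<Sum>i\<le>N. B i * (A i * p i)) - (\<Sum>i\<le>N. p i * (\<Sum>m\<le>N. Q i m * A m))"
proof -
  have diag: "(\<Sum>i\<le>N. \<Sum>m\<le>N. (if i = m then B i else 0) * f i m) = (\<Sum>i\<le>N. B i * f i i)" for f
    by (intro sum.cong) (auto simp: if_distrib[where f="\<lambda>z. z * _"] cong: if_cong)
  have swap: "(\<Sum>i\<le>N. \<Sum>m\<le>N. Q i m * f i m) = (\<Sum>i\<le>N. B i * f i i) - (\<Sum>i\<le>N. \<Sum>m\<le>N. Q i m * f m i)" for f
  proof -
    have "(\<Sum>i\<le>N. \<Sum>m\<le>N. Q i m * f i m) + (\<Sum>i\<le>N. \<Sum>m\<le>N. Q m i * f i m)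
      = (\<Sum>i\<le>N. \<Sum>m\<le>N. (if i = m then B i else 0) * f i m)"
      unfolding sum.distrib[symmetric] distrib_right[symmetric] by (intro sum.cong) (auto simp: Q)
    moreover have "(\<Sum>i\<le>N. \<Sum>m\<le>N. Q m i * f i m) = (\<Sum>i\<le>N. \<Sum>m\<le>N. Q i m * f m i)" by (rule sum.swap)
    ultimately show ?thesis by (simp add: diag)
  qed
  have r0: "(\<Sum>i\<le>N. \<Sum>m\<le>N. Q i m * f i) = 0" for f
    by (simp add: sum_distrib_right[symmetric] row)
  have "(\<Sum>i\<le>N. \<Sum>m\<le>N. Q i m * ((A i + A m) / 2 * (p m - p i)))
    = ((\<Sum>i\<le>N. \<Sum>m\<le>N. Q i m * (A i * p m)) - (\<Sum>i\<le>N. \<Sum>m\<le>N. Q i m * (A i * p i))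
       + (\<Sum>i\<le>N. \<Sum>m\<le>N. Q i m * (A m * p m)) - (\<Sum>i\<le>N. \<Sum>m\<le>N. Q i m * (A m * p i))) / 2"
    by (simp add: sum.distrib[symmetric] sum_subtractf[symmetric] sum_divide_distrib[symmetric] field_simps)
  also have "\<dots> = (\<Sum>i\<le>N. B i * (A i * p i)) - (\<Sum>i\<le>N. \<Sum>m\<le>N. Q i m * (A m * p i))"
    using swap[of "\<lambda>i m. A i * p m"] swap[of "\<lambda>i m. A m * p m"] r0[of "\<lambda>i. A i * p i"] by simp
  finally show ?thesis by (simp add: sum_distrib_left mult_ac)
qed

text \<open>Integrating half of the flux differences by parts produces jumps of \<open>V\<close>, which the two-point
  relations convert into jumps of the potentials; \<open>sbp_scalar_line\<close> evaluates those.\<close>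

theorem sbp_flux_line:
  fixes V :: "nat \<Rightarrow> real^4" and F :: "2 \<Rightarrow> nat \<Rightarrow> nat \<Rightarrow> real^4"
  assumes N: "N \<ge> 1" and nodes: "gll_nodes N \<xi>"
    and H: "\<And>i m. i \<le> N \<Longrightarrow> m \<le> N \<Longrightarrow> H i m = (\<Sum>a\<in>UNIV. ((A a i + A a m) / 2) *\<^sub>R F a i m) - ((C i + C m) / 2) *\<^sub>R S i m"
    and sym: "\<And>a i m. i \<le> N \<Longrightarrow> m \<le> N \<Longrightarrow> F a i m = F a m i" "\<And>i m. i \<le> N \<Longrightarrow> m \<le> N \<Longrightarrow> S i m = S m i"
    and VF: "\<And>a i m. i \<le> N \<Longrightarrow> m \<le> N \<Longrightarrow> (V m - V i) \<bullet> F a i m = \<psi> a m - \<psi> a i"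
    and VS: "\<And>i m. i \<le> N \<Longrightarrow> m \<le> N \<Longrightarrow> (V m - V i) \<bullet> S i m = \<phi> m - \<phi> i"
  defines "\<omega> \<equiv> gll_weight N \<xi>"
  shows "(\<Sum>i\<le>N. \<omega> i * (V i \<bullet> (2 *\<^sub>R (\<Sum>m\<le>N. Dmat N \<xi> i m *\<^sub>R H i m))))
     = (\<Sum>i\<le>N. Bdiag N i * (V i \<bullet> H i i - ((\<Sum>a\<in>UNIV. A a i * \<psi> a i) - C i * \<phi> i)))
       + (\<Sum>i\<le>N. \<omega> i * ((\<Sum>a\<in>UNIV. \<psi> a i * (\<Sum>m\<le>N. Dmat N \<xi> i m * A a m)) - \<phi> i * (\<Sum>m\<le>N. Dmat N \<xi> i m * C m)))"
proof -
  define Q where "Q i m = \<omega> i * Dmat N \<xi> i m" for i m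
  have Q: "Q i m + Q m i = (if i = m then Bdiag N i else 0)" if "i \<le> N" "m \<le> N" for i m
    unfolding Q_def \<omega>_def by (rule gll_summation_by_parts[OF N nodes that])
  have row: "(\<Sum>m\<le>N. Q i m) = 0" for i
    unfolding Q_def sum_distrib_left[symmetric] Dmat_row_sum[OF N nodes] by simp
  have line: "(\<Sum>i\<le>N. \<Sum>m\<le>N. Q i m * ((A i + A m) / 2 * (p m - p i)))
     = (\<Sum>i\<le>N. Bdiag N i * (A i * p i)) - (\<Sum>i\<le>N. p i * (\<Sum>m\<le>N. Q i m * A m))" for A p
    by (rule sbp_scalar_line[OF Q row])
  have Hsym: "H i m = H m i" if "i \<le> N" "m \<le> N" for i m
    using sym that by (simp add: H add.commute)
  have jump: "(V m - V i) \<bullet> H i m = (\<Sum>a\<in>UNIV. (A a i + A a m) / 2 * (\<psi> a m - \<psi> a i)) - (C i + C m) / 2 * (\<phi> m - \<phi> i)"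
    if "i \<le> N" "m \<le> N" for i m
    unfolding H[OF that] inner_diff_right inner_sum_right inner_scaleR_right VF[OF that] VS[OF that] ..
  have "(\<Sum>i\<le>N. \<Sum>m\<le>N. Q i m * (V m \<bullet> H i m)) = (\<Sum>i\<le>N. \<Sum>m\<le>N. Q m i * (V i \<bullet> H i m))"
    by (subst sum.swap) (intro sum.cong refl, simp add: Hsym)
  also have "\<dots> = (\<Sum>i\<le>N. \<Sum>m\<le>N. ((if i = m then Bdiag N i else 0) - Q i m) * (V i \<bullet> H i m))"
    by (intro sum.cong refl) (simp add: Q[symmetric])
  also have "\<dots> = (\<Sum>i\<le>N. Bdiag N i * (V i \<bullet> H i i)) - (\<Sum>i\<le>N. \<Sum>m\<le>N. Q i m * (V i \<bullet> H i m))"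
    unfolding left_diff_distrib sum_subtractf
    by (simp add: if_distrib[where f="\<lambda>z. z * _"] cong: if_cong)
  finally have sw: "(\<Sum>i\<le>N. \<Sum>m\<le>N. Q i m * (V m \<bullet> H i m))
     = (\<Sum>i\<le>N. Bdiag N i * (V i \<bullet> H i i)) - (\<Sum>i\<le>N. \<Sum>m\<le>N. Q i m * (V i \<bullet> H i m))" .
  have "(\<Sum>i\<le>N. \<omega> i * (V i \<bullet> (2 *\<^sub>R (\<Sum>m\<le>N. Dmat N \<xi> i m *\<^sub>R H i m)))) = 2 * (\<Sum>i\<le>N. \<Sum>m\<le>N. Q i m * (V i \<bullet> H i m))"
    by (simp add: Q_def inner_sum_right sum_distrib_left mult_ac)
  also have "\<dots> = (\<Sum>i\<le>N. Bdiag N i * (V i \<bullet> H i i)) - (\<Sum>i\<le>N. \<Sum>m\<le>N. Q i m * ((V m - V i) \<bullet> H i m))"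
    unfolding inner_diff_left right_diff_distrib sum_subtractf sw by simp
  also have "(\<Sum>i\<le>N. \<Sum>m\<le>N. Q i m * ((V m - V i) \<bullet> H i m))
     = (\<Sum>a\<in>UNIV. \<Sum>i\<le>N. \<Sum>m\<le>N. Q i m * ((A a i + A a m) / 2 * (\<psi> a m - \<psi> a i))) - (\<Sum>i\<le>N. \<Sum>m\<le>N. Q i m * ((C i + C m) / 2 * (\<phi> m - \<phi> i)))"
    by (simp add: jump sum_2 distrib_left right_diff_distrib sum.distrib sum_subtractf)
  also have "\<dots> = (\<Sum>a\<in>UNIV. (\<Sum>i\<le>N. Bdiag N i * (A a i * \<psi> a i)) - (\<Sum>i\<le>N. \<psi> a i * (\<Sum>m\<le>N. Q i m * A a m)))
     - ((\<Sum>i\<le>N. Bdiag N i * (C i * \<phi> i)) - (\<Sum>i\<le>N. \<phi> i * (\<Sum>m\<le>N. Q i m * C m)))"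
    unfolding line ..
  finally show ?thesis
    by (simp add: sum_2 Q_def distrib_left right_diff_distrib sum.distrib sum_subtractf sum_distrib_left mult_ac)
qed

lemma sum_Bdiag: "N \<ge> 1 \<Longrightarrow> (\<Sum>i\<le>N. Bdiag N i * f i) = f N - f 0"
proof -
  assume N: "N \<ge> 1"
  have "(\<Sum>i\<le>N. Bdiag N i * f i) = (\<Sum>i\<le>N. (if i = N then f N else 0) - (if i = 0 then f 0 else 0))"
    using N by (intro sum.cong) (auto simp: Bdiag_def)
  then show ?thesis by (simp add: sum_subtractf)
qed

section \<open>Entropy dissipation at an interface\<close>

lemma llf_reverse: "llf \<Gamma> G \<omega> (- n) Wp Wm = - llf \<Gamma> G \<omega> n Wm Wp"
proof -
  have "A *v (- n) = - (A *v n)" for A :: "real^2^2" by (simp add: vec_eq_iff matrix_vector_mult_def sum_negf)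
  then have c: "causal_speed G (- n) = causal_speed G n" by (simp add: causal_speed_def)
  show ?thesis unfolding llf_def Let_def c by (simp add: sum_negf algebra_simps)
qed

definition flux_potential :: "geom \<Rightarrow> real \<Rightarrow> 2 \<Rightarrow> prim \<Rightarrow> real" where
  "flux_potential G \<omega> I q = (\<Sum>a\<in>UNIV. \<omega> * Ageo G a I * (dens q * vel q $ a)) - \<omega> * Cgeo G I * dens q"

text \<open>Dividing by \<open>w j\<^sub>2\<close> reduces the interface flux to flat space with the direction
  \<open>e\<^sub>a = \<Theta>\<^sub>a\<^sub>I / \<surd>\<gamma>\<^sup>I\<^sup>I\<close>, which has length one because \<open>\<Theta>\<^sup>T \<Theta> = \<gamma>\<^sup>-\<^sup>1\<close>.\<close>

theorem llf_entropy_dissipative: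
  assumes Gam: "1 < \<Gamma>" "\<Gamma> \<le> 2" and G: "geom_ok G" and \<omega>: "\<omega> > 0"
    and adm: "admissible \<Gamma> (Wm /\<^sub>R (\<omega> * j2 G))" "admissible \<Gamma> (Wp /\<^sub>R (\<omega> * j2 G))"
  defines "q \<equiv> prim_of \<Gamma> (Wm /\<^sub>R (\<omega> * j2 G))" and "q' \<equiv> prim_of \<Gamma> (Wp /\<^sub>R (\<omega> * j2 G))"
  shows "(entropy_var \<Gamma> q' - entropy_var \<Gamma> q) \<bullet> llf \<Gamma> G \<omega> (axis I 1) Wm Wp \<le> flux_potential G \<omega> I q' - flux_potential G \<omega> I q"
proof -
  define c where "c = \<omega> * j2 G"
  have c: "c > 0" using \<omega> j2_eq(2)[OF G] by (simp add: c_def)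
  have q: "prim_ok q" "cons \<Gamma> q = Wm /\<^sub>R c" "prim_ok q'" "cons \<Gamma> q' = Wp /\<^sub>R c"
    using prim_of_admissible[OF Gam adm(1)] prim_of_admissible[OF Gam adm(2)] by (simp_all add: q_def q'_def c_def)
  have W: "Wm = c *\<^sub>R cons \<Gamma> q" "Wp = c *\<^sub>R cons \<Gamma> q'" using q c by simp_all
  define g where "g = sqrt (axis I 1 \<bullet> (matrix_inv (metric G) *v axis I 1))"
  have gII: "axis I 1 \<bullet> (matrix_inv (metric G) *v axis I 1) = (Theta G $ 1 $ I)\<^sup>2 + (Theta G $ 2 $ I)\<^sup>2"
    unfolding Theta_explicit(2)[OF G, symmetric]
    using exhaust_2[of I] by (auto simp: inner_real2 matrix_vector_mult_def matrix_matrix_mult_def transpose_def sum_2 axis_def power2_eq_square)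
  have "(Theta G $ 1 $ I)\<^sup>2 + (Theta G $ 2 $ I)\<^sup>2 > 0"
  proof -
    have "metric G $ 2 $ 2 > 0" "j2 G > 0" using G j2_eq(2)[OF G] by (auto simp: geom_ok_iff)
    then have "Theta G $ 1 $ 1 > 0" "Theta G $ 2 $ 2 > 0" by (auto simp: Theta_explicit(1)[OF G])
    then show ?thesis using exhaust_2[of I] by (auto intro: add_pos_nonneg add_nonneg_pos)
  qed
  then have g: "g > 0" "g\<^sup>2 = (Theta G $ 1 $ I)\<^sup>2 + (Theta G $ 2 $ I)\<^sup>2" by (auto simp: g_def gII)
  define e :: "real^2" where "e = (\<chi> a. Theta G $ a $ I / g)"
  have "(norm e)\<^sup>2 = ((Theta G $ 1 $ I)\<^sup>2 + (Theta G $ 2 $ I)\<^sup>2) / g\<^sup>2"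
    unfolding norm_real2_sq by (simp add: e_def power_divide add_divide_distrib)
  then have "(norm e)\<^sup>2 = 1" unfolding g(2)[symmetric] using g(1) by simp
  then have e: "norm e \<le> 1" by (intro power2_le_imp_le[of "norm e" 1]) simp_all
  define l where "l = lapse G * g"
  have l: "l \<ge> 0" using g G by (simp add: l_def geom_ok_iff)
  have A: "\<omega> * Ageo G a I = c * (l * e $ a)" for a using g by (simp add: Ageo_def c_def l_def e_def)
  have C: "\<omega> * Cgeo G I = c * shift G $ I" by (simp add: Cgeo_def c_def)
  have speed: "causal_speed G (axis I 1) = \<bar>shift G $ I\<bar> + l"
    by (simp add: causal_speed_def l_def g_def inner_axis)
  have ax: "(\<Sum>J\<in>UNIV. (axis I 1 :: real^2) $ J *\<^sub>R f J) = f I" for f :: "2 \<Rightarrow> real^4"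
    using exhaust_2[of I] by (auto simp: sum_2 axis_def)
  define Hf where "Hf r = l *\<^sub>R (\<Sum>a\<in>UNIV. e $ a *\<^sub>R phys_flux \<Gamma> a r) - (shift G $ I) *\<^sub>R cons \<Gamma> r" for r
  have f: "flux \<Gamma> G \<omega> I (W /\<^sub>R c) = c *\<^sub>R Hf (prim_of \<Gamma> (W /\<^sub>R c))" if "cons \<Gamma> (prim_of \<Gamma> (W /\<^sub>R c)) = W /\<^sub>R c" for W
    unfolding flux_def A C Hf_def that by (simp add: scaleR_diff_right scaleR_sum_right)
  have "llf \<Gamma> G \<omega> (axis I 1) Wm Wp = c *\<^sub>R ((1/2) *\<^sub>R (Hf q + Hf q') - ((\<bar>shift G $ I\<bar> + l) / 2) *\<^sub>R (cons \<Gamma> q' - cons \<Gamma> q))"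
  proof -
    have 1: "flux \<Gamma> G \<omega> I (Wm /\<^sub>R c) = c *\<^sub>R Hf q" using f[of Wm] q(2) by (simp add: q_def c_def)
    have 2: "flux \<Gamma> G \<omega> I (Wp /\<^sub>R c) = c *\<^sub>R Hf q'" using f[of Wp] q(4) by (simp add: q'_def c_def)
    have "Wp - Wm = c *\<^sub>R (cons \<Gamma> q' - cons \<Gamma> q)" unfolding W scaleR_diff_right ..
    then show ?thesis unfolding llf_def Let_def ax speed c_def[symmetric] 1 2
      by (simp add: scaleR_diff_right scaleR_add_right mult.commute)
  qed
  then have "(entropy_var \<Gamma> q' - entropy_var \<Gamma> q) \<bullet> llf \<Gamma> G \<omega> (axis I 1) Wm Wp
    = c * ((entropy_var \<Gamma> q' - entropy_var \<Gamma> q) \<bullet> ((1/2) *\<^sub>R (Hf q + Hf q') - ((\<bar>shift G $ I\<bar> + l) / 2) *\<^sub>R (cons \<Gamma> q' - cons \<Gamma> q)))"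
    by (simp only: inner_scaleR_right)
  also have "\<dots> \<le> c * (dens q' * (l * (e \<bullet> vel q') - shift G $ I) - dens q * (l * (e \<bullet> vel q) - shift G $ I))"
    unfolding Hf_def using c by (intro mult_left_mono lax_friedrichs_dissipative[OF Gam q(1,3) e l]) simp
  also have "\<dots> = flux_potential G \<omega> I q' - flux_potential G \<omega> I q"
    unfolding flux_potential_def A C by (simp add: inner_real2 sum_2 algebra_simps)
  finally show ?thesis .
qed

section \<open>Discrete balance laws\<close>

text \<open>The discretisation at one instant: no time derivative occurs.\<close>

locale nodal_state =
  fixes \<Gamma> :: real
    and Us :: "real^4 \<Rightarrow> real^4 \<Rightarrow> real^4"
    and Fec :: "2 \<Rightarrow> real^4 \<Rightarrow> real^4 \<Rightarrow> real^4"
    and N :: nat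
    and \<xi> :: "nat \<Rightarrow> real"
    and lo hi :: "real^2"
    and M :: "(real^2) set set"
    and geo :: "(real^2) set \<Rightarrow> real^2 \<Rightarrow> geom"
    and wt :: "(real^2) set \<Rightarrow> real^2 \<Rightarrow> real"
    and W :: "(real^2) set \<Rightarrow> nat \<Rightarrow> nat \<Rightarrow> real^4"
  assumes Gam: "1 < \<Gamma>" "\<Gamma> \<le> 2"
    and ec: "ec_pair \<Gamma> Us Fec"
    and N: "N \<ge> 1" and nodes: "gll_nodes N \<xi>"
    and mesh: "periodic_mesh lo hi M"
    and geom_nodes: "\<And>K i j. K \<in> M \<Longrightarrow> i \<le> N \<Longrightarrow> j \<le> N \<Longrightarrow> geom_ok (Gn \<xi> geo K i j)"
    and geo_sv: "face_single_valued lo hi M N \<xi> geo" and wt_sv: "face_single_valued lo hi M N \<xi> wt"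
    and wt_pos: "\<And>K i j. K \<in> M \<Longrightarrow> i \<le> N \<Longrightarrow> j \<le> N \<Longrightarrow> wn \<xi> wt K i j > 0"
    and adm: "\<And>K i j. K \<in> M \<Longrightarrow> i \<le> N \<Longrightarrow> j \<le> N \<Longrightarrow> admissible \<Gamma> (Ust \<xi> geo wt W K i j)"
begin

abbreviation "\<omega> \<equiv> gll_weight N \<xi>"
abbreviation "geom_at_node \<equiv> Gn \<xi> geo"
abbreviation "wt_at_node \<equiv> wn \<xi> wt"
abbreviation "U \<equiv> Ust \<xi> geo wt W"
abbreviation "q K i j \<equiv> prim_of \<Gamma> (U K i j)"
abbreviation "Hnum \<equiv> Hllf \<Gamma> N \<xi> lo hi M geo wt W"

lemma q_ok: "K \<in> M \<Longrightarrow> i \<le> N \<Longrightarrow> j \<le> N \<Longrightarrow> prim_ok (q K i j)"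
  using prim_of_admissible(1)[OF Gam adm] .

lemma two_point_properties:
  assumes "admissible \<Gamma> u" "admissible \<Gamma> u'"
  shows "Us u u' = Us u' u" "Us u u = u" "Fec a u u' = Fec a u' u" "Fec a u u = phys_flux \<Gamma> a (prim_of \<Gamma> u)"
    "(entropy_var \<Gamma> (prim_of \<Gamma> u') - entropy_var \<Gamma> (prim_of \<Gamma> u)) \<bullet> Us u u' = dens (prim_of \<Gamma> u') - dens (prim_of \<Gamma> u)"
    "(entropy_var \<Gamma> (prim_of \<Gamma> u') - entropy_var \<Gamma> (prim_of \<Gamma> u)) \<bullet> Fec a u u'
       = dens (prim_of \<Gamma> u') * vel (prim_of \<Gamma> u') $ a - dens (prim_of \<Gamma> u) * vel (prim_of \<Gamma> u) $ a"
  using ec assms unfolding ec_pair_def Let_def by blast+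

lemma Hec_diagonal:
  assumes "K \<in> M" "i \<le> N" "j \<le> N"
  shows "Hec Us Fec \<xi> geo wt W K I (i, j) (i, j) = Hn \<Gamma> \<xi> geo wt W K I i j"
  using two_point_properties(2,4)[OF adm[OF assms] adm[OF assms]] by (simp add: Hec_def Hn_def flux_def)

text \<open>The potential of the full flux \<open>w A\<^sub>a\<^sub>I F\<^sup>a - w C\<^sub>I U\<close>.\<close>

definition tested_potential ::
  "(2 \<Rightarrow> (real^2) set \<Rightarrow> nat \<Rightarrow> nat \<Rightarrow> real) \<Rightarrow> ((real^2) set \<Rightarrow> nat \<Rightarrow> nat \<Rightarrow> real) \<Rightarrow> 2 \<Rightarrow> (real^2) set \<Rightarrow> nat \<Rightarrow> nat \<Rightarrow> real" where
  "tested_potential \<psi> \<phi> I K i j = (\<Sum>a\<in>UNIV. wt_at_node K i j * Ageo (geom_at_node K i j) a I * \<psi> a K i j)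
      - wt_at_node K i j * Cgeo (geom_at_node K i j) I * \<phi> K i j"

text \<open>A nodal field \<open>V\<close> with potentials \<open>\<psi>\<close>, \<open>\<phi>\<close> against which the scheme can be tested.  Besides the two-point
  relations it is required that the discrete source does exactly the work that remains from the
  volume terms.  Entropy and mass are two instances.\<close>

definition entropy_test ::
  "((real^2) set \<Rightarrow> nat \<Rightarrow> nat \<Rightarrow> real^4) \<Rightarrow> (2 \<Rightarrow> (real^2) set \<Rightarrow> nat \<Rightarrow> nat \<Rightarrow> real) \<Rightarrow> ((real^2) set \<Rightarrow> nat \<Rightarrow> nat \<Rightarrow> real) \<Rightarrow> bool" where
  "entropy_test V \<psi> \<phi> \<longleftrightarrow> (\<forall>K\<in>M. \<forall>i\<le>N. \<forall>j\<le>N.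
     (\<forall>k\<le>N. \<forall>l\<le>N. (V K k l - V K i j) \<bullet> Us (U K i j) (U K k l) = \<phi> K k l - \<phi> K i j \<and>
        (\<forall>a. (V K k l - V K i j) \<bullet> Fec a (U K i j) (U K k l) = \<psi> a K k l - \<psi> a K i j)) \<and>
     V K i j \<bullet> Sh \<Gamma> N \<xi> geo wt W K i j = (\<Sum>I\<in>UNIV. kap K I *
        ((\<Sum>a\<in>UNIV. \<psi> a K i j * Dop N \<xi> I (\<lambda>k l. wt_at_node K k l * Ageo (geom_at_node K k l) a I) i j)
         - \<phi> K i j * Dop N \<xi> I (\<lambda>k l. wt_at_node K k l * Cgeo (geom_at_node K k l) I) i j)))"

definition scheme_at :: "((real^2) set \<Rightarrow> nat \<Rightarrow> nat \<Rightarrow> real^4) \<Rightarrow> bool" where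
  "scheme_at Wd \<longleftrightarrow> (\<forall>K\<in>M. \<forall>i\<le>N. \<forall>j\<le>N. Wd K i j
        + (2 * kap K 1) *\<^sub>R (\<Sum>m\<le>N. Dmat N \<xi> i m *\<^sub>R Hec Us Fec \<xi> geo wt W K 1 (i, j) (m, j))
        + (2 * kap K 2) *\<^sub>R (\<Sum>m\<le>N. Dmat N \<xi> j m *\<^sub>R Hec Us Fec \<xi> geo wt W K 2 (i, j) (i, m))
        + (kap K 1 * Bdiag N i / gll_weight N \<xi> i) *\<^sub>R (Hnum K 1 i j - Hn \<Gamma> \<xi> geo wt W K 1 i j)
        + (kap K 2 * Bdiag N j / gll_weight N \<xi> j) *\<^sub>R (Hnum K 2 i j - Hn \<Gamma> \<xi> geo wt W K 2 i j)
        = Sh \<Gamma> N \<xi> geo wt W K i j)"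

text \<open>Along each grid line the volume terms cancel against the source by \<open>sbp_flux_line\<close>, and the
  penalty term replaces the physical by the numerical boundary flux.\<close>

lemma element_balance:
  assumes test: "entropy_test V \<psi> \<phi>" and sch: "scheme_at Wd" and K: "K \<in> M"
  defines "g \<equiv> \<lambda>I i j. tested_potential \<psi> \<phi> I K i j - V K i j \<bullet> Hnum K I i j"
  shows "(\<Sum>i\<le>N. \<Sum>j\<le>N. \<omega> i * \<omega> j * (V K i j \<bullet> Wd K i j))
     = kap K 1 * (\<Sum>j\<le>N. \<omega> j * (g 1 N j - g 1 0 j)) + kap K 2 * (\<Sum>i\<le>N. \<omega> i * (g 2 i N - g 2 i 0))"
proof -
  define h1 where "h1 i j = 2 *\<^sub>R (\<Sum>m\<le>N. Dmat N \<xi> i m *\<^sub>R Hec Us Fec \<xi> geo wt W K 1 (i, j) (m, j))" for i j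
  define h2 where "h2 i j = 2 *\<^sub>R (\<Sum>m\<le>N. Dmat N \<xi> j m *\<^sub>R Hec Us Fec \<xi> geo wt W K 2 (i, j) (i, m))" for i j
  define H where "H = Hn \<Gamma> \<xi> geo wt W K"
  define s where "s I i j = (\<Sum>a\<in>UNIV. \<psi> a K i j * Dop N \<xi> I (\<lambda>k l. wt_at_node K k l * Ageo (geom_at_node K k l) a I) i j)
         - \<phi> K i j * Dop N \<xi> I (\<lambda>k l. wt_at_node K k l * Cgeo (geom_at_node K k l) I) i j" for I i j
  define x1 where "x1 i j = s 1 i j - V K i j \<bullet> h1 i j - Bdiag N i / \<omega> i * (V K i j \<bullet> (Hnum K 1 i j - H 1 i j))" for i j
  define x2 where "x2 i j = s 2 i j - V K i j \<bullet> h2 i j - Bdiag N j / \<omega> j * (V K i j \<bullet> (Hnum K 2 i j - H 2 i j))" for i j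
  have \<omega>: "i \<le> N \<Longrightarrow> \<omega> i \<noteq> 0" for i using gll_weight_pos[OF N nodes, of i] by simp
  have nodal: "V K i j \<bullet> Wd K i j = kap K 1 * x1 i j + kap K 2 * x2 i j" if "i \<le> N" "j \<le> N" for i j
  proof -
    have "Wd K i j = Sh \<Gamma> N \<xi> geo wt W K i j - kap K 1 *\<^sub>R h1 i j - kap K 2 *\<^sub>R h2 i j
       - (kap K 1 * (Bdiag N i / \<omega> i)) *\<^sub>R (Hnum K 1 i j - H 1 i j) - (kap K 2 * (Bdiag N j / \<omega> j)) *\<^sub>R (Hnum K 2 i j - H 2 i j)"
      using sch K that unfolding scheme_at_def h1_def h2_def H_def by (simp add: algebra_simps)
    moreover have "V K i j \<bullet> Sh \<Gamma> N \<xi> geo wt W K i j = kap K 1 * s 1 i j + kap K 2 * s 2 i j"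
      using test K that unfolding entropy_test_def s_def by (simp add: sum_2)
    ultimately show ?thesis
      by (simp only: inner_diff_right inner_scaleR_right x1_def x2_def) (simp add: algebra_simps)
  qed
  have two_neq_one: "(2::2) \<noteq> 1" by simp
  have 1: "(\<Sum>i\<le>N. \<omega> i * x1 i j) = g 1 N j - g 1 0 j" if j: "j \<le> N" for j
  proof -
    have "(\<Sum>i\<le>N. \<omega> i * (V K i j \<bullet> h1 i j))
       = (\<Sum>i\<le>N. Bdiag N i * (V K i j \<bullet> H 1 i j - tested_potential \<psi> \<phi> 1 K i j)) + (\<Sum>i\<le>N. \<omega> i * s 1 i j)"
    proof -
      have "(\<Sum>i\<le>N. \<omega> i * (V K i j \<bullet> h1 i j))
       = (\<Sum>i\<le>N. Bdiag N i * (V K i j \<bullet> Hec Us Fec \<xi> geo wt W K 1 (i, j) (i, j) - tested_potential \<psi> \<phi> 1 K i j)) + (\<Sum>i\<le>N. \<omega> i * s 1 i j)"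
        unfolding h1_def s_def tested_potential_def Dop_def if_P[OF refl]
        by (rule sbp_flux_line[OF N nodes, where F = "\<lambda>a i m. Fec a (U K i j) (U K m j)" and S = "\<lambda>i m. Us (U K i j) (U K m j)"])
          (use test K j two_point_properties(1,3) adm in \<open>auto simp: Hec_def entropy_test_def\<close>)
      also have "(\<Sum>i\<le>N. Bdiag N i * (V K i j \<bullet> Hec Us Fec \<xi> geo wt W K 1 (i, j) (i, j) - tested_potential \<psi> \<phi> 1 K i j))
         = (\<Sum>i\<le>N. Bdiag N i * (V K i j \<bullet> H 1 i j - tested_potential \<psi> \<phi> 1 K i j))"
        unfolding H_def by (intro sum.cong) (auto simp: Hec_diagonal[OF K _ j])
      finally show ?thesis .
    qed
    moreover have "(\<Sum>i\<le>N. \<omega> i * (Bdiag N i / \<omega> i * (V K i j \<bullet> (Hnum K 1 i j - H 1 i j))))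
       = (\<Sum>i\<le>N. Bdiag N i * (V K i j \<bullet> (Hnum K 1 i j - H 1 i j)))"
      by (intro sum.cong) (auto simp: \<omega>)
    ultimately have "(\<Sum>i\<le>N. \<omega> i * x1 i j) = (\<Sum>i\<le>N. Bdiag N i * g 1 i j)"
      unfolding x1_def g_def by (simp add: right_diff_distrib sum_subtractf inner_diff_right)
    then show ?thesis by (simp add: sum_Bdiag[OF N])
  qed
  have 2: "(\<Sum>j\<le>N. \<omega> j * x2 i j) = g 2 i N - g 2 i 0" if i: "i \<le> N" for i
  proof -
    have "(\<Sum>j\<le>N. \<omega> j * (V K i j \<bullet> h2 i j))
       = (\<Sum>j\<le>N. Bdiag N j * (V K i j \<bullet> H 2 i j - tested_potential \<psi> \<phi> 2 K i j)) + (\<Sum>j\<le>N. \<omega> j * s 2 i j)"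
    proof -
      have "(\<Sum>j\<le>N. \<omega> j * (V K i j \<bullet> h2 i j))
       = (\<Sum>j\<le>N. Bdiag N j * (V K i j \<bullet> Hec Us Fec \<xi> geo wt W K 2 (i, j) (i, j) - tested_potential \<psi> \<phi> 2 K i j)) + (\<Sum>j\<le>N. \<omega> j * s 2 i j)"
        unfolding h2_def s_def tested_potential_def Dop_def if_not_P[OF two_neq_one]
        by (rule sbp_flux_line[OF N nodes, where F = "\<lambda>a j m. Fec a (U K i j) (U K i m)" and S = "\<lambda>j m. Us (U K i j) (U K i m)"])
          (use test K i two_point_properties(1,3) adm in \<open>auto simp: Hec_def entropy_test_def\<close>)
      also have "(\<Sum>j\<le>N. Bdiag N j * (V K i j \<bullet> Hec Us Fec \<xi> geo wt W K 2 (i, j) (i, j) - tested_potential \<psi> \<phi> 2 K i j))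
         = (\<Sum>j\<le>N. Bdiag N j * (V K i j \<bullet> H 2 i j - tested_potential \<psi> \<phi> 2 K i j))"
        unfolding H_def by (intro sum.cong) (auto simp: Hec_diagonal[OF K i])
      finally show ?thesis .
    qed
    moreover have "(\<Sum>j\<le>N. \<omega> j * (Bdiag N j / \<omega> j * (V K i j \<bullet> (Hnum K 2 i j - H 2 i j))))
       = (\<Sum>j\<le>N. Bdiag N j * (V K i j \<bullet> (Hnum K 2 i j - H 2 i j)))"
      by (intro sum.cong) (auto simp: \<omega>)
    ultimately have "(\<Sum>j\<le>N. \<omega> j * x2 i j) = (\<Sum>j\<le>N. Bdiag N j * g 2 i j)"
      unfolding x2_def g_def by (simp add: right_diff_distrib sum_subtractf inner_diff_right)
    then show ?thesis by (simp add: sum_Bdiag[OF N])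
  qed
  have "(\<Sum>i\<le>N. \<Sum>j\<le>N. \<omega> i * \<omega> j * (V K i j \<bullet> Wd K i j))
    = (\<Sum>i\<le>N. \<Sum>j\<le>N. \<omega> i * \<omega> j * (kap K 1 * x1 i j + kap K 2 * x2 i j))"
    by (intro sum.cong) (auto simp: nodal)
  also have "\<dots> = kap K 1 * (\<Sum>i\<le>N. \<Sum>j\<le>N. \<omega> j * (\<omega> i * x1 i j)) + kap K 2 * (\<Sum>i\<le>N. \<Sum>j\<le>N. \<omega> i * (\<omega> j * x2 i j))"
    by (simp add: sum_distrib_left sum.distrib[symmetric] algebra_simps)
  also have "(\<Sum>i\<le>N. \<Sum>j\<le>N. \<omega> j * (\<omega> i * x1 i j)) = (\<Sum>j\<le>N. \<omega> j * (g 1 N j - g 1 0 j))"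
    by (subst sum.swap) (simp add: sum_distrib_left[symmetric] 1)
  also have "(\<Sum>i\<le>N. \<Sum>j\<le>N. \<omega> i * (\<omega> j * x2 i j)) = (\<Sum>i\<le>N. \<omega> i * (g 2 i N - g 2 i 0))"
    by (simp add: sum_distrib_left[symmetric] 2)
  finally show ?thesis .
qed

abbreviation "right I K \<equiv> neighbour lo hi M K I 1"

lemma right_facts:
  assumes "K \<in> M"
  shows "right I K \<in> M" "neighbour lo hi M (right I K) I (-1) = K" "J \<noteq> I \<Longrightarrow> width (right I K) J = width K J"
  using neighbour_properties[OF mesh assms, of 1] by simp_all

text \<open>Passing to the right neighbour permutes the elements and preserves the transverse width.\<close>

lemma sum_over_right:
  assumes "J \<noteq> I"
  shows "(\<Sum>K\<in>M. width K J * f (right I K)) = (\<Sum>K\<in>M. width K J * (f K :: real))"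
proof (rule sum.reindex_bij_witness[where i = "\<lambda>K. neighbour lo hi M K I (-1)" and j = "right I"])
  fix K assume K: "K \<in> M"
  show "neighbour lo hi M (right I K) I (-1) = K" "right I K \<in> M" using right_facts[OF K] by auto
  show "neighbour lo hi M K I (-1) \<in> M" "right I (neighbour lo hi M K I (-1)) = K"
    using neighbour_properties[OF mesh K, of "-1"] by simp_all
  show "width (right I K) J * f (right I K) = width K J * f (right I K)" using right_facts(3)[OF K assms] by simp
qed

text \<open>Both elements see the same geometry and, up to the sign of the normal, the same interface flux, so
  the flux is single-valued.\<close>

lemma face_match:
  assumes K: "K \<in> M" and ij: "i \<le> N" "j \<le> N" and on: "(if I = 1 then i else j) = N"
  defines "i' \<equiv> ext_i N I i" and "j' \<equiv> ext_j N I j"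
  shows "geom_at_node (right I K) i' j' = geom_at_node K i j" "wt_at_node (right I K) i' j' = wt_at_node K i j"
    "i' \<le> N" "j' \<le> N"
    "Hnum K I i j = llf \<Gamma> (geom_at_node K i j) (wt_at_node K i j) (axis I 1) (W K i j) (W (right I K) i' j')"
    "Hnum (right I K) I i' j' = Hnum K I i j"
proof -
  have sg: "side_sgn N I i j = 1" using on by (simp add: side_sgn_def)
  have os: "on_side N I i j" using on by (simp add: on_side_def)
  show G: "geom_at_node (right I K) i' j' = geom_at_node K i j"
    using geo_sv K ij os sg unfolding face_single_valued_def Let_def Gn_def i'_def j'_def by metis
  show w: "wt_at_node (right I K) i' j' = wt_at_node K i j"
    using wt_sv K ij os sg unfolding face_single_valued_def Let_def wn_def i'_def j'_def by metis
  show "i' \<le> N" "j' \<le> N" using ij by (auto simp: i'_def j'_def ext_i_def ext_j_def)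
  have sg': "side_sgn N I i' j' = -1"
    using on N by (auto simp: side_sgn_def i'_def j'_def ext_i_def ext_j_def split: if_splits)
  have invol: "ext_i N I i' = i" "ext_j N I j' = j"
    using ij by (auto simp: i'_def j'_def ext_i_def ext_j_def)
  show H: "Hnum K I i j = llf \<Gamma> (geom_at_node K i j) (wt_at_node K i j) (axis I 1) (W K i j) (W (right I K) i' j')"
    by (simp add: Hllf_def sg i'_def j'_def)
  show "Hnum (right I K) I i' j' = Hnum K I i j"
    unfolding H by (simp add: Hllf_def sg' invol right_facts(2)[OF K] G w llf_reverse)
qed

text \<open>The face term of the left side of each element is attributed to its left neighbour, where the two
  one-sided contributions combine into a jump.\<close>

theorem global_balance:
  assumes test: "entropy_test V \<psi> \<phi>" and sch: "scheme_at Wd"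
  defines "face \<equiv> \<lambda>I K i j. let K' = right I K; i' = ext_i N I i; j' = ext_j N I j in
     (V K' i' j' - V K i j) \<bullet> llf \<Gamma> (geom_at_node K i j) (wt_at_node K i j) (axis I 1) (W K i j) (W K' i' j')
      - (tested_potential \<psi> \<phi> I K' i' j' - tested_potential \<psi> \<phi> I K i j)"
  shows "mesh_integral N \<xi> M (\<lambda>K i j. V K i j \<bullet> Wd K i j)
    = (\<Sum>K\<in>M. width K 2 / 2 * (\<Sum>j\<le>N. \<omega> j * face 1 K N j)) + (\<Sum>K\<in>M. width K 1 / 2 * (\<Sum>i\<le>N. \<omega> i * face 2 K i N))"
proof -
  define g where "g = (\<lambda>I K i j. tested_potential \<psi> \<phi> I K i j - V K i j \<bullet> Hnum K I i j)"
  have wpos: "width K I > 0" if K: "K \<in> M" for K I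
  proof -
    obtain a b where "K = cbox a b" "\<And>I. a $ I < b $ I" using periodic_mesh_element[OF mesh K] by blast
    then show ?thesis using width_cbox(1)[of a b I] by simp
  qed
  have face: "face I K i j = g I K i j - g I (right I K) (ext_i N I i) (ext_j N I j)"
    if "K \<in> M" "i \<le> N" "j \<le> N" "(if I = 1 then i else j) = N" for I K i j
    unfolding face_def g_def Let_def face_match(6)[OF that] face_match(5)[OF that, symmetric]
    by (simp add: inner_diff_left)
  have "mesh_integral N \<xi> M (\<lambda>K i j. V K i j \<bullet> Wd K i j)
     = (\<Sum>K\<in>M. jac K * (kap K 1 * (\<Sum>j\<le>N. \<omega> j * (g 1 K N j - g 1 K 0 j)) + kap K 2 * (\<Sum>i\<le>N. \<omega> i * (g 2 K i N - g 2 K i 0))))"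
    unfolding mesh_integral_def g_def by (intro sum.cong refl) (simp add: element_balance[OF test sch])
  also have "\<dots> = (\<Sum>K\<in>M. width K 2 / 2 * (\<Sum>j\<le>N. \<omega> j * (g 1 K N j - g 1 K 0 j))
      + width K 1 / 2 * (\<Sum>i\<le>N. \<omega> i * (g 2 K i N - g 2 K i 0)))"
  proof (intro sum.cong refl)
    fix K assume "K \<in> M"
    then have "jac K * kap K 1 = width K 2 / 2" "jac K * kap K 2 = width K 1 / 2"
      using wpos[of K 1] wpos[of K 2] by (simp_all add: jac_def kap_def)
    then show "jac K * (kap K 1 * (\<Sum>j\<le>N. \<omega> j * (g 1 K N j - g 1 K 0 j)) + kap K 2 * (\<Sum>i\<le>N. \<omega> i * (g 2 K i N - g 2 K i 0)))
       = width K 2 / 2 * (\<Sum>j\<le>N. \<omega> j * (g 1 K N j - g 1 K 0 j)) + width K 1 / 2 * (\<Sum>i\<le>N. \<omega> i * (g 2 K i N - g 2 K i 0))"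
      by (simp only: distrib_left mult.assoc[symmetric])
  qed
  also have "\<dots> = (\<Sum>K\<in>M. width K 2 * (\<Sum>j\<le>N. \<omega> j * g 1 K N j)) / 2 - (\<Sum>K\<in>M. width K 2 * (\<Sum>j\<le>N. \<omega> j * g 1 K 0 j)) / 2
     + ((\<Sum>K\<in>M. width K 1 * (\<Sum>i\<le>N. \<omega> i * g 2 K i N)) / 2 - (\<Sum>K\<in>M. width K 1 * (\<Sum>i\<le>N. \<omega> i * g 2 K i 0)) / 2)"
    by (simp add: right_diff_distrib sum_subtractf sum.distrib sum_divide_distrib diff_divide_distrib)
  also have "\<dots> = (\<Sum>K\<in>M. width K 2 * (\<Sum>j\<le>N. \<omega> j * g 1 K N j)) / 2 - (\<Sum>K\<in>M. width K 2 * (\<Sum>j\<le>N. \<omega> j * g 1 (right 1 K) 0 j)) / 2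
     + ((\<Sum>K\<in>M. width K 1 * (\<Sum>i\<le>N. \<omega> i * g 2 K i N)) / 2 - (\<Sum>K\<in>M. width K 1 * (\<Sum>i\<le>N. \<omega> i * g 2 (right 2 K) i 0)) / 2)"
    using sum_over_right[of 2 1 "\<lambda>K. \<Sum>j\<le>N. \<omega> j * g 1 K 0 j"] sum_over_right[of 1 2 "\<lambda>K. \<Sum>i\<le>N. \<omega> i * g 2 K i 0"] by simp
  also have "\<dots> = (\<Sum>K\<in>M. width K 2 / 2 * (\<Sum>j\<le>N. \<omega> j * (g 1 K N j - g 1 (right 1 K) 0 j)))
      + (\<Sum>K\<in>M. width K 1 / 2 * (\<Sum>i\<le>N. \<omega> i * (g 2 K i N - g 2 (right 2 K) i 0)))"
    by (simp add: right_diff_distrib sum_subtractf sum_divide_distrib)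
  also have "\<dots> = (\<Sum>K\<in>M. width K 2 / 2 * (\<Sum>j\<le>N. \<omega> j * face 1 K N j)) + (\<Sum>K\<in>M. width K 1 / 2 * (\<Sum>i\<le>N. \<omega> i * face 2 K i N))"
    by (intro arg_cong2[of _ _ _ _ "(+)"] sum.cong refl arg_cong2[of _ _ _ _ "(*)"]) (auto simp: face ext_i_def ext_j_def)
  finally show ?thesis .
qed

text \<open>The derivative of \<open>Ageo G 2 1\<close> that appears on the right is zero, as this entry vanishes at
  every node.\<close>

lemma Sh_inner:
  assumes B: "\<And>I. v \<bullet> bj (source_coeffs \<Gamma> (q K i j) (geom_at_node K i j)) I = 0"
    "\<And>I. v \<bullet> Rw \<Gamma> (q K i j) (geom_at_node K i j) I = 0"
    and A: "\<And>I a J. (a, J) \<in> upper_idx \<Longrightarrow> v \<bullet> bA (source_coeffs \<Gamma> (q K i j) (geom_at_node K i j)) I a J = \<psi> a * kron I J"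
    and C: "\<And>I J. v \<bullet> bC (source_coeffs \<Gamma> (q K i j) (geom_at_node K i j)) I J = - \<phi> * kron I J"
    and K: "K \<in> M" and ij: "i \<le> N" "j \<le> N"
  shows "v \<bullet> Sh \<Gamma> N \<xi> geo wt W K i j = (\<Sum>I\<in>UNIV. kap K I *
        ((\<Sum>a\<in>UNIV. \<psi> a * Dop N \<xi> I (\<lambda>k l. wt_at_node K k l * Ageo (geom_at_node K k l) a I) i j)
         - \<phi> * Dop N \<xi> I (\<lambda>k l. wt_at_node K k l * Cgeo (geom_at_node K k l) I) i j))"
proof -
  have z: "Dop N \<xi> 1 (\<lambda>k l. wt_at_node K k l * Ageo (geom_at_node K k l) 2 1) i j = 0"
    unfolding Dop_def using geom_nodes[OF K _ ij(2)] by (simp add: Ageo_explicit)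
  have A': "v \<bullet> bA (source_coeffs \<Gamma> (q K i j) (geom_at_node K i j)) I 1 1 = \<psi> 1 * kron I 1"
     "v \<bullet> bA (source_coeffs \<Gamma> (q K i j) (geom_at_node K i j)) I 1 2 = \<psi> 1 * kron I 2"
     "v \<bullet> bA (source_coeffs \<Gamma> (q K i j) (geom_at_node K i j)) I 2 2 = \<psi> 2 * kron I 2" for I
    using A by (auto simp: upper_idx_def)
  show ?thesis
    unfolding Sh_def Let_def sum_upper_idx sum_2 inner_add_right inner_scaleR_right B A' C
    by (simp add: kron_def z algebra_simps)
qed

lemma entropy_is_test:
  "entropy_test (\<lambda>K i j. entropy_var \<Gamma> (q K i j)) (\<lambda>a K i j. dens (q K i j) * vel (q K i j) $ a) (\<lambda>K i j. dens (q K i j))"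
  unfolding entropy_test_def
proof (intro ballI allI impI conjI)
  fix K i j assume n: "K \<in> M" "i \<le> N" "j \<le> N"
  show "entropy_var \<Gamma> (q K i j) \<bullet> Sh \<Gamma> N \<xi> geo wt W K i j = (\<Sum>I\<in>UNIV. kap K I *
        ((\<Sum>a\<in>UNIV. dens (q K i j) * vel (q K i j) $ a * Dop N \<xi> I (\<lambda>k l. wt_at_node K k l * Ageo (geom_at_node K k l) a I) i j)
         - dens (q K i j) * Dop N \<xi> I (\<lambda>k l. wt_at_node K k l * Cgeo (geom_at_node K k l) I) i j))"
    by (rule Sh_inner[OF _ _ _ _ n]) (use source_coeffs_entropy[OF geom_nodes[OF n] q_ok[OF n]] in auto)
  fix k l a assume m: "k \<le> N" "l \<le> N"
  show "(entropy_var \<Gamma> (q K k l) - entropy_var \<Gamma> (q K i j)) \<bullet> Us (U K i j) (U K k l) = dens (q K k l) - dens (q K i j)"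
    "(entropy_var \<Gamma> (q K k l) - entropy_var \<Gamma> (q K i j)) \<bullet> Fec a (U K i j) (U K k l)
      = dens (q K k l) * vel (q K k l) $ a - dens (q K i j) * vel (q K i j) $ a"
    using two_point_properties(5,6)[OF adm[OF n] adm[OF n(1) m]] by auto
qed

lemma density_is_test: "entropy_test (\<lambda>K i j. axis 1 1) (\<lambda>a K i j. 0) (\<lambda>K i j. 0)"
  unfolding entropy_test_def
proof (intro ballI allI impI conjI)
  fix K i j assume n: "K \<in> M" "i \<le> N" "j \<le> N"
  show "axis 1 1 \<bullet> Sh \<Gamma> N \<xi> geo wt W K i j = (\<Sum>I\<in>UNIV. kap K I *
        ((\<Sum>a\<in>UNIV. 0 * Dop N \<xi> I (\<lambda>k l. wt_at_node K k l * Ageo (geom_at_node K k l) a I) i j)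
         - 0 * Dop N \<xi> I (\<lambda>k l. wt_at_node K k l * Cgeo (geom_at_node K k l) I) i j))"
    by (rule Sh_inner[OF _ _ _ _ n]) (use source_coeffs_density[OF geom_nodes[OF n]] in \<open>auto simp: inner_axis'\<close>)
qed auto

text \<open>By \<open>global_balance\<close> only the jumps at faces contribute, and \<open>llf_entropy_dissipative\<close> gives them
  a sign.\<close>

theorem entropy_rate:
  assumes "scheme_at Wd"
  shows "mesh_integral N \<xi> M (\<lambda>K i j. entropy_var \<Gamma> (q K i j) \<bullet> Wd K i j) \<le> 0"
proof -
  have face: "(entropy_var \<Gamma> (q K' i' j') - entropy_var \<Gamma> (q K i j))
        \<bullet> llf \<Gamma> (geom_at_node K i j) (wt_at_node K i j) (axis I 1) (W K i j) (W K' i' j')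
      - (tested_potential (\<lambda>a K i j. dens (q K i j) * vel (q K i j) $ a) (\<lambda>K i j. dens (q K i j)) I K' i' j'
         - tested_potential (\<lambda>a K i j. dens (q K i j) * vel (q K i j) $ a) (\<lambda>K i j. dens (q K i j)) I K i j) \<le> 0"
    if n: "K \<in> M" "i \<le> N" "j \<le> N" "(if I = 1 then i else j) = N" and K': "K' = right I K" "i' = ext_i N I i" "j' = ext_j N I j"
    for I K i j K' i' j'
  proof -
    note f = face_match[OF n, folded K']
    have K'M: "K' \<in> M" using right_facts(1)[OF n(1)] K' by simp
    have UK: "U K i j = W K i j /\<^sub>R (wt_at_node K i j * j2 (geom_at_node K i j))" by (rule Ust_def)
    have UK': "U K' i' j' = W K' i' j' /\<^sub>R (wt_at_node K i j * j2 (geom_at_node K i j))" by (simp only: Ust_def f(1,2))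
    have "(entropy_var \<Gamma> (q K' i' j') - entropy_var \<Gamma> (q K i j))
        \<bullet> llf \<Gamma> (geom_at_node K i j) (wt_at_node K i j) (axis I 1) (W K i j) (W K' i' j')
       \<le> flux_potential (geom_at_node K i j) (wt_at_node K i j) I (q K' i' j') - flux_potential (geom_at_node K i j) (wt_at_node K i j) I (q K i j)"
      by (rule llf_entropy_dissipative[OF Gam geom_nodes[OF n(1-3)] wt_pos[OF n(1-3)], of "W K i j" "W K' i' j'" I,
            folded UK UK', OF adm[OF n(1-3)] adm[OF K'M f(3,4)]])
    then show ?thesis by (simp add: tested_potential_def flux_potential_def f(1,2))
  qed
  have wpos: "width K I \<ge> 0" if K: "K \<in> M" for K I
  proof -
    obtain a b where ab: "K = cbox a b" "\<And>I. a $ I < b $ I" using periodic_mesh_element[OF mesh K] by blast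
    then show ?thesis using width_cbox(1)[of a b I] less_imp_le[OF ab(2)[of I]] by simp
  qed
  have wp: "i \<le> N \<Longrightarrow> \<omega> i \<ge> 0" for i using gll_weight_pos[OF N nodes, of i] by simp
  show ?thesis
    unfolding global_balance[OF entropy_is_test assms] Let_def
    by (intro add_nonpos_nonpos sum_nonpos mult_nonneg_nonpos face refl) (auto intro: wpos wp)
qed

text \<open>The test field is constant and its potentials are zero, so the jumps in \<open>global_balance\<close> vanish.\<close>

theorem mass_rate:
  assumes "scheme_at Wd"
  shows "mesh_integral N \<xi> M (\<lambda>K i j. Wd K i j $ 1) = 0"
  using global_balance[OF density_is_test assms] by (simp add: inner_axis' tested_potential_def)

end

section \<open>Entropy stability and conservation of mass\<close>

lemma node_in_element:
  assumes mesh: "periodic_mesh lo hi M" and K: "K \<in> M" and N: "N \<ge> 1" and nodes: "gll_nodes N \<xi>"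
    and ij: "i \<le> N" "j \<le> N"
  shows "node \<xi> K i j \<in> K"
proof -
  obtain a b where ab: "K = cbox a b" "\<And>I. a $ I < b $ I" using periodic_mesh_element[OF mesh K] by blast
  have "a $ I \<le> node \<xi> K i j $ I \<and> node \<xi> K i j $ I \<le> b $ I" for I
  proof -
    define s where "s = ((if I = 1 then \<xi> i else \<xi> j) + 1) / 2"
    have s: "0 \<le> s" "s \<le> 1" using gll_nodes_bounds(1)[OF N nodes ij(1)] gll_nodes_bounds(1)[OF N nodes ij(2)] by (auto simp: s_def)
    have "node \<xi> K i j $ I = a $ I + (b $ I - a $ I) * s"
      by (simp add: node_def ab(1) width_cbox[OF ab(2)] s_def)
    moreover have "0 \<le> (b $ I - a $ I) * s" "(b $ I - a $ I) * s \<le> (b $ I - a $ I) * 1"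
      using s ab(2)[of I] by (auto intro!: mult_left_mono)
    ultimately show ?thesis by simp
  qed
  then show ?thesis by (simp add: ab(1) mem_box_cart)
qed

theorem theorem3p4:
  fixes \<Gamma> :: real
    and Us :: "real^4 \<Rightarrow> real^4 \<Rightarrow> real^4"
    and Fec :: "2 \<Rightarrow> real^4 \<Rightarrow> real^4 \<Rightarrow> real^4"
    and N :: nat
    and \<xi> :: "nat \<Rightarrow> real"
    and lo hi :: "real^2"
    and M :: "(real^2) set set"
    and geo :: "(real^2) set \<Rightarrow> real^2 \<Rightarrow> geom"
    and wt :: "(real^2) set \<Rightarrow> real^2 \<Rightarrow> real"
    and T :: "real set"
    and W :: "real \<Rightarrow> (real^2) set \<Rightarrow> nat \<Rightarrow> nat \<Rightarrow> real^4"
  assumes "1 < \<Gamma>" "\<Gamma> \<le> 2"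
    and "ec_pair \<Gamma> Us Fec"
    and "N \<ge> 1" "gll_nodes N \<xi>"
    and "periodic_mesh lo hi M"
    and "\<And>K. K \<in> M \<Longrightarrow> smooth_geom_on K (geo K)"
    and "\<And>K. K \<in> M \<Longrightarrow> smooth_on K (wt K)"
    and "face_single_valued lo hi M N \<xi> geo" "face_single_valued lo hi M N \<xi> wt"
    and "\<And>K i j. K \<in> M \<Longrightarrow> i \<le> N \<Longrightarrow> j \<le> N \<Longrightarrow> wt K (node \<xi> K i j) > 0"
    and "is_interval T"
    and "\<And>t K i j. t \<in> T \<Longrightarrow> K \<in> M \<Longrightarrow> i \<le> N \<Longrightarrow> j \<le> N \<Longrightarrow>
           admissible \<Gamma> (Ust \<xi> geo wt (W t) K i j)"
    and "semidiscrete \<Gamma> Us Fec N \<xi> lo hi M geo wt T W"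
  shows "(\<forall>t\<in>T. \<exists>d. ((\<lambda>s. total_entropy \<Gamma> N \<xi> M geo wt (W s)) has_real_derivative d)
                     (at t within T) \<and> d \<le> 0)
       \<and> (\<lambda>s. total_mass \<Gamma> N \<xi> M geo wt (W s)) constant_on T"
proof -
  note Gam = assms(1,2) and N = assms(4) and nodes = assms(5) and mesh = assms(6) and adm = assms(13)
  define c where "c K i j = wn \<xi> wt K i j * j2 (Gn \<xi> geo K i j)" for K i j
  have geom: "geom_ok (Gn \<xi> geo K i j)" and w: "wn \<xi> wt K i j > 0" if "K \<in> M" "i \<le> N" "j \<le> N" for K i j
    using assms(7)[OF that(1)] assms(11)[OF that] node_in_element[OF mesh that(1) N nodes that(2,3)]
    by (auto simp: smooth_geom_on_def Gn_def wn_def)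
  have c: "c K i j > 0" if "K \<in> M" "i \<le> N" "j \<le> N" for K i j
    using geom[OF that] w[OF that] j2_eq(2) by (simp add: c_def)
  have U: "Ust \<xi> geo wt V K i j = V K i j /\<^sub>R c K i j" for V K i j by (simp only: Ust_def c_def)
  have st: "nodal_state \<Gamma> Us Fec N \<xi> lo hi M geo wt (W t)" if "t \<in> T" for t
    using assms geom w that by unfold_locales auto
  have "\<forall>t\<in>T. \<exists>Wd. (\<forall>K\<in>M. \<forall>i\<le>N. \<forall>j\<le>N. ((\<lambda>s. W s K i j) has_vector_derivative Wd K i j) (at t within T))
        \<and> nodal_state.scheme_at \<Gamma> Us Fec N \<xi> lo hi M geo wt (W t) Wd"
  proof
    fix t assume t: "t \<in> T"
    define P where "P K i j Wdot \<longleftrightarrow> ((\<lambda>s. W s K i j) has_vector_derivative Wdot) (at t within T) \<and>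
        Wdot
        + (2 * kap K 1) *\<^sub>R (\<Sum>m\<le>N. Dmat N \<xi> i m *\<^sub>R Hec Us Fec \<xi> geo wt (W t) K 1 (i, j) (m, j))
        + (2 * kap K 2) *\<^sub>R (\<Sum>m\<le>N. Dmat N \<xi> j m *\<^sub>R Hec Us Fec \<xi> geo wt (W t) K 2 (i, j) (i, m))
        + (kap K 1 * Bdiag N i / gll_weight N \<xi> i) *\<^sub>R (Hllf \<Gamma> N \<xi> lo hi M geo wt (W t) K 1 i j - Hn \<Gamma> \<xi> geo wt (W t) K 1 i j)
        + (kap K 2 * Bdiag N j / gll_weight N \<xi> j) *\<^sub>R (Hllf \<Gamma> N \<xi> lo hi M geo wt (W t) K 2 i j - Hn \<Gamma> \<xi> geo wt (W t) K 2 i j)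
        = Sh \<Gamma> N \<xi> geo wt (W t) K i j" for K i j Wdot
    have "\<exists>Wdot. P K i j Wdot" if "K \<in> M" "i \<le> N" "j \<le> N" for K i j
      using assms(14) t that unfolding semidiscrete_def P_def by blast
    then obtain Wd where "\<And>K i j. K \<in> M \<Longrightarrow> i \<le> N \<Longrightarrow> j \<le> N \<Longrightarrow> P K i j (Wd K i j)" by metis
    then show "\<exists>Wd. (\<forall>K\<in>M. \<forall>i\<le>N. \<forall>j\<le>N. ((\<lambda>s. W s K i j) has_vector_derivative Wd K i j) (at t within T))
        \<and> nodal_state.scheme_at \<Gamma> Us Fec N \<xi> lo hi M geo wt (W t) Wd"
      unfolding nodal_state.scheme_at_def[OF st[OF t]] P_def by blast
  qed
  then obtain Wd where Wd: "\<And>t K i j. t \<in> T \<Longrightarrow> K \<in> M \<Longrightarrow> i \<le> N \<Longrightarrow> j \<le> N \<Longrightarrow> ((\<lambda>s. W s K i j) has_vector_derivative Wd t K i j) (at t within T)"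
    and sch: "\<And>t. t \<in> T \<Longrightarrow> nodal_state.scheme_at \<Gamma> Us Fec N \<xi> lo hi M geo wt (W t) (Wd t)"
    unfolding bchoice_iff by blast
  have lift: "((\<lambda>s. mesh_integral N \<xi> M (\<lambda>K i j. f s K i j)) has_real_derivative mesh_integral N \<xi> M f') (at t within T)"
    if "\<And>K i j. K \<in> M \<Longrightarrow> i \<le> N \<Longrightarrow> j \<le> N \<Longrightarrow> ((\<lambda>s. f s K i j) has_real_derivative f' K i j) (at t within T)" for f f' t
    unfolding mesh_integral_def using that by (intro DERIV_sum DERIV_cmult) auto
  have "((\<lambda>s. total_entropy \<Gamma> N \<xi> M geo wt (W s)) has_real_derivative
      mesh_integral N \<xi> M (\<lambda>K i j. entropy_var \<Gamma> (prim_of \<Gamma> (Ust \<xi> geo wt (W t) K i j)) \<bullet> Wd t K i j)) (at t within T)"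
    if t: "t \<in> T" for t
    unfolding total_entropy_def
  proof (rule lift)
    fix K i j assume n: "K \<in> M" "i \<le> N" "j \<le> N"
    have "((\<lambda>s. Ust \<xi> geo wt (W s) K i j) has_vector_derivative Wd t K i j /\<^sub>R c K i j) (at t within T)"
      unfolding U by (rule bounded_linear.has_vector_derivative[OF bounded_linear_scaleR_right Wd[OF t n]])
    from eta_has_derivative_along[OF Gam t _ this] adm n
    have "((\<lambda>s. eta \<Gamma> (prim_of \<Gamma> (Ust \<xi> geo wt (W s) K i j))) has_real_derivative
       entropy_var \<Gamma> (prim_of \<Gamma> (Ust \<xi> geo wt (W t) K i j)) \<bullet> (Wd t K i j /\<^sub>R c K i j)) (at t within T)"
      by blast
    from DERIV_cmult[OF this, of "c K i j"]
    have "((\<lambda>s. c K i j * eta \<Gamma> (prim_of \<Gamma> (Ust \<xi> geo wt (W s) K i j))) has_real_derivative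
       c K i j * (entropy_var \<Gamma> (prim_of \<Gamma> (Ust \<xi> geo wt (W t) K i j)) \<bullet> (Wd t K i j /\<^sub>R c K i j))) (at t within T)" .
    moreover have "c K i j * (v \<bullet> (x /\<^sub>R c K i j)) = v \<bullet> x" for v x :: "real^4"
      using c[OF n] by (simp add: mult.assoc[symmetric])
    ultimately show "((\<lambda>s. wn \<xi> wt K i j * j2 (Gn \<xi> geo K i j) * eta \<Gamma> (prim_of \<Gamma> (Ust \<xi> geo wt (W s) K i j))) has_real_derivative
        entropy_var \<Gamma> (prim_of \<Gamma> (Ust \<xi> geo wt (W t) K i j)) \<bullet> Wd t K i j) (at t within T)"
      unfolding c_def[symmetric] by (simp only:)
  qed
  then have entropy: "\<forall>t\<in>T. \<exists>d. ((\<lambda>s. total_entropy \<Gamma> N \<xi> M geo wt (W s)) has_real_derivative d) (at t within T) \<and> d \<le> 0"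
    using nodal_state.entropy_rate[OF st sch] by blast
  have mass_eq: "total_mass \<Gamma> N \<xi> M geo wt (W s) = mesh_integral N \<xi> M (\<lambda>K i j. W s K i j $ 1)" if s: "s \<in> T" for s
  proof -
    have "wn \<xi> wt K i j * j2 (Gn \<xi> geo K i j) * dens (prim_of \<Gamma> (Ust \<xi> geo wt (W s) K i j)) = W s K i j $ 1"
      if n: "K \<in> M" "i \<le> N" "j \<le> N" for K i j
    proof -
      have "dens (prim_of \<Gamma> (Ust \<xi> geo wt (W s) K i j)) = Ust \<xi> geo wt (W s) K i j $ 1"
        using prim_of_admissible(2)[OF Gam adm[OF s n]] cons_nth(1) by metis
      then show ?thesis using c[OF n] unfolding c_def[symmetric] U by simp
    qed
    then show ?thesis unfolding total_mass_def mesh_integral_def by (intro sum.cong refl arg_cong2[of _ _ _ _ "(*)"]) auto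
  qed
  have "((\<lambda>s. mesh_integral N \<xi> M (\<lambda>K i j. W s K i j $ 1)) has_real_derivative 0) (at t within T)" if t: "t \<in> T" for t
  proof -
    have "((\<lambda>s. mesh_integral N \<xi> M (\<lambda>K i j. W s K i j $ 1)) has_real_derivative mesh_integral N \<xi> M (\<lambda>K i j. Wd t K i j $ 1)) (at t within T)"
      by (rule lift) (simp add: has_real_derivative_iff_has_vector_derivative bounded_linear.has_vector_derivative[OF bounded_linear_vec_nth Wd[OF t]])
    then show ?thesis using nodal_state.mass_rate[OF st[OF t] sch[OF t]] by simp
  qed
  then obtain k where "\<forall>s\<in>T. mesh_integral N \<xi> M (\<lambda>K i j. W s K i j $ 1) = k"
    using has_field_derivative_zero_constant[OF is_interval_convex[OF assms(12)]] by blast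
  then have "(\<lambda>s. total_mass \<Gamma> N \<xi> M geo wt (W s)) constant_on T"
    unfolding constant_on_def using mass_eq by auto
  with entropy show ?thesis by blast
qed

end
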